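(* Let $\mathfrak{A}$ be a unital $C^*$-algebra and set $$\mathcal{P}(\mathfrak{A}):=\{p\in\mathfrak{A}\mid p=p^2=p^*\},\qquad \mathcal{U}(\mathfrak{A}):=\{a\in\mathfrak{A}\mid aa^*,\,a^*a\in\mathcal{P}(\mathfrak{A})\}.$$ Then the groupoid $\mathcal{U}(\mathfrak{A})\rightrightarrows\mathcal{P}(\mathfrak{A})$, with target and source maps $\mathbf{t}(a)=aa^*$, $\mathbf{s}(a)=a^*a$, inversion $\mathbf{i}(a)=a^*$, and composition $(a,b)\mapsto ab$ defined when $\mathbf{s}(a)=\mathbf{t}(b)$, is a real analytic Banach-Lie groupoid. Moreover, this groupoid is locally transitive. Its isotropy group at $\mathbf{1}\in\mathcal{P}(\mathfrak{A})$ is the Banach-Lie group of unitary elements of $\mathfrak{A}$.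
   Context: $\mathbf{1}\in\mathfrak{A}$ denotes the unit of the algebra; the isotropy group at $\mathbf{1}$ is $\{a\in\mathcal{U}(\mathfrak{A})\mid\mathbf{s}(a)=\mathbf{t}(a)=\mathbf{1}\}$. A Banach-Lie groupoid is a groupoid $\mathcal{G}\rightrightarrows M$ (source $\mathbf{s}$, target $\mathbf{t}$, multiplication $gh$ defined when $\mathbf{s}(g)=\mathbf{t}(h)$, identity section $M\to\mathcal{G}$, inversion) that is a topological groupoid (continuous structure maps, $\mathbf{s},\mathbf{t}$ open and surjective, identity section an embedding), such that $\mathcal{G}$ and $M$ are Hausdorff Banach manifolds, $\mathbf{s}$ is a surjective submersion (tangent maps surjective with closed complemented kernels), and inversion and multiplication are smooth. It is real analytic if $\mathcal{G}$ and $M$ are real analytic Banach manifolds and the structure maps are real analytic. Here $\mathcal{U}(\mathfrak{A})$ and $\mathcal{P}(\mathfrak{A})$ carry their structures of real analytic submanifolds of the (real) Banach space $\mathfrak{A}$ (with closed complemented tangent spaces). The groupoid is locally transitive if each orbit $\mathcal{G}.x=\{\mathbf{t}(g)\mid g\in\mathbf{s}^{-1}(x)\}$, $x\in M$, is open in $M$. *)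

theory Defs
  imports "HOL-Analysis.Analysis" "HOL-Algebra.Group"
begin

section \<open>Unital C*-algebras\<close>

text \<open>
  The superclass \<^class>\<open>monoid_mult\<close> is used instead of \<^class>\<open>real_normed_algebra_1\<close>
  so that the zero algebra is not excluded; \<^prop>\<open>norm 1 = 1\<close> follows from the C*-identity
  in all other cases.
\<close>

class unital_cstar_algebra = real_normed_algebra + monoid_mult + banach +
  fixes scaleC :: "complex \<Rightarrow> 'a \<Rightarrow> 'a"  (infixr "*\<^sub>C" 75)
    and star :: "'a \<Rightarrow> 'a"  ("(_\<^sup>\<star>)" [1000] 999)
  assumes scaleC_add_right: "c *\<^sub>C (x + y) = c *\<^sub>C x + c *\<^sub>C y"
    and scaleC_add_left: "(c + d) *\<^sub>C x = c *\<^sub>C x + d *\<^sub>C x"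
    and scaleC_scaleC: "c *\<^sub>C (d *\<^sub>C x) = (c * d) *\<^sub>C x"
    and scaleC_of_real: "complex_of_real r *\<^sub>C x = r *\<^sub>R x"
    and norm_scaleC: "norm (c *\<^sub>C x) = cmod c * norm x"
    and scaleC_mult_left: "(c *\<^sub>C x) * y = c *\<^sub>C (x * y)"
    and scaleC_mult_right: "x * (c *\<^sub>C y) = c *\<^sub>C (x * y)"
    and star_star: "(x\<^sup>\<star>)\<^sup>\<star> = x"
    and star_add: "(x + y)\<^sup>\<star> = x\<^sup>\<star> + y\<^sup>\<star>"
    and star_scaleC: "(c *\<^sub>C x)\<^sup>\<star> = cnj c *\<^sub>C x\<^sup>\<star>"
    and star_mult: "(x * y)\<^sup>\<star> = y\<^sup>\<star> * x\<^sup>\<star>"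
    and cstar_identity: "norm (x\<^sup>\<star> * x) = (norm x)\<^sup>2"

definition projections :: "'a::unital_cstar_algebra set" where
  "projections = {p. p = p\<^sup>2 \<and> p\<^sup>2 = p\<^sup>\<star>}"

definition partial_isometries :: "'a::unital_cstar_algebra set" where
  "partial_isometries = {a. a * a\<^sup>\<star> \<in> projections \<and> a\<^sup>\<star> * a \<in> projections}"

definition unitaries :: "'a::unital_cstar_algebra set" where
  "unitaries = {u. u\<^sup>\<star> * u = 1 \<and> u * u\<^sup>\<star> = 1}"


section \<open>Real analytic maps on open subsets of Banach spaces\<close>

text \<open>
  A closed complemented subspace, i.e. a topological direct summand.
\<close>

definition split_subspace :: "'e::banach set \<Rightarrow> bool" where
  "split_subspace F \<longleftrightarrow> (\<exists>P. bounded_linear P \<and> (\<forall>x. P (P x) = P x) \<and> range P = F)"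

text \<open>
  \<open>n\<close>-linear maps \<open>F \<times> \<dots> \<times> F \<rightarrow> 'f\<close>; the argument tuple is the restriction of
  \<open>h\<close> to \<open>{..<n}\<close>, and nothing is required of tuples with entries outside \<open>F\<close>.
\<close>

definition multilinear_on :: "'e::real_vector set \<Rightarrow> nat \<Rightarrow> ((nat \<Rightarrow> 'e) \<Rightarrow> 'f::real_vector) \<Rightarrow> bool" where
  "multilinear_on F n A \<longleftrightarrow>
     (\<forall>h k. (\<forall>i<n. h i = k i) \<longrightarrow> A h = A k) \<and>
     (\<forall>h. (\<forall>i<n. h i \<in> F) \<longrightarrow>
        (\<forall>i<n. (\<forall>v\<in>F. \<forall>w\<in>F. A (h(i := v + w)) = A (h(i := v)) + A (h(i := w))) \<and>
               (\<forall>c. \<forall>v\<in>F. A (h(i := c *\<^sub>R v)) = c *\<^sub>R A (h(i := v)))))"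

text \<open>
  Local expansion \<open>f (x + h) = (\<Sum>n. A n (h, \<dots>, h))\<close> for small \<open>h\<close> in the closed subspace \<open>F\<close>,
  with bounded \<open>n\<close>-linear \<open>A n\<close> and \<open>(\<Sum>n. \<parallel>A n\<parallel> r ^ n) < \<infinity>\<close> for some \<open>r > 0\<close>.
\<close>

definition real_analytic_at :: "'e::banach set \<Rightarrow> 'e \<Rightarrow> ('e \<Rightarrow> 'f::banach) \<Rightarrow> bool" where
  "real_analytic_at F x f \<longleftrightarrow>
     (\<exists>A K. \<exists>r>0.
        (\<forall>n. multilinear_on F n (A n) \<and> 0 \<le> K n \<and>
             (\<forall>h. (\<forall>i<n. h i \<in> F) \<longrightarrow> norm (A n h) \<le> K n * (\<Prod>i<n. norm (h i)))) \<and>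
        summable (\<lambda>n. K n * r ^ n) \<and>
        (\<forall>h\<in>F. norm h < r \<longrightarrow> (\<lambda>n. A n (\<lambda>_. h)) sums f (x + h)))"

text \<open>Used for relatively open subsets \<open>D\<close> of a split subspace \<open>F\<close>.\<close>

definition real_analytic_on :: "'e::banach set \<Rightarrow> 'e set \<Rightarrow> ('e \<Rightarrow> 'f::banach) \<Rightarrow> bool" where
  "real_analytic_on F D f \<longleftrightarrow> (\<forall>x\<in>D. real_analytic_at F x f)"


section \<open>Real analytic Banach manifolds\<close>

text \<open>
  A chart \<open>(U, \<phi>, F)\<close> is a homeomorphism \<open>\<phi>\<close> of the open set \<open>U\<close> onto an open subset of the model
  Banach space \<open>F\<close>. Model spaces are split subspaces of one Banach space \<open>'e\<close> and may differ from
  chart to chart. This is no restriction, since any set of Banach spaces embeds into its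
  \<open>l\<^sup>1\<close>-sum as a set of split subspaces.
\<close>

type_synonym ('m, 'e) chart = "'m set \<times> ('m \<Rightarrow> 'e) \<times> 'e set"

definition is_chart :: "'m topology \<Rightarrow> ('m, 'e::banach) chart \<Rightarrow> bool" where
  "is_chart X = (\<lambda>(U, \<phi>, F).
     openin X U \<and> split_subspace F \<and>
     openin (top_of_set F) (\<phi> ` U) \<and>
     homeomorphic_map (subtopology X U) (top_of_set (\<phi> ` U)) \<phi>)"

definition compatible :: "('m, 'e::banach) chart \<Rightarrow> ('m, 'e) chart \<Rightarrow> bool" where
  "compatible = (\<lambda>(U, \<phi>, F) (V, \<psi>, H).
     real_analytic_on F (\<phi> ` (U \<inter> V)) (\<psi> \<circ> inv_into U \<phi>) \<and>
     real_analytic_on H (\<psi> ` (U \<inter> V)) (\<phi> \<circ> inv_into V \<psi>))"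

record ('m, 'e) manifold =
  mtop :: "'m topology"
  charts :: "('m, 'e) chart set"

definition real_analytic_manifold :: "('m, 'e::banach) manifold \<Rightarrow> bool" where
  "real_analytic_manifold M \<longleftrightarrow>
     Hausdorff_space (mtop M) \<and>
     (\<forall>c\<in>charts M. is_chart (mtop M) c) \<and>
     (\<Union>(U, \<phi>, F)\<in>charts M. U) = topspace (mtop M) \<and>
     (\<forall>c\<in>charts M. \<forall>d\<in>charts M. compatible c d)"

definition maximal_atlas :: "('m, 'e::banach) manifold \<Rightarrow> ('m, 'e) chart set" where
  "maximal_atlas M = {c. is_chart (mtop M) c \<and> (\<forall>d\<in>charts M. compatible c d)}"

definition same_analytic_structure :: "('m, 'e::banach) manifold \<Rightarrow> ('m, 'e) manifold \<Rightarrow> bool" where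
  "same_analytic_structure M N \<longleftrightarrow>
     mtop M = mtop N \<and> (\<forall>c\<in>charts M. \<forall>d\<in>charts N. compatible c d)"

definition real_analytic_map ::
  "('m, 'e::banach) manifold \<Rightarrow> ('n, 'f::banach) manifold \<Rightarrow> ('m \<Rightarrow> 'n) \<Rightarrow> bool" where
  "real_analytic_map M N f \<longleftrightarrow>
     continuous_map (mtop M) (mtop N) f \<and>
     (\<forall>(U, \<phi>, F)\<in>charts M. \<forall>(V, \<psi>, H)\<in>charts N.
        real_analytic_on F (\<phi> ` {x\<in>U. f x \<in> V}) (\<psi> \<circ> f \<circ> inv_into U \<phi>))"

text \<open>
  \<open>D\<close> is the tangent map of \<open>f\<close> at \<open>x\<close> read in charts; it is determined on the model space \<open>F\<close>
  only. A subspace of \<open>F\<close> is split in \<open>F\<close> iff it is split in \<open>'e\<close>, because \<open>F\<close> itself is.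
\<close>

definition submersion ::
  "('m, 'e::banach) manifold \<Rightarrow> ('n, 'f::banach) manifold \<Rightarrow> ('m \<Rightarrow> 'n) \<Rightarrow> bool" where
  "submersion M N f \<longleftrightarrow>
     real_analytic_map M N f \<and>
     (\<forall>(U, \<phi>, F)\<in>charts M. \<forall>(V, \<psi>, H)\<in>charts N. \<forall>x\<in>U. f x \<in> V \<longrightarrow>
        (\<exists>D. ((\<psi> \<circ> f \<circ> inv_into U \<phi>) has_derivative D) (at (\<phi> x) within \<phi> ` {y\<in>U. f y \<in> V}) \<and>
             D ` F = H \<and> split_subspace {h\<in>F. D h = 0}))"

definition prod_manifold ::
  "('m, 'e::banach) manifold \<Rightarrow> ('n, 'f::banach) manifold \<Rightarrow> ('m \<times> 'n, 'e \<times> 'f) manifold" where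
  "prod_manifold M N =
     \<lparr>mtop = prod_topology (mtop M) (mtop N),
      charts = {(U \<times> V, map_prod \<phi> \<psi>, F \<times> H) | U \<phi> F V \<psi> H. (U, \<phi>, F) \<in> charts M \<and> (V, \<psi>, H) \<in> charts N}\<rparr>"

definition banach_space_manifold :: "('e::banach, 'e) manifold" where
  "banach_space_manifold = \<lparr>mtop = euclidean, charts = {(UNIV, id, UNIV)}\<rparr>"

text \<open>
  A chart \<open>(U, \<phi>, F)\<close> of \<open>M\<close> that straightens \<open>S\<close> to a closed complemented subspace \<open>F'\<close> of \<open>F\<close>
  restricts to a chart of \<open>S\<close>.
\<close>

definition submanifold :: "('m, 'e::banach) manifold \<Rightarrow> 'm set \<Rightarrow> ('m, 'e) manifold" where
  "submanifold M S =
     \<lparr>mtop = subtopology (mtop M) S,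
      charts = {(U \<inter> S, \<phi>, F') | U \<phi> F F'. (U, \<phi>, F) \<in> maximal_atlas M \<and>
                  split_subspace F' \<and> F' \<subseteq> F \<and> \<phi> ` (U \<inter> S) = \<phi> ` U \<inter> F'}\<rparr>"

definition is_submanifold :: "('m, 'e::banach) manifold \<Rightarrow> 'm set \<Rightarrow> bool" where
  "is_submanifold M S \<longleftrightarrow>
     S \<subseteq> topspace (mtop M) \<and> (\<Union>(U, \<phi>, F)\<in>charts (submanifold M S). U) = S"


section \<open>Real analytic Banach-Lie groups and groupoids\<close>

definition real_analytic_Banach_Lie_group :: "'g monoid \<Rightarrow> ('g, 'e::banach) manifold \<Rightarrow> bool" where
  "real_analytic_Banach_Lie_group G M \<longleftrightarrow>
     Group.group G \<and> real_analytic_manifold M \<and> topspace (mtop M) = carrier G \<and>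
     real_analytic_map (prod_manifold M M) M (\<lambda>(x, y). x \<otimes>\<^bsub>G\<^esub> y) \<and>
     real_analytic_map M M (\<lambda>x. m_inv G x)"

record ('g, 'm) groupoid =
  arrows :: "'g set"
  objects :: "'m set"
  source :: "'g \<Rightarrow> 'm"
  target :: "'g \<Rightarrow> 'm"
  gmult :: "'g \<Rightarrow> 'g \<Rightarrow> 'g"
  identity :: "'m \<Rightarrow> 'g"
  inversion :: "'g \<Rightarrow> 'g"

definition composable :: "('g, 'm) groupoid \<Rightarrow> ('g \<times> 'g) set" where
  "composable \<G> = {(g, h). g \<in> arrows \<G> \<and> h \<in> arrows \<G> \<and> source \<G> g = target \<G> h}"

definition is_groupoid :: "('g, 'm) groupoid \<Rightarrow> bool" where
  "is_groupoid \<G> \<longleftrightarrow>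
     source \<G> \<in> arrows \<G> \<rightarrow> objects \<G> \<and> target \<G> \<in> arrows \<G> \<rightarrow> objects \<G> \<and>
     identity \<G> \<in> objects \<G> \<rightarrow> arrows \<G> \<and> inversion \<G> \<in> arrows \<G> \<rightarrow> arrows \<G> \<and>
     (\<forall>(g, h)\<in>composable \<G>. gmult \<G> g h \<in> arrows \<G> \<and>
        source \<G> (gmult \<G> g h) = source \<G> h \<and> target \<G> (gmult \<G> g h) = target \<G> g) \<and>
     (\<forall>g h k. (g, h) \<in> composable \<G> \<longrightarrow> (h, k) \<in> composable \<G> \<longrightarrow>
        gmult \<G> (gmult \<G> g h) k = gmult \<G> g (gmult \<G> h k)) \<and>
     (\<forall>x\<in>objects \<G>. source \<G> (identity \<G> x) = x \<and> target \<G> (identity \<G> x) = x) \<and>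
     (\<forall>g\<in>arrows \<G>.
        gmult \<G> (identity \<G> (target \<G> g)) g = g \<and> gmult \<G> g (identity \<G> (source \<G> g)) = g \<and>
        source \<G> (inversion \<G> g) = target \<G> g \<and> target \<G> (inversion \<G> g) = source \<G> g \<and>
        gmult \<G> (inversion \<G> g) g = identity \<G> (source \<G> g) \<and>
        gmult \<G> g (inversion \<G> g) = identity \<G> (target \<G> g))"

definition topological_groupoid :: "('g, 'm) groupoid \<Rightarrow> 'g topology \<Rightarrow> 'm topology \<Rightarrow> bool" where
  "topological_groupoid \<G> X Y \<longleftrightarrow>
     is_groupoid \<G> \<and> topspace X = arrows \<G> \<and> topspace Y = objects \<G> \<and>
     continuous_map X Y (source \<G>) \<and> continuous_map X Y (target \<G>) \<and>
     open_map X Y (source \<G>) \<and> open_map X Y (target \<G>) \<and>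
     source \<G> ` arrows \<G> = objects \<G> \<and> target \<G> ` arrows \<G> = objects \<G> \<and>
     embedding_map Y X (identity \<G>) \<and>
     continuous_map X X (inversion \<G>) \<and>
     continuous_map (subtopology (prod_topology X X) (composable \<G>)) X (\<lambda>(g, h). gmult \<G> g h)"

text \<open>
  Since real analytic maps are smooth, the real analyticity conditions contain the smoothness
  conditions on inversion, multiplication and the atlases of a Banach-Lie groupoid. The composable
  pairs form a submanifold of the product because the source map is a submersion; this is listed
  as a separate conjunct so that analyticity of the multiplication, which refers to the charts of
  that submanifold, is never vacuous.
\<close>

definition real_analytic_Banach_Lie_groupoid ::
  "('g, 'm) groupoid \<Rightarrow> ('g, 'e::banach) manifold \<Rightarrow> ('m, 'f::banach) manifold \<Rightarrow> bool" where
  "real_analytic_Banach_Lie_groupoid \<G> G M \<longleftrightarrow>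
     topological_groupoid \<G> (mtop G) (mtop M) \<and>
     real_analytic_manifold G \<and> real_analytic_manifold M \<and>
     submersion G M (source \<G>) \<and>
     real_analytic_map G M (target \<G>) \<and>
     real_analytic_map M G (identity \<G>) \<and>
     real_analytic_map G G (inversion \<G>) \<and>
     is_submanifold (prod_manifold G G) (composable \<G>) \<and>
     real_analytic_map (submanifold (prod_manifold G G) (composable \<G>)) G (\<lambda>(g, h). gmult \<G> g h)"

definition orbit :: "('g, 'm) groupoid \<Rightarrow> 'm \<Rightarrow> 'm set" where
  "orbit \<G> x = {target \<G> g | g. g \<in> arrows \<G> \<and> source \<G> g = x}"

definition locally_transitive :: "('g, 'm) groupoid \<Rightarrow> 'm topology \<Rightarrow> bool" where
  "locally_transitive \<G> Y \<longleftrightarrow> (\<forall>x\<in>objects \<G>. openin Y (orbit \<G> x))"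

definition isotropy_group :: "('g, 'm) groupoid \<Rightarrow> 'm \<Rightarrow> 'g monoid" where
  "isotropy_group \<G> x =
     \<lparr>carrier = {g\<in>arrows \<G>. source \<G> g = x \<and> target \<G> g = x},
      monoid.mult = gmult \<G>, one = identity \<G> x\<rparr>"


section \<open>The groupoid of partial isometries\<close>

definition partial_isometry_groupoid :: "('a::unital_cstar_algebra, 'a) groupoid" where
  "partial_isometry_groupoid =
     \<lparr>arrows = partial_isometries, objects = projections,
      source = (\<lambda>a. a\<^sup>\<star> * a), target = (\<lambda>a. a * a\<^sup>\<star>),
      gmult = (*), identity = (\<lambda>p. p), inversion = star\<rparr>"

definition unitary_group :: "'a::unital_cstar_algebra monoid" where
  "unitary_group = \<lparr>carrier = unitaries, monoid.mult = (*), one = 1\<rparr>"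

definition projection_manifold :: "('a::unital_cstar_algebra, 'a) manifold" where
  "projection_manifold = submanifold banach_space_manifold projections"

definition partial_isometry_manifold :: "('a::unital_cstar_algebra, 'a) manifold" where
  "partial_isometry_manifold = submanifold banach_space_manifold partial_isometries"

definition unitary_manifold :: "('a::unital_cstar_algebra, 'a) manifold" where
  "unitary_manifold = submanifold banach_space_manifold unitaries"

end

theory Submission
  imports Defs
begin

text \<open>
  Every chart is explicit, so that no implicit function theorem enters. Let \<open>a\<close> be a partial
  isometry, \<open>p = a\<^sup>\<star> a\<close> and \<open>q = a a\<^sup>\<star>\<close>. An element \<open>v\<close> near \<open>a\<close> is a \<open>2 \<times> 2\<close> block matrix
  relative to \<open>q\<close>, \<open>1 - q\<close> on the left and \<open>p\<close>, \<open>1 - p\<close> on the right. Its \<open>q\<close>-\<open>p\<close> block is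
  invertible, and Gaussian elimination gives \<open>v = (a + y) k (p + x) + e\<close> with
  \<open>y \<in> (1 - q) A p\<close>, \<open>k \<in> p A p\<close>, \<open>x \<in> p A (1 - p)\<close> and \<open>e \<in> (1 - q) A (1 - p)\<close>. Such a \<open>v\<close> is a
  partial isometry iff \<open>e = 0\<close> and \<open>k (1 + x x\<^sup>\<star>) k\<^sup>\<star> (1 + y\<^sup>\<star> y) = p\<close>, that is, iff \<open>e = 0\<close> and
  \<open>w = (1 + y\<^sup>\<star> y)\<^sup>1\<^sup>/\<^sup>2 k (1 + x x\<^sup>\<star>)\<^sup>1\<^sup>/\<^sup>2\<close> is unitary in \<open>p A p\<close>. The Cayley transform
  \<open>c = (w - p) (w + p)\<^sup>-\<^sup>1\<close> turns the last condition into the real linear one \<open>c\<^sup>\<star> = - c\<close>.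
  Hence \<open>v \<mapsto> (y, x, c, e)\<close> straightens the set of partial isometries near \<open>a\<close>
  (\<open>pi_chart_straightens\<close>).

  The same coordinates serve all the other submanifolds. At a projection \<open>a = p\<close> the projections
  are given by \<open>e = 0\<close>, \<open>c = 0\<close> and \<open>y = x\<^sup>\<star>\<close> (\<open>projection_chart_straightens\<close>). The coordinate
  \<open>x\<close> determines \<open>v\<^sup>\<star> v\<close> and \<open>y\<close> determines \<open>v v\<^sup>\<star>\<close>, so that near \<open>(a, b)\<close> with
  \<open>a\<^sup>\<star> a = b b\<^sup>\<star>\<close> composability of \<open>(g, h)\<close> is the linear equation
  \<open>x\<^sub>g\<^sup>\<star> = y\<^sub>h b\<^sup>\<star>\<close> (\<open>composable_in_charts\<close>). The unitaries are the partial isometries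
  with \<open>\<parallel>1 - v\<^sup>\<star> v\<parallel> < 1\<close> and \<open>\<parallel>1 - v v\<^sup>\<star>\<parallel> < 1\<close>, an open set, because a projection of norm less
  than \<open>1\<close> vanishes.

  The map \<open>\<sigma>(q') = a (p q' p)\<^sup>-\<^sup>1\<^sup>/\<^sup>2 q'\<close>, with the power taken in \<open>p A p\<close>, is an analytic local
  section of the source map with \<open>\<sigma>(p) = a\<close> and constant target (\<open>source_section\<close>). Such
  sections make the source map an open submersion and the orbits open.

  All structure maps are restrictions of polynomial maps on the algebra, and charts of submanifolds
  of a Banach space and their inverses are analytic as maps between ambient spaces. The analyticity
  claims for arbitrary charts therefore reduce to one fact about power series with multilinear
  coefficients: they can be substituted into each other (\<open>real_analytic_at_compose_expansion\<close>).
\<close>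

section \<open>Multi-indexed sums\<close>

text \<open>
  The composition of two power series is a sum over lists of degrees. It is regrouped along two
  index maps: the length of the list gives the value of the outer series, the sum of the list
  gives the total degree.
\<close>

lemma has_sum_fibres:
  fixes f :: "'i \<Rightarrow> 'c::banach"
  assumes "(f has_sum S) UNIV" and "\<And>n. (f has_sum g n) {i. \<phi> i = n}"
  shows "(g has_sum S) UNIV"
proof (rule has_sum_SigmaD)
  have bij: "bij_betw snd (Sigma UNIV (\<lambda>n. {i. \<phi> i = n})) UNIV"
    by (force simp: bij_betw_def inj_on_def)
  show "((\<lambda>z. f (snd z)) has_sum S) (Sigma UNIV (\<lambda>n. {i. \<phi> i = n}))"
    using assms(1) by (simp add: has_sum_reindex_bij_betw[OF bij])
qed (use assms(2) in auto)

lemma summable_on_fibresI: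
  fixes f :: "'i \<Rightarrow> real"
  assumes "\<And>n. (f has_sum g n) {i. \<phi> i = n}" and "g summable_on UNIV" and "\<And>i. f i \<ge> 0"
  shows "f summable_on UNIV"
proof -
  have bij: "bij_betw snd (Sigma UNIV (\<lambda>n. {i. \<phi> i = n})) UNIV"
    by (force simp: bij_betw_def inj_on_def)
  have "(\<lambda>z. f (snd z)) summable_on (Sigma UNIV (\<lambda>n. {i. \<phi> i = n}))"
    by (rule summable_on_SigmaI[where g = g]) (use assms in auto)
  then show ?thesis
    by (simp add: summable_on_reindex_bij_betw[OF bij])
qed

lemma bij_betw_snoc:
  "bij_betw (\<lambda>(ns, n). ns @ [n]) ({ns. length ns = m} \<times> UNIV) {ns. length ns = Suc m}"
  by (rule bij_betw_byWitness[where f' = "\<lambda>ns. (butlast ns, last ns)"])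
     (auto simp: length_Suc_conv_rev)

lemma has_sum_prod_list:
  fixes \<kappa> :: "nat \<Rightarrow> real"
  assumes "(\<kappa> has_sum \<tau>) UNIV" and "\<And>n. \<kappa> n \<ge> 0"
  shows "((\<lambda>ns. prod_list (map \<kappa> ns)) has_sum \<tau> ^ m) {ns. length ns = m}"
proof (induction m)
  case 0
  have "{ns::nat list. length ns = 0} = {[]}" by auto
  then show ?case by (simp add: has_sum_finite_iff)
next
  case (Suc m)
  have nonneg: "prod_list (map \<kappa> ns) \<ge> 0" for ns
    by (induction ns) (auto simp: assms(2))
  let ?f = "\<lambda>(ns, n). prod_list (map \<kappa> ns) * \<kappa> n"
  have inner: "((\<lambda>n. ?f (ns, n)) has_sum prod_list (map \<kappa> ns) * \<tau>) UNIV" for ns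
    using has_sum_cmult_right[OF assms(1)] by simp
  have outer: "((\<lambda>ns. prod_list (map \<kappa> ns) * \<tau>) has_sum \<tau> ^ m * \<tau>) {ns. length ns = m}"
    by (rule has_sum_cmult_left[OF Suc])
  have "?f summable_on ({ns. length ns = m} \<times> UNIV)"
    by (rule summable_on_SigmaI[OF inner has_sum_imp_summable[OF outer]])
       (use nonneg assms(2) in auto)
  then have "(?f has_sum \<tau> ^ m * \<tau>) ({ns. length ns = m} \<times> UNIV)"
    by (rule has_sum_SigmaI[OF inner outer])
  then have "((\<lambda>z. prod_list (map \<kappa> (case z of (ns, n) \<Rightarrow> ns @ [n]))) has_sum \<tau> ^ m * \<tau>)
      ({ns. length ns = m} \<times> UNIV)"
    by (simp add: case_prod_unfold)
  then show ?case
    by (simp only: has_sum_reindex_bij_betw[OF bij_betw_snoc, of "\<lambda>ns. prod_list (map \<kappa> ns)"]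
        power_Suc2)
qed

section \<open>Bounded multilinear maps\<close>

definition bounded_multilinear_on ::
  "'e::real_normed_vector set \<Rightarrow> nat \<Rightarrow> real \<Rightarrow> ((nat \<Rightarrow> 'e) \<Rightarrow> 'f::real_normed_vector) \<Rightarrow> bool" where
  "bounded_multilinear_on F n K A \<longleftrightarrow>
     multilinear_on F n A \<and> 0 \<le> K \<and>
     (\<forall>h. (\<forall>i<n. h i \<in> F) \<longrightarrow> norm (A h) \<le> K * (\<Prod>i<n. norm (h i)))"

lemma bounded_multilinear_onD:
  assumes "bounded_multilinear_on F n K A"
  shows bounded_multilinear_on_cong: "(\<And>i. i < n \<Longrightarrow> h i = k i) \<Longrightarrow> A h = A k"
    and bounded_multilinear_on_add: "\<lbrakk>\<And>j. j < n \<Longrightarrow> h j \<in> F; i < n; v \<in> F; w \<in> F\<rbrakk>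
      \<Longrightarrow> A (h(i := v + w)) = A (h(i := v)) + A (h(i := w))"
    and bounded_multilinear_on_scaleR: "\<lbrakk>\<And>j. j < n \<Longrightarrow> h j \<in> F; i < n; v \<in> F\<rbrakk>
      \<Longrightarrow> A (h(i := c *\<^sub>R v)) = c *\<^sub>R A (h(i := v))"
    and bounded_multilinear_on_nonneg: "0 \<le> K"
    and bounded_multilinear_on_bound: "(\<And>i. i < n \<Longrightarrow> h i \<in> F)
      \<Longrightarrow> norm (A h) \<le> K * (\<Prod>i<n. norm (h i))"
  using assms unfolding bounded_multilinear_on_def multilinear_on_def by meson+

lemma bounded_multilinear_onI:
  assumes "\<And>h k. (\<And>i. i < n \<Longrightarrow> h i = k i) \<Longrightarrow> A h = A k"
    and "\<And>h i v w. \<lbrakk>\<And>j. j < n \<Longrightarrow> h j \<in> F; i < n; v \<in> F; w \<in> F\<rbrakk>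
      \<Longrightarrow> A (h(i := v + w)) = A (h(i := v)) + A (h(i := w))"
    and "\<And>h i v c. \<lbrakk>\<And>j. j < n \<Longrightarrow> h j \<in> F; i < n; v \<in> F\<rbrakk>
      \<Longrightarrow> A (h(i := c *\<^sub>R v)) = c *\<^sub>R A (h(i := v))"
    and "0 \<le> K"
    and "\<And>h. (\<And>i. i < n \<Longrightarrow> h i \<in> F) \<Longrightarrow> norm (A h) \<le> K * (\<Prod>i<n. norm (h i))"
  shows "bounded_multilinear_on F n K A"
  unfolding bounded_multilinear_on_def multilinear_on_def
  using assms by (intro conjI allI impI ballI) blast+

lemma bounded_multilinear_on_slot:
  assumes "bounded_multilinear_on UNIV n K A" and "i < n"
  shows "bounded_linear (\<lambda>v. A (h(i := v)))"
proof (rule bounded_linear_intro)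
  show "A (h(i := v + w)) = A (h(i := v)) + A (h(i := w))" for v w
    by (rule bounded_multilinear_on_add[OF assms(1)]) (use assms in auto)
  show "A (h(i := c *\<^sub>R v)) = c *\<^sub>R A (h(i := v))" for c v
    by (rule bounded_multilinear_on_scaleR[OF assms(1)]) (use assms in auto)
  show "norm (A (h(i := v))) \<le> norm v * (K * (\<Prod>j\<in>{..<n} - {i}. norm (h j)))" for v
  proof -
    have "norm (A (h(i := v))) \<le> K * (\<Prod>j<n. norm ((h(i := v)) j))"
      by (rule bounded_multilinear_on_bound[OF assms(1)]) auto
    also have "(\<Prod>j<n. norm ((h(i := v)) j)) = norm v * (\<Prod>j\<in>{..<n} - {i}. norm (h j))"
      using assms(2) by (subst prod.remove[of _ i]) auto
    finally show ?thesis by (simp only: mult_ac)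
  qed
qed

text \<open>
  The \<open>m\<close> arguments are expanded one slot at a time: each step is a bounded linear map applied to
  a convergent series, and the product majorant permits the exchange of the two summations.
\<close>

lemma has_sum_bounded_multilinear:
  fixes a :: "nat \<Rightarrow> 'e::banach" and B :: "(nat \<Rightarrow> 'e) \<Rightarrow> 'f::banach"
  assumes B: "bounded_multilinear_on UNIV m L B"
    and a: "(a has_sum k) UNIV"
    and \<kappa>: "(\<kappa> has_sum \<tau>) UNIV" "\<And>n. norm (a n) \<le> \<kappa> n"
  shows "((\<lambda>ns. B (\<lambda>i. a (ns ! i))) has_sum B (\<lambda>_. k)) {ns. length ns = m}"
proof -
  have \<kappa>0: "\<kappa> n \<ge> 0" for n
    by (rule order_trans[OF norm_ge_zero \<kappa>(2)])
  \<comment> \<open>In \<open>?G u j ns\<close> the first \<open>j\<close> slots are already expanded, the others hold \<open>u\<close>.\<close>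
  let ?G = "\<lambda>u j ns i. if i < j then a (ns ! i) else u i"
  have "((\<lambda>ns. B (?G u j ns)) has_sum B (\<lambda>i. if i < j then k else u i)) {ns. length ns = j}"
    if "j \<le> m" for u j
    using that
  proof (induction j arbitrary: u)
    case 0
    have "{ns::nat list. length ns = 0} = {[]}" by auto
    then show ?case by (simp add: has_sum_finite_iff)
  next
    case (Suc j)
    let ?f = "\<lambda>(ns, n). B (?G (u(j := a n)) j ns)"
    have inner: "((\<lambda>n. ?f (ns, n)) has_sum B (?G (u(j := k)) j ns)) UNIV" for ns
    proof -
      have upd: "?G (u(j := v)) j ns = (?G u j ns)(j := v)" for v
        by auto
      show ?thesis
        using has_sum_bounded_linear[OF bounded_multilinear_on_slot[OF B, of j "?G u j ns"] a] Suc.prems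
        by (simp add: upd)
    qed
    have outer: "((\<lambda>ns. B (?G (u(j := k)) j ns)) has_sum
        B (\<lambda>i. if i < j then k else (u(j := k)) i)) {ns. length ns = j}"
      using Suc by simp
    let ?C = "L * (\<Prod>i\<in>{Suc j..<m}. norm (u i))"
    have bound: "norm (?f (ns, n)) \<le> ?C * (prod_list (map \<kappa> ns) * \<kappa> n)" if "length ns = j" for ns n
    proof -
      have "(\<Prod>i<m. norm (?G (u(j := a n)) j ns i)) =
          (\<Prod>i<j. norm (a (ns ! i))) * norm (a n) * (\<Prod>i\<in>{Suc j..<m}. norm (u i))"
      proof -
        have "prod w {..<m} = prod w {..<j} * w j * prod w {Suc j..<m}" for w :: "nat \<Rightarrow> real"
        proof -
          have "{..<m} = {..<j} \<union> {j..<m}" using Suc.prems by auto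
          then have "prod w {..<m} = prod w {..<j} * prod w {j..<m}"
            by (simp only: prod.union_disjoint finite_lessThan finite_atLeastLessThan ivl_disj_int)
          then show ?thesis
            using Suc.prems by (simp add: prod.atLeast_Suc_lessThan mult.assoc)
        qed
        then show ?thesis by simp
      qed
      also have "\<dots> \<le> (prod_list (map \<kappa> ns) * \<kappa> n) * (\<Prod>i\<in>{Suc j..<m}. norm (u i))"
      proof -
        have "(\<Prod>i<j. norm (a (ns ! i))) \<le> (\<Prod>i<j. \<kappa> (ns ! i))"
          by (intro prod_mono) (auto intro: \<kappa>)
        also have "(\<Prod>i<j. \<kappa> (ns ! i)) = prod_list (map \<kappa> ns)"
          using that by (simp add: prod.list_conv_set_nth atLeast0LessThan)
        finally show ?thesis
          using \<kappa>(2) \<kappa>0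
          by (intro mult_right_mono mult_mono prod_nonneg prod_list_nonneg) auto
      qed
      finally have "L * (\<Prod>i<m. norm (?G (u(j := a n)) j ns i)) \<le>
          L * (prod_list (map \<kappa> ns) * \<kappa> n * (\<Prod>i\<in>{Suc j..<m}. norm (u i)))"
        by (rule mult_left_mono) (rule bounded_multilinear_on_nonneg[OF B])
      also have "\<dots> = ?C * (prod_list (map \<kappa> ns) * \<kappa> n)"
        by (simp only: mult_ac)
      finally have "L * (\<Prod>i<m. norm (?G (u(j := a n)) j ns i)) \<le> ?C * (prod_list (map \<kappa> ns) * \<kappa> n)" .
      moreover have "norm (?f (ns, n)) \<le> L * (\<Prod>i<m. norm (?G (u(j := a n)) j ns i))"
        by (auto intro!: bounded_multilinear_on_bound[OF B])
      ultimately show ?thesis by linarith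
    qed
    have "?f summable_on ({ns. length ns = j} \<times> UNIV)"
    proof (rule abs_summable_summable, rule Infinite_Sum.abs_summable_on_comparison_test')
      have "(\<lambda>z. case z of (ns, n) \<Rightarrow> prod_list (map \<kappa> ns) * \<kappa> n) summable_on ({ns. length ns = j} \<times> UNIV)"
      proof (rule summable_on_SigmaI)
        show "((\<lambda>n. case (ns, n) of (ns, n) \<Rightarrow> prod_list (map \<kappa> ns) * \<kappa> n) has_sum prod_list (map \<kappa> ns) * \<tau>) UNIV" for ns
          using has_sum_cmult_right[OF \<kappa>(1)] by simp
        show "(\<lambda>ns. prod_list (map \<kappa> ns) * \<tau>) summable_on {ns. length ns = j}"
          by (intro summable_on_cmult_left has_sum_imp_summable[OF has_sum_prod_list[OF \<kappa>(1) \<kappa>0]])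
      qed (auto intro!: mult_nonneg_nonneg prod_list_nonneg \<kappa>0)
      from summable_on_cmult_right[OF this, of ?C]
      show "(\<lambda>(ns, n). ?C * (prod_list (map \<kappa> ns) * \<kappa> n)) summable_on ({ns. length ns = j} \<times> UNIV)"
        by (simp add: case_prod_unfold)
    qed (use bound in auto)
    then have "(?f has_sum B (\<lambda>i. if i < j then k else (u(j := k)) i)) ({ns. length ns = j} \<times> UNIV)"
      by (rule has_sum_SigmaI[OF inner outer])
    also have "(\<lambda>i. if i < j then k else (u(j := k)) i) = (\<lambda>i. if i < Suc j then k else u i)"
      by (auto simp: less_Suc_eq)
    finally have "((\<lambda>z. B (?G u (Suc j) (case z of (ns, n) \<Rightarrow> ns @ [n]))) has_sum
        B (\<lambda>i. if i < Suc j then k else u i)) ({ns. length ns = j} \<times> UNIV)"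
      by (rule has_sum_cong[THEN iffD1, rotated])
         (auto simp: nth_append less_Suc_eq intro!: arg_cong[where f = B])
    then show ?case
      by (simp only: has_sum_reindex_bij_betw[OF bij_betw_snoc, of "\<lambda>ns. B (?G u (Suc j) ns)"])
  qed
  from this[of m a] have "((\<lambda>ns. B (?G a m ns)) has_sum B (\<lambda>i. if i < m then k else a i)) {ns. length ns = m}"
    by simp
  moreover have "B (?G a m ns) = B (\<lambda>i. a (ns ! i))" for ns
    by (rule bounded_multilinear_on_cong[OF B]) auto
  moreover have "B (\<lambda>i. if i < m then k else a i) = B (\<lambda>_. k)"
    by (rule bounded_multilinear_on_cong[OF B]) auto
  ultimately show ?thesis by simp
qed

section \<open>Composition of power series\<close>

text \<open>
  Real analyticity with its witnesses made explicit: the composition theorem needs control of the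
  majorant \<open>\<Sum>n. K n * r ^ n\<close>.
\<close>

definition power_expansion ::
  "'e::banach set \<Rightarrow> (nat \<Rightarrow> (nat \<Rightarrow> 'e) \<Rightarrow> 'f::banach) \<Rightarrow> (nat \<Rightarrow> real) \<Rightarrow> real \<Rightarrow> 'e \<Rightarrow> ('e \<Rightarrow> 'f) \<Rightarrow> bool"
  where
  "power_expansion F A K r x f \<longleftrightarrow>
     0 < r \<and> (\<forall>n. bounded_multilinear_on F n (K n) (A n)) \<and> summable (\<lambda>n. K n * r ^ n) \<and>
     (\<forall>h\<in>F. norm h < r \<longrightarrow> (\<lambda>n. A n (\<lambda>_. h)) sums f (x + h))"

lemma real_analytic_at_iff: "real_analytic_at F x f \<longleftrightarrow> (\<exists>A K r. power_expansion F A K r x f)"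
  unfolding real_analytic_at_def power_expansion_def bounded_multilinear_on_def by blast

text \<open>
  A tuple of length \<open>sum_list ns\<close> is cut into consecutive blocks of lengths \<open>ns ! 0\<close>, \<open>ns ! 1\<close>, \<dots>.
\<close>

definition block :: "nat list \<Rightarrow> (nat \<Rightarrow> 'e) \<Rightarrow> nat \<Rightarrow> nat \<Rightarrow> 'e" where
  "block ns h i j = h (sum_list (take i ns) + j)"

lemma sum_list_take_mono: "i \<le> j \<Longrightarrow> sum_list (take i ns) \<le> sum_list (take j (ns :: nat list))"
  by (metis append_take_drop_id le_add1 min.absorb1 sum_list_append take_take)

lemma sum_list_take_Suc:
  "i < length ns \<Longrightarrow> sum_list (take (Suc i) ns) = sum_list (take i ns) + (ns ! i :: nat)"
  by (simp add: take_Suc_conv_app_nth)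

lemma block_index_less:
  assumes "i < length ns" "j < ns ! i"
  shows "sum_list (take i ns) + j < sum_list (ns :: nat list)"
  using sum_list_take_Suc[OF assms(1)] sum_list_take_mono[of "Suc i" "length ns" ns] assms by simp

lemma block_index_unique:
  assumes "i < length ns" "j < ns ! i" "i' < length ns" "j' < ns ! i'"
    and "sum_list (take i ns) + j = sum_list (take i' ns) + (j' :: nat)"
  shows "i = i' \<and> j = j'"
proof -
  have less: "sum_list (take a ns) + b < sum_list (take a' ns) + b'"
    if "a < a'" "a' < length ns" "b < ns ! a" for a a' b b'
    using sum_list_take_Suc[of a ns] sum_list_take_mono[of "Suc a" a' ns] that by simp
  show ?thesis
    using less[of i i' j j'] less[of i' i j' j] assms by (cases i i' rule: linorder_cases) auto
qed

lemma block_index_exists: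
  "l < sum_list (ns :: nat list) \<Longrightarrow> \<exists>i<length ns. \<exists>j<ns ! i. l = sum_list (take i ns) + j"
proof (induction ns rule: rev_induct)
  case (snoc n ns)
  show ?case
  proof (cases "l < sum_list ns")
    case True
    with snoc.IH obtain i j where "i < length ns" "j < ns ! i" "l = sum_list (take i ns) + j"
      by blast
    then show ?thesis
      by (intro exI[of _ i] conjI exI[of _ j]) (auto simp: nth_append)
  next
    case False
    then show ?thesis
      using snoc.prems
      by (intro exI[of _ "length ns"] conjI exI[of _ "l - sum_list ns"]) (auto simp: nth_append)
  qed
qed simp

lemma prod_blocks:
  fixes w :: "nat \<Rightarrow> real"
  shows "(\<Prod>i<length ns. \<Prod>j<ns ! i. w (sum_list (take i ns) + j)) = (\<Prod>l<sum_list ns. w l)"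
proof (induction ns rule: rev_induct)
  case (snoc n ns)
  have "(\<Prod>l<a + b. w l) = (\<Prod>l<a. w l) * (\<Prod>j<b. w (a + j))" for a b
    by (induction b) (auto simp: mult_ac)
  then show ?case
    using snoc by (simp add: nth_append)
qed simp

text \<open>
  The multilinear map of degree \<open>sum_list ns\<close> that arises when the homogeneous terms of degrees
  \<open>ns ! 0\<close>, \<open>ns ! 1\<close>, \<dots> of the inner series are substituted into the outer coefficient of degree
  \<open>length ns\<close>.
\<close>

definition composition_term ::
  "(nat \<Rightarrow> (nat \<Rightarrow> 'e) \<Rightarrow> 'f) \<Rightarrow> (nat \<Rightarrow> (nat \<Rightarrow> 'f) \<Rightarrow> 'g) \<Rightarrow> nat list \<Rightarrow> (nat \<Rightarrow> 'e) \<Rightarrow> 'g" where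
  "composition_term A B ns h = B (length ns) (\<lambda>i. A (ns ! i) (block ns h i))"

lemma bounded_multilinear_on_composition_term:
  assumes A: "\<And>n. bounded_multilinear_on F n (K n) (A n)"
    and B: "\<And>m. bounded_multilinear_on UNIV m (L m) (B m)"
  shows "bounded_multilinear_on F (sum_list ns) (L (length ns) * prod_list (map K ns))
           (composition_term A B ns)"
proof -
  let ?m = "length ns"
  let ?g = "\<lambda>h i. A (ns ! i) (block ns h i)"
  have block_F: "block ns h i j \<in> F"
    if "\<And>l. l < sum_list ns \<Longrightarrow> h l \<in> F" "i < ?m" "j < ns ! i" for h i j
    using that by (simp add: block_def block_index_less)
  \<comment> \<open>An entry of the concatenated tuple lies in exactly one block.\<close>
  have slot: "\<exists>i<?m. \<exists>j<ns ! i. \<forall>v. composition_term A B ns (h(l := v)) =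
      B ?m ((?g h)(i := A (ns ! i) ((block ns h i)(j := v))))" if l: "l < sum_list ns" for h l
  proof -
    obtain i j where ij: "i < ?m" "j < ns ! i" "l = sum_list (take i ns) + j"
      using block_index_exists[OF l] by blast
    have "?g (h(l := v)) i' = ((?g h)(i := A (ns ! i) ((block ns h i)(j := v)))) i'"
      if "i' < ?m" for i' v
    proof (cases "i' = i")
      case True
      have "A (ns ! i) (block ns (h(l := v)) i) = A (ns ! i) ((block ns h i)(j := v))"
        by (rule bounded_multilinear_on_cong[OF A]) (auto simp: block_def ij(3))
      with True show ?thesis by simp
    next
      case False
      have "A (ns ! i') (block ns (h(l := v)) i') = A (ns ! i') (block ns h i')"
      proof (rule bounded_multilinear_on_cong[OF A])
        fix j' assume "j' < ns ! i'"
        then have "sum_list (take i' ns) + j' \<noteq> l"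
          using False block_index_unique[OF ij(1,2) that, of j'] ij(3) by auto
        then show "block ns (h(l := v)) i' j' = block ns h i' j'"
          by (simp add: block_def)
      qed
      with False show ?thesis by simp
    qed
    then have "composition_term A B ns (h(l := v)) =
        B ?m ((?g h)(i := A (ns ! i) ((block ns h i)(j := v))))" for v
      unfolding composition_term_def by (intro bounded_multilinear_on_cong[OF B])
    with ij show ?thesis by blast
  qed
  show ?thesis
  proof (rule bounded_multilinear_onI)
    fix h k :: "nat \<Rightarrow> 'a" assume "\<And>i. i < sum_list ns \<Longrightarrow> h i = k i"
    then show "composition_term A B ns h = composition_term A B ns k"
      unfolding composition_term_def
      by (intro bounded_multilinear_on_cong[OF B] bounded_multilinear_on_cong[OF A])
         (auto simp: block_def block_index_less)
  next
    fix h :: "nat \<Rightarrow> 'a" and l v w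
    assume h: "\<And>j. j < sum_list ns \<Longrightarrow> h j \<in> F" and l: "l < sum_list ns" and vw: "v \<in> F" "w \<in> F"
    obtain i j where ij: "i < ?m" "j < ns ! i" and eq: "\<And>v. composition_term A B ns (h(l := v)) =
      B ?m ((?g h)(i := A (ns ! i) ((block ns h i)(j := v))))"
      using slot[OF l, of h] by blast
    show "composition_term A B ns (h(l := v + w)) =
        composition_term A B ns (h(l := v)) + composition_term A B ns (h(l := w))"
      unfolding eq using bounded_multilinear_on_add[OF A block_F ij(2) vw, OF h ij(1)]
        bounded_multilinear_on_add[OF B UNIV_I ij(1) UNIV_I UNIV_I] by simp
  next
    fix h :: "nat \<Rightarrow> 'a" and l v c
    assume h: "\<And>j. j < sum_list ns \<Longrightarrow> h j \<in> F" and l: "l < sum_list ns" and v: "v \<in> F"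
    obtain i j where ij: "i < ?m" "j < ns ! i" and eq: "\<And>v. composition_term A B ns (h(l := v)) =
      B ?m ((?g h)(i := A (ns ! i) ((block ns h i)(j := v))))"
      using slot[OF l, of h] by blast
    show "composition_term A B ns (h(l := c *\<^sub>R v)) = c *\<^sub>R composition_term A B ns (h(l := v))"
      unfolding eq using bounded_multilinear_on_scaleR[OF A block_F ij(2) v, OF h ij(1)]
        bounded_multilinear_on_scaleR[OF B UNIV_I ij(1) UNIV_I] by simp
  next
    show "0 \<le> L ?m * prod_list (map K ns)"
      using bounded_multilinear_on_nonneg[OF A] bounded_multilinear_on_nonneg[OF B]
      by (auto intro!: mult_nonneg_nonneg prod_list_nonneg)
  next
    fix h :: "nat \<Rightarrow> 'a" assume h: "\<And>i. i < sum_list ns \<Longrightarrow> h i \<in> F"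
    have "norm (composition_term A B ns h) \<le> L ?m * (\<Prod>i<?m. norm (?g h i))"
      unfolding composition_term_def by (rule bounded_multilinear_on_bound[OF B]) simp
    also have "(\<Prod>i<?m. norm (?g h i)) \<le>
        (\<Prod>i<?m. K (ns ! i) * (\<Prod>j<ns ! i. norm (h (sum_list (take i ns) + j))))"
      using bounded_multilinear_on_bound[OF A block_F] h
      by (intro prod_mono) (auto simp: block_def[symmetric])
    also have "\<dots> = prod_list (map K ns) * (\<Prod>l<sum_list ns. norm (h l))"
      by (simp add: prod.distrib prod.list_conv_set_nth atLeast0LessThan
          prod_blocks[where w = "\<lambda>l. norm (h l)"])
    finally show "norm (composition_term A B ns h) \<le>
        L ?m * prod_list (map K ns) * (\<Prod>i<sum_list ns. norm (h i))"
      using bounded_multilinear_on_nonneg[OF B] by (simp add: mult.assoc mult_left_mono)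
  qed
qed

lemma prod_list_mult_power:
  "prod_list (map (\<lambda>n. K n * r ^ n) ns) = prod_list (map K ns) * (r :: real) ^ sum_list ns"
  by (induction ns) (auto simp: power_add mult_ac)

text \<open>
  The coefficient of degree \<open>N\<close> of the composition is the sum of the composition terms over all
  lists with sum \<open>N\<close>. Degree \<open>0\<close> is allowed in the lists, so that infinitely many lists contribute
  to each \<open>N\<close>; the majorant \<open>\<Sum>m. L m * \<tau> ^ m\<close> with \<open>\<tau> = (\<Sum>n. K n * r ^ n) < s\<close> makes everything
  absolutely convergent. A nonzero constant term of the inner series is what turns the re-expansion
  of a power series at a neighbouring point into a special case.
\<close>

theorem real_analytic_at_compose_expansion:
  assumes f: "power_expansion F A K r x (\<lambda>z. f z - y)"
    and g: "power_expansion UNIV B L s y g"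
    and \<tau>: "(\<Sum>n. K n * r ^ n) < s"
  shows "real_analytic_at F x (g \<circ> f)"
proof -
  define \<tau> where "\<tau> = (\<Sum>n. K n * r ^ n)"
  have A: "bounded_multilinear_on F n (K n) (A n)" and B: "bounded_multilinear_on UNIV n (L n) (B n)" for n
    using f g by (auto simp: power_expansion_def)
  have r: "r > 0" and s: "s > 0"
    and fs: "\<And>h. \<lbrakk>h \<in> F; norm h < r\<rbrakk> \<Longrightarrow> (\<lambda>n. A n (\<lambda>_. h)) sums (f (x + h) - y)"
    and gs: "\<And>k. norm k < s \<Longrightarrow> (\<lambda>n. B n (\<lambda>_. k)) sums g (y + k)"
    and Ks: "summable (\<lambda>n. K n * r ^ n)" and Ls: "summable (\<lambda>n. L n * s ^ n)"
    using f g by (auto simp: power_expansion_def)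
  have K0: "K n \<ge> 0" and L0: "L n \<ge> 0" for n
    using bounded_multilinear_on_nonneg[OF A] bounded_multilinear_on_nonneg[OF B] by auto
  define \<kappa> where "\<kappa> n = K n * r ^ n" for n
  have \<kappa>0: "\<kappa> n \<ge> 0" for n
    using K0 r by (simp add: \<kappa>_def)
  have \<kappa>: "(\<kappa> has_sum \<tau>) UNIV"
  proof (rule sums_nonneg_imp_has_sum)
    show "\<kappa> sums \<tau>"
      unfolding \<tau>_def \<kappa>_def[abs_def] using Ks by (rule summable_sums)
  qed (rule \<kappa>0)
  have \<tau>0: "\<tau> \<ge> 0"
    by (rule has_sum_nonneg[OF \<kappa>]) (simp add: \<kappa>0)
  define c where "c ns = L (length ns) * prod_list (map K ns)" for ns
  have c0: "c ns \<ge> 0" for ns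
    using K0 L0 by (auto simp: c_def intro!: mult_nonneg_nonneg prod_list_nonneg)
  have c\<kappa>: "c ns * r ^ sum_list ns = L (length ns) * prod_list (map \<kappa> ns)" for ns
    by (simp add: c_def \<kappa>_def[abs_def] prod_list_mult_power)
  have total: "(\<lambda>ns. c ns * r ^ sum_list ns) summable_on UNIV"
  proof (rule summable_on_fibresI[where \<phi> = length])
    show "((\<lambda>ns. c ns * r ^ sum_list ns) has_sum L m * \<tau> ^ m) {ns. length ns = m}" for m
      using has_sum_cmult_right[OF has_sum_prod_list[OF \<kappa> \<kappa>0], of "L m" m]
      by (rule has_sum_cong[THEN iffD1, rotated]) (auto simp: c\<kappa>)
    have "summable (\<lambda>m. L m * \<tau> ^ m)"
    proof (rule summable_comparison_test'[OF Ls, of 0])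
      show "norm (L m * \<tau> ^ m) \<le> L m * s ^ m" for m
        using L0 \<tau>0 \<tau> by (auto simp: \<tau>_def[symmetric] intro!: mult_left_mono power_mono)
    qed
    then show "(\<lambda>m. L m * \<tau> ^ m) summable_on UNIV"
      using L0 \<tau>0 by (intro summable_nonneg_imp_summable_on) auto
  qed (use c0 r in auto)
  have c_sum: "c summable_on {ns. sum_list ns = N}" for N
  proof -
    have "(\<lambda>ns. c ns * r ^ sum_list ns) summable_on {ns. sum_list ns = N}"
      by (rule summable_on_subset_banach[OF total]) simp
    then have "(\<lambda>ns. c ns * r ^ N) summable_on {ns. sum_list ns = N}"
      by (rule summable_on_cong[THEN iffD1, rotated]) auto
    from summable_on_cmult_left[OF this, of "1 / r ^ N"] r show ?thesis
      by simp
  qed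
  let ?T = "composition_term A B"
  define D where "D N h = infsum (\<lambda>ns. ?T ns h) {ns. sum_list ns = N}" for N h
  define C where "C N = infsum c {ns. sum_list ns = N}" for N
  have T: "bounded_multilinear_on F (sum_list ns) (c ns) (?T ns)" for ns
    unfolding c_def by (rule bounded_multilinear_on_composition_term[OF A B])
  have T_bound: "norm (?T ns h) \<le> c ns * (\<Prod>i<N. norm (h i))"
    if "\<And>i. i < N \<Longrightarrow> h i \<in> F" "sum_list ns = N" for ns h N
    using bounded_multilinear_on_bound[OF T] that by blast
  have T_sum: "(\<lambda>ns. ?T ns h) summable_on {ns. sum_list ns = N}"
    if "\<And>i. i < N \<Longrightarrow> h i \<in> F" for h N
  proof -
    have "(\<lambda>ns. c ns * (\<Prod>i<N. norm (h i))) summable_on {ns. sum_list ns = N}"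
      by (intro summable_on_cmult_left c_sum)
    then have "(\<lambda>ns. norm (?T ns h)) summable_on {ns. sum_list ns = N}"
      by (rule Infinite_Sum.abs_summable_on_comparison_test') (use T_bound that in auto)
    then show ?thesis
      by (rule abs_summable_summable)
  qed
  have D: "bounded_multilinear_on F N (C N) (D N)" for N
  proof (rule bounded_multilinear_onI)
    fix h k :: "nat \<Rightarrow> 'a" assume "\<And>i. i < N \<Longrightarrow> h i = k i"
    then show "D N h = D N k"
      unfolding D_def by (intro infsum_cong bounded_multilinear_on_cong[OF T]) auto
  next
    fix h :: "nat \<Rightarrow> 'a" and i v w
    assume *: "\<And>j. j < N \<Longrightarrow> h j \<in> F" "i < N" "v \<in> F" "w \<in> F"
    have "D N (h(i := v + w)) = infsum (\<lambda>ns. ?T ns (h(i := v)) + ?T ns (h(i := w))) {ns. sum_list ns = N}"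
      unfolding D_def using * by (intro infsum_cong bounded_multilinear_on_add[OF T]) auto
    also have "\<dots> = D N (h(i := v)) + D N (h(i := w))"
      unfolding D_def using * by (intro infsum_add T_sum) auto
    finally show "D N (h(i := v + w)) = D N (h(i := v)) + D N (h(i := w))" .
  next
    fix h :: "nat \<Rightarrow> 'a" and i v a
    assume *: "\<And>j. j < N \<Longrightarrow> h j \<in> F" "i < N" "v \<in> F"
    have "D N (h(i := a *\<^sub>R v)) = infsum (\<lambda>ns. a *\<^sub>R ?T ns (h(i := v))) {ns. sum_list ns = N}"
      unfolding D_def using * by (intro infsum_cong bounded_multilinear_on_scaleR[OF T]) auto
    also have "\<dots> = a *\<^sub>R D N (h(i := v))"
      unfolding D_def by (rule infsum_scaleR_right)
    finally show "D N (h(i := a *\<^sub>R v)) = a *\<^sub>R D N (h(i := v))" .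
  next
    show "0 \<le> C N"
      unfolding C_def by (intro infsum_nonneg c0)
  next
    fix h :: "nat \<Rightarrow> 'a" assume h: "\<And>i. i < N \<Longrightarrow> h i \<in> F"
    show "norm (D N h) \<le> C N * (\<Prod>i<N. norm (h i))"
      unfolding D_def C_def
    proof (rule norm_infsum_le[OF has_sum_infsum[OF T_sum]])
      show "((\<lambda>ns. c ns * (\<Prod>i<N. norm (h i))) has_sum
          infsum c {ns. sum_list ns = N} * (\<Prod>i<N. norm (h i))) {ns. sum_list ns = N}"
        by (intro has_sum_cmult_left has_sum_infsum c_sum)
    qed (use h T_bound in auto)
  qed
  have "((\<lambda>N. C N * r ^ N) has_sum infsum (\<lambda>ns. c ns * r ^ sum_list ns) UNIV) UNIV"
  proof (rule has_sum_fibres[OF has_sum_infsum[OF total], where \<phi> = sum_list])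
    show "((\<lambda>ns. c ns * r ^ sum_list ns) has_sum C N * r ^ N) {ns. sum_list ns = N}" for N
      using has_sum_cmult_left[OF has_sum_infsum[OF c_sum[of N]], of "r ^ N"]
      unfolding C_def by (rule has_sum_cong[THEN iffD1, rotated]) auto
  qed
  then have C_sum: "summable (\<lambda>N. C N * r ^ N)"
    by (intro summable_on_imp_summable has_sum_imp_summable)
  have sums: "(\<lambda>N. D N (\<lambda>_. h)) sums (g \<circ> f) (x + h)" if h: "h \<in> F" "norm h < r" for h
  proof -
    define a where "a n = A n (\<lambda>_. h)" for n
    define k where "k = f (x + h) - y"
    have a\<kappa>: "norm (a n) \<le> \<kappa> n" for n
    proof -
      have "norm (a n) \<le> K n * norm h ^ n"
        using bounded_multilinear_on_bound[OF A, of n "\<lambda>_. h"] h by (simp add: a_def)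
      also have "\<dots> \<le> \<kappa> n"
        unfolding \<kappa>_def using h K0 by (intro mult_left_mono power_mono) auto
      finally show ?thesis .
    qed
    have a: "(a has_sum k) UNIV"
    proof (rule norm_summable_imp_has_sum)
      show "summable (\<lambda>n. norm (a n))"
        by (rule summable_comparison_test'[OF Ks, of 0]) (use a\<kappa> in \<open>auto simp: \<kappa>_def\<close>)
      show "a sums k"
        using fs[OF h] by (simp add: a_def[abs_def] k_def)
    qed
    have "norm k \<le> \<tau>"
      using norm_infsum_le[OF a \<kappa>] a\<kappa> by simp
    then have k: "norm k < s"
      using \<tau> by (simp add: \<tau>_def)
    have T_eq: "?T ns (\<lambda>_. h) = B (length ns) (\<lambda>i. a (ns ! i))" for ns
      by (simp add: composition_term_def a_def block_def[abs_def])
    have abs_sum: "(\<lambda>ns. ?T ns (\<lambda>_. h)) summable_on UNIV"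
    proof (rule abs_summable_summable, rule Infinite_Sum.abs_summable_on_comparison_test'[OF total])
      fix ns :: "nat list"
      have "norm (?T ns (\<lambda>_. h)) \<le> c ns * norm h ^ sum_list ns"
        using T_bound[of _ "\<lambda>_. h" ns, OF _ refl] h by simp
      also have "\<dots> \<le> c ns * r ^ sum_list ns"
        using h c0 by (intro mult_left_mono power_mono) auto
      finally show "norm (?T ns (\<lambda>_. h)) \<le> c ns * r ^ sum_list ns" .
    qed
    let ?t = "infsum (\<lambda>ns. ?T ns (\<lambda>_. h)) UNIV"
    have "((\<lambda>m. B m (\<lambda>_. k)) has_sum ?t) UNIV"
    proof (rule has_sum_fibres[OF has_sum_infsum[OF abs_sum], where \<phi> = length])
      show "((\<lambda>ns. ?T ns (\<lambda>_. h)) has_sum B m (\<lambda>_. k)) {ns. length ns = m}" for m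
        using has_sum_bounded_multilinear[OF B a \<kappa> a\<kappa>, of m]
        by (rule has_sum_cong[THEN iffD1, rotated]) (auto simp: T_eq)
    qed
    then have "(\<lambda>m. B m (\<lambda>_. k)) sums ?t"
      by (rule has_sum_imp_sums)
    with gs[OF k] have t: "?t = g (y + k)"
      by (rule sums_unique2[symmetric])
    have "((\<lambda>N. D N (\<lambda>_. h)) has_sum ?t) UNIV"
    proof (rule has_sum_fibres[OF has_sum_infsum[OF abs_sum], where \<phi> = sum_list])
      show "((\<lambda>ns. ?T ns (\<lambda>_. h)) has_sum D N (\<lambda>_. h)) {ns. sum_list ns = N}" for N
        unfolding D_def using h by (intro has_sum_infsum T_sum) auto
    qed
    then show ?thesis
      using t by (simp add: has_sum_imp_sums k_def)
  qed
  show ?thesis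
    unfolding real_analytic_at_iff power_expansion_def
    using r D C_sum sums by blast
qed

section \<open>Real analytic maps\<close>

lemma power_expansion_nonneg: "power_expansion F A K r x f \<Longrightarrow> K n \<ge> 0"
  unfolding power_expansion_def using bounded_multilinear_on_nonneg by blast

lemma power_expansion_at_0:
  assumes "power_expansion F A K r x f" and "0 \<in> F"
  shows "A 0 h = f x"
proof -
  have A: "bounded_multilinear_on F n (K n) (A n)" for n
    using assms by (auto simp: power_expansion_def)
  have "A n (\<lambda>_. 0) = 0" if "n > 0" for n
    using bounded_multilinear_on_bound[OF A, of n "\<lambda>_. 0"] assms(2) that by (simp add: power_0_left)
  then have "(\<lambda>n. A n (\<lambda>_. 0)) sums A 0 (\<lambda>_. 0)"
    using sums_finite[of "{0}" "\<lambda>n. A n (\<lambda>_. 0)"] by simp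
  moreover have "(\<lambda>n. A n (\<lambda>_. 0)) sums f (x + 0)"
    using assms unfolding power_expansion_def by (metis norm_zero)
  ultimately have "A 0 (\<lambda>_. 0) = f x"
    using sums_unique2 by force
  moreover have "A 0 h = A 0 (\<lambda>_. 0)"
    by (rule bounded_multilinear_on_cong[OF A]) simp
  ultimately show ?thesis by simp
qed

lemma power_expansion_radius_le:
  assumes "power_expansion F A K r x f" and "0 < r'" "r' \<le> r"
  shows "power_expansion F A K r' x f"
proof -
  have K: "K n \<ge> 0" for n
    by (rule power_expansion_nonneg[OF assms(1)])
  have "summable (\<lambda>n. K n * r' ^ n)"
  proof (rule summable_comparison_test'[where N = 0])
    show "summable (\<lambda>n. K n * r ^ n)" using assms(1) by (simp add: power_expansion_def)
    show "norm (K n * r' ^ n) \<le> K n * r ^ n" for n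
      using assms K by (auto intro!: mult_left_mono power_mono)
  qed
  then show ?thesis
    using assms by (auto simp: power_expansion_def)
qed

lemma bounded_multilinear_on_zero: "0 \<le> K \<Longrightarrow> bounded_multilinear_on F n K (\<lambda>_. 0)"
  by (rule bounded_multilinear_onI) (auto intro!: mult_nonneg_nonneg prod_nonneg)

text \<open>
  Once the constant term \<open>f x\<close> is subtracted, the majorant of the inner series has no term of degree
  \<open>0\<close>; scaling the radius by \<open>t \<le> 1\<close> scales it by at most \<open>t\<close>, hence below the outer radius.
\<close>

theorem real_analytic_at_compose:
  assumes f: "real_analytic_at F x f" and g: "real_analytic_at UNIV (f x) g" and F: "0 \<in> F"
  shows "real_analytic_at F x (g \<circ> f)"
proof -
  obtain A K r where f: "power_expansion F A K r x f"
    using f unfolding real_analytic_at_iff by blast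
  obtain B L s where g: "power_expansion UNIV B L s (f x) g"
    using g unfolding real_analytic_at_iff by blast
  have A: "bounded_multilinear_on F n (K n) (A n)" and K: "K n \<ge> 0" for n
    using f power_expansion_nonneg[OF f] by (auto simp: power_expansion_def)
  have r: "r > 0" and s: "s > 0" and Ks: "summable (\<lambda>n. K n * r ^ n)"
    using f g by (auto simp: power_expansion_def)
  let ?A = "\<lambda>n. if n = 0 then (\<lambda>_. 0) else A n"
  let ?K = "\<lambda>n. if n = 0 then 0 else K n"
  define S where "S = (\<Sum>n. K n * r ^ n)"
  have S: "S \<ge> 0"
    unfolding S_def using K r by (intro suminf_nonneg Ks) auto
  define t where "t = min 1 (s / (2 * (S + 1)))"
  have t: "0 < t" "t \<le> 1"
    using s S by (auto simp: t_def)
  have Kt: "?K n * (r * t) ^ n \<le> t * (K n * r ^ n)" for n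
  proof (cases "n = 0")
    case False
    then have "t ^ n \<le> t"
      using power_decreasing[of 1 n t] t by simp
    then have "K n * r ^ n * t ^ n \<le> K n * r ^ n * t"
      using K r by (intro mult_left_mono) auto
    with False show ?thesis by (simp add: power_mult_distrib mult_ac)
  qed (use K r t in auto)
  have sum': "summable (\<lambda>n. ?K n * (r * t) ^ n)"
  proof (rule summable_comparison_test'[where N = 0])
    show "summable (\<lambda>n. t * (K n * r ^ n))" using Ks by (rule summable_mult)
    show "norm (?K n * (r * t) ^ n) \<le> t * (K n * r ^ n)" for n
      using Kt[of n] K r t by simp
  qed
  have sums': "(\<lambda>n. ?A n (\<lambda>_. h)) sums (f (x + h) - f x)" if "h \<in> F" "norm h < r * t" for h
  proof -
    have "norm h < r"
      using that(2) mult_left_mono[OF t(2), of r] r by linarith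
    then have "(\<lambda>n. A n (\<lambda>_. h)) sums f (x + h)"
      using f that by (auto simp: power_expansion_def)
    from sums_diff[OF this sums_single[of 0 "\<lambda>_. f x"]]
    have "(\<lambda>n. A n (\<lambda>_. h) - (if n = 0 then f x else 0)) sums (f (x + h) - f x)" .
    also have "(\<lambda>n. A n (\<lambda>_. h) - (if n = 0 then f x else 0)) = (\<lambda>n. ?A n (\<lambda>_. h))"
      by (auto simp: power_expansion_at_0[OF f F])
    finally show ?thesis .
  qed
  have "power_expansion F ?A ?K (r * t) x (\<lambda>z. f z - f x)"
    unfolding power_expansion_def
    using r t sum' sums' A by (auto simp: bounded_multilinear_on_zero)
  moreover have "(\<Sum>n. ?K n * (r * t) ^ n) < s"
  proof -
    have "(\<Sum>n. ?K n * (r * t) ^ n) \<le> (\<Sum>n. t * (K n * r ^ n))"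
      by (intro suminf_le Kt sum' summable_mult Ks)
    also have "\<dots> = t * S"
      unfolding S_def by (rule suminf_mult[OF Ks])
    also have "\<dots> \<le> s / (2 * (S + 1)) * S"
      using S by (intro mult_right_mono) (auto simp: t_def)
    also have "\<dots> < s"
      using s S by (simp add: field_simps) (smt (verit) mult_nonneg_nonneg)
    finally show ?thesis .
  qed
  ultimately show ?thesis
    using g by (intro real_analytic_at_compose_expansion)
qed

text \<open>
  Degree two is enough for constants, linear maps and products. The explicit value of the majorant is
  used for translations.
\<close>

lemma power_expansion_quadratic:
  assumes f: "\<And>h. f (x + h) = c + l h + q h h"
    and l: "bounded_linear l" "\<And>h. norm (l h) \<le> k1 * norm h"
    and q: "bounded_bilinear q" "\<And>h k. norm (q h k) \<le> k2 * norm h * norm k"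
    and k: "k1 \<ge> 0" "k2 \<ge> 0" and r: "r > 0"
  defines "K \<equiv> (\<lambda>_. 0)(0 := norm c, 1 := k1, 2 := k2)"
  shows "\<exists>A. power_expansion UNIV A K r x f" and "(\<Sum>n. K n * r ^ n) = norm c + k1 * r + k2 * r\<^sup>2"
proof -
  interpret l: bounded_linear l by fact
  interpret q: bounded_bilinear q by fact
  define A where "A n h = (if n = 0 then c else if n = 1 then l (h 0) else if n = 2 then q (h 0) (h 1) else 0)"
    for n :: nat and h :: "nat \<Rightarrow> 'a"
  have Ks: "(\<lambda>n. K n * r ^ n) sums (\<Sum>n\<in>{0, 1, 2}. K n * r ^ n)"
    by (rule sums_finite) (auto simp: K_def)
  then show "(\<Sum>n. K n * r ^ n) = norm c + k1 * r + k2 * r\<^sup>2"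
    by (simp add: sums_iff K_def)
  have "bounded_multilinear_on UNIV n (K n) (A n)" for n
  proof -
    consider "n = 0" | "n = 1" | "n = 2" | "n > 2" by linarith
    then show ?thesis
    proof cases
      case 3
      have two: "i < 2 \<longleftrightarrow> i = 0 \<or> i = 1" for i :: nat by auto
      have "{..<2} = {0, 1::nat}" by auto
      then show ?thesis
        unfolding 3 using q k
        by (intro bounded_multilinear_onI)
           (auto simp: A_def K_def two q.add_left q.add_right q.scaleR_left q.scaleR_right mult_ac)
    qed (use k l in \<open>auto intro!: bounded_multilinear_onI simp: A_def K_def l.add l.scaleR\<close>)
  qed
  moreover have "(\<lambda>n. A n (\<lambda>_. h)) sums f (x + h)" for h
  proof -
    have "(\<lambda>n. A n (\<lambda>_. h)) sums (\<Sum>n\<in>{0, 1, 2}. A n (\<lambda>_. h))"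
      by (rule sums_finite) (auto simp: A_def)
    then show ?thesis by (simp add: A_def f add.assoc)
  qed
  ultimately show "\<exists>A. power_expansion UNIV A K r x f"
    using Ks r by (auto simp: power_expansion_def sums_iff)
qed

lemma real_analytic_at_quadratic:
  assumes "\<And>h. f (x + h) = c + l h + q h h" "bounded_linear l" "bounded_bilinear q"
  shows "real_analytic_at UNIV x f"
proof -
  obtain k1 where k1: "k1 > 0" "\<And>h. norm (l h) \<le> norm h * k1"
    using bounded_linear.pos_bounded[OF assms(2)] by blast
  obtain k2 where k2: "k2 > 0" "\<And>h k. norm (q h k) \<le> norm h * norm k * k2"
    using bounded_bilinear.pos_bounded[OF assms(3)] by blast
  have "\<exists>A. power_expansion UNIV A ((\<lambda>_. 0)(0 := norm c, 1 := k1, 2 := k2)) 1 x f"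
    by (rule power_expansion_quadratic(1)[OF assms(1) assms(2) _ assms(3)])
       (use k1 k2 in \<open>auto simp: mult_ac\<close>)
  then show ?thesis
    unfolding real_analytic_at_iff by blast
qed

lemma bounded_bilinear_zero: "bounded_bilinear (\<lambda>_ _. 0)"
  by (rule bounded_bilinear.intro) (auto intro: exI[of _ 0])

lemma real_analytic_at_bounded_linear: "bounded_linear f \<Longrightarrow> real_analytic_at UNIV x f"
  by (rule real_analytic_at_quadratic[where c = "f x" and l = f and q = "\<lambda>_ _. 0"])
     (auto simp: linear_add bounded_linear.linear bounded_bilinear_zero)

lemma real_analytic_at_bounded_bilinear:
  assumes "bounded_bilinear b"
  shows "real_analytic_at UNIV x (\<lambda>z. b (fst z) (snd z))"
proof (rule real_analytic_at_quadratic[where c = "b (fst x) (snd x)"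
      and l = "\<lambda>h. b (fst x) (snd h) + b (fst h) (snd x)" and q = "\<lambda>h k. b (fst h) (snd k)"])
  interpret b: bounded_bilinear b by fact
  show "b (fst (x + h)) (snd (x + h)) =
      b (fst x) (snd x) + (b (fst x) (snd h) + b (fst h) (snd x)) + b (fst h) (snd h)" for h
    by (simp add: b.add_left b.add_right)
  show "bounded_linear (\<lambda>h. b (fst x) (snd h) + b (fst h) (snd x))"
    by (intro bounded_linear_add b.bounded_linear_left[THEN bounded_linear_compose]
        b.bounded_linear_right[THEN bounded_linear_compose] bounded_linear_fst bounded_linear_snd)
  show "bounded_bilinear (\<lambda>h k. b (fst h) (snd k))"
    by (rule bounded_bilinear.comp[OF assms bounded_linear_fst bounded_linear_snd])
qed

lemma bounded_multilinear_on_subset: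
  "bounded_multilinear_on F n K A \<Longrightarrow> G \<subseteq> F \<Longrightarrow> bounded_multilinear_on G n K A"
  by (rule bounded_multilinear_onI)
     (auto intro: bounded_multilinear_on_nonneg intro!: bounded_multilinear_on_cong[where A = A]
       bounded_multilinear_on_add[where A = A] bounded_multilinear_on_scaleR[where A = A]
       bounded_multilinear_on_bound[where A = A])

lemma real_analytic_at_subset:
  assumes "real_analytic_at F x f" "G \<subseteq> F"
  shows "real_analytic_at G x f"
proof -
  obtain A K r where "power_expansion F A K r x f"
    using assms(1) unfolding real_analytic_at_iff by blast
  then have "power_expansion G A K r x f"
    using assms(2) by (auto simp: power_expansion_def intro: bounded_multilinear_on_subset)
  then show ?thesis
    unfolding real_analytic_at_iff by blast
qed

lemma real_analytic_at_cong:
  assumes "real_analytic_at F x f" and "\<forall>\<^sub>F z in nhds x. z - x \<in> F \<longrightarrow> f z = g z"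
  shows "real_analytic_at F x g"
proof -
  obtain A K r where f: "power_expansion F A K r x f"
    using assms(1) unfolding real_analytic_at_iff by blast
  obtain e where e: "e > 0" "\<And>z. dist z x < e \<Longrightarrow> z - x \<in> F \<Longrightarrow> f z = g z"
    using assms(2) unfolding eventually_nhds_metric by blast
  have "power_expansion F A K (min r e) x f"
    by (rule power_expansion_radius_le[OF f]) (use f e in \<open>auto simp: power_expansion_def\<close>)
  moreover have "f (x + h) = g (x + h)" if "h \<in> F" "norm h < e" for h
    using e(2)[of "x + h"] that by (simp add: dist_norm)
  ultimately have "power_expansion F A K (min r e) x g"
    by (simp add: power_expansion_def)
  then show ?thesis
    unfolding real_analytic_at_iff by blast
qed

lemma real_analytic_at_const: "real_analytic_at F x (\<lambda>_. c)"
  by (rule real_analytic_at_subset[OF real_analytic_at_quadratic[where c = c and l = "\<lambda>_. 0" and q = "\<lambda>_ _. 0"]])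
     (auto simp: bounded_bilinear_zero)

lemma real_analytic_at_ident: "real_analytic_at F x (\<lambda>z. z)"
  by (rule real_analytic_at_subset[OF real_analytic_at_bounded_linear[OF bounded_linear_ident]]) simp

lemma bounded_multilinear_on_plus:
  assumes A: "bounded_multilinear_on F n K A" and B: "bounded_multilinear_on F n L B"
  shows "bounded_multilinear_on F n (K + L) (\<lambda>h. A h + B h)"
proof (rule bounded_multilinear_onI)
  show "A h + B h = A k + B k" if "\<And>i. i < n \<Longrightarrow> h i = k i" for h k
    using bounded_multilinear_on_cong[OF A that] bounded_multilinear_on_cong[OF B that] by simp
  show "norm (A h + B h) \<le> (K + L) * (\<Prod>i<n. norm (h i))" if "\<And>i. i < n \<Longrightarrow> h i \<in> F" for h
    using norm_triangle_mono[OF bounded_multilinear_on_bound[OF A that] bounded_multilinear_on_bound[OF B that]]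
    by (simp add: distrib_right)
qed (use bounded_multilinear_on_nonneg[OF A] bounded_multilinear_on_nonneg[OF B] in
    \<open>auto simp: bounded_multilinear_on_add[OF A] bounded_multilinear_on_add[OF B] scaleR_add_right
      bounded_multilinear_on_scaleR[OF A] bounded_multilinear_on_scaleR[OF B]\<close>)

lemma real_analytic_at_add:
  assumes "real_analytic_at F x f" "real_analytic_at F x g"
  shows "real_analytic_at F x (\<lambda>z. f z + g z)"
proof -
  obtain A K r where f: "power_expansion F A K r x f"
    using assms(1) unfolding real_analytic_at_iff by blast
  obtain B L s where g: "power_expansion F B L s x g"
    using assms(2) unfolding real_analytic_at_iff by blast
  have rs: "r > 0" "s > 0"
    using f g by (auto simp: power_expansion_def)
  have "power_expansion F A K (min r s) x f" "power_expansion F B L (min r s) x g"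
    using rs by (auto intro!: power_expansion_radius_le[OF f] power_expansion_radius_le[OF g])
  then have "power_expansion F (\<lambda>n h. A n h + B n h) (\<lambda>n. K n + L n) (min r s) x (\<lambda>z. f z + g z)"
    by (simp add: power_expansion_def bounded_multilinear_on_plus distrib_right sums_add summable_add)
  then show ?thesis
    unfolding real_analytic_at_iff by blast
qed

lemma real_analytic_at_linear_compose:
  assumes "bounded_linear l" "real_analytic_at F x f" "0 \<in> F"
  shows "real_analytic_at F x (\<lambda>z. l (f z))"
  using real_analytic_at_compose[OF assms(2) real_analytic_at_bounded_linear[OF assms(1)] assms(3)]
  by (simp add: o_def)

lemma real_analytic_at_Pair:
  assumes "real_analytic_at F x f" "real_analytic_at F x g" "0 \<in> F"
  shows "real_analytic_at F x (\<lambda>z. (f z, g z))"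
proof -
  have "real_analytic_at F x (\<lambda>z. (f z, 0) + (0, g z))"
    by (intro real_analytic_at_add real_analytic_at_linear_compose[where l = "\<lambda>a. (a, 0)"]
        real_analytic_at_linear_compose[where l = "\<lambda>b. (0, b)"] assms
        bounded_linear_Pair bounded_linear_ident bounded_linear_zero)
  then show ?thesis by simp
qed

lemma real_analytic_at_bilinear_compose:
  assumes "bounded_bilinear b" "real_analytic_at F x f" "real_analytic_at F x g" "0 \<in> F"
  shows "real_analytic_at F x (\<lambda>z. b (f z) (g z))"
  using real_analytic_at_compose[OF real_analytic_at_Pair[OF assms(2-4)]
      real_analytic_at_bounded_bilinear[OF assms(1)] assms(4)]
  by (simp add: o_def)

text \<open>
  Re-expansion at \<open>x\<close> is the substitution of the affine map \<open>h \<mapsto> (x - y) + h\<close>. Its majorant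
  \<open>\<parallel>x - y\<parallel> + r\<close> is below \<open>s\<close> for the chosen \<open>r\<close>.
\<close>

lemma real_analytic_at_nearby:
  fixes f :: "'e::banach \<Rightarrow> 'f::banach"
  assumes f: "power_expansion UNIV B L s y f" and x: "norm (x - y) < s"
  shows "real_analytic_at UNIV x f"
proof -
  let ?r = "(s - norm (x - y)) / 2"
  let ?K = "(\<lambda>_. 0)(0 := norm (x - y), 1 := 1, 2 := 0) :: nat \<Rightarrow> real"
  have *: "(x + h) - y = (x - y) + h + 0" "norm h \<le> 1 * norm h" "norm (0::'e) \<le> 0 * norm h * norm k" for h k :: 'e
    by simp_all
  have r: "?r > 0" using x by simp
  note quad = power_expansion_quadratic[OF *(1) bounded_linear_ident *(2) bounded_bilinear_zero *(3)
      zero_le_one order_refl r]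
  obtain A where A: "power_expansion UNIV A ?K ?r x (\<lambda>z. z - y)"
    using quad(1) by blast
  have "(\<Sum>n. ?K n * ?r ^ n) < s"
    unfolding quad(2) using x by (simp add: field_simps)
  from real_analytic_at_compose_expansion[OF A f this] show "real_analytic_at UNIV x f"
    by (simp add: o_def)
qed

text \<open>
  This reduces analyticity on a neighbourhood to analyticity at a single point. For the charts at
  \<open>a\<close> only the expansions at \<open>a\<close> and at its image have to be found.
\<close>

theorem open_real_analytic_at: "open {x. real_analytic_at UNIV x f}"
  unfolding open_contains_ball
proof
  fix y assume "y \<in> {x. real_analytic_at UNIV x f}"
  then obtain B L s where f: "power_expansion UNIV B L s y f"
    unfolding real_analytic_at_iff by blast
  then have "s > 0" by (simp add: power_expansion_def)
  then show "\<exists>e>0. ball y e \<subseteq> {x. real_analytic_at UNIV x f}"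
    by (intro exI[of _ s])
       (auto simp: dist_norm norm_minus_commute intro: real_analytic_at_nearby[OF f])
qed

text \<open>A function on a split subspace is extended to the whole space through a projection.\<close>

lemma real_analytic_at_projection:
  assumes P: "bounded_linear P" "range P \<subseteq> F" and f: "real_analytic_at F x f"
  shows "real_analytic_at UNIV x (\<lambda>z. f (x + P (z - x)))"
proof -
  obtain A K r where f: "power_expansion F A K r x f"
    using f unfolding real_analytic_at_iff by blast
  have A: "bounded_multilinear_on F n (K n) (A n)" and K: "K n \<ge> 0" for n
    using f power_expansion_nonneg[OF f] by (auto simp: power_expansion_def)
  obtain C where C: "C > 0" "\<And>h. norm (P h) \<le> norm h * C"
    using bounded_linear.pos_bounded[OF P(1)] by blast
  interpret P: bounded_linear P by (rule P(1))
  have PF: "P v \<in> F" for v using P(2) by blast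
  have "bounded_multilinear_on UNIV n (K n * C ^ n) (\<lambda>h. A n (\<lambda>i. P (h i)))" for n
  proof (rule bounded_multilinear_onI)
    fix h :: "nat \<Rightarrow> 'a"
    have upd: "(\<lambda>j. P ((h(i := v)) j)) = (\<lambda>j. P (h j))(i := P v)" for h :: "nat \<Rightarrow> 'a" and i v
      by auto
    show "A n (\<lambda>j. P ((h(i := v + w)) j)) = A n (\<lambda>j. P ((h(i := v)) j)) + A n (\<lambda>j. P ((h(i := w)) j))"
      if "i < n" for i v w
      unfolding upd P.add using that PF by (intro bounded_multilinear_on_add[OF A]) auto
    show "A n (\<lambda>j. P ((h(i := c *\<^sub>R v)) j)) = c *\<^sub>R A n (\<lambda>j. P ((h(i := v)) j))" if "i < n" for i v c
      unfolding upd P.scaleR using that PF by (intro bounded_multilinear_on_scaleR[OF A]) auto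
    have "norm (A n (\<lambda>i. P (h i))) \<le> K n * (\<Prod>i<n. norm (P (h i)))"
      using PF by (intro bounded_multilinear_on_bound[OF A]) auto
    also have "\<dots> \<le> K n * (\<Prod>i<n. norm (h i) * C)"
      using C K by (intro mult_left_mono prod_mono) auto
    finally show "norm (A n (\<lambda>i. P (h i))) \<le> K n * C ^ n * (\<Prod>i<n. norm (h i))"
      by (simp add: prod.distrib mult_ac)
  qed (use K C in \<open>auto intro!: bounded_multilinear_on_cong[OF A]\<close>)
  moreover have "(\<lambda>n. A n (\<lambda>_. P h)) sums f (x + P ((x + h) - x))" if "norm h < r / C" for h
  proof -
    have "norm h * C < r" using that C by (simp add: field_simps)
    then show ?thesis
      using f PF C(2)[of h] by (simp add: power_expansion_def)
  qed
  moreover have "summable (\<lambda>n. K n * C ^ n * (r / C) ^ n)"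
  proof -
    have "(\<lambda>n. K n * C ^ n * (r / C) ^ n) = (\<lambda>n. K n * r ^ n)"
      using C by (simp add: power_divide)
    then show ?thesis
      using f by (simp only: power_expansion_def)
  qed
  ultimately have "power_expansion UNIV (\<lambda>n h. A n (\<lambda>i. P (h i))) (\<lambda>n. K n * C ^ n) (r / C) x
      (\<lambda>z. f (x + P (z - x)))"
    using f C by (simp add: power_expansion_def)
  then show ?thesis
    unfolding real_analytic_at_iff by blast
qed

text \<open>
  The terms of degree at least \<open>2\<close> are bounded by a multiple of \<open>\<parallel>h\<parallel>\<^sup>2\<close>.
\<close>

lemma real_analytic_at_has_derivative:
  assumes "real_analytic_at UNIV x f"
  shows "\<exists>D. (f has_derivative D) (at x)"
proof -
  obtain A K r where f: "power_expansion UNIV A K r x f"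
    using assms unfolding real_analytic_at_iff by blast
  have A: "bounded_multilinear_on UNIV n (K n) (A n)" and K: "K n \<ge> 0" for n
    using f power_expansion_nonneg[OF f] by (auto simp: power_expansion_def)
  have r: "r > 0" and Ks: "summable (\<lambda>n. K n * r ^ n)"
    using f by (auto simp: power_expansion_def)
  let ?D = "\<lambda>v. A 1 (\<lambda>_. v)"
  define S where "S = (\<Sum>n. K n * r ^ n)"
  have "bounded_linear (\<lambda>v. A 1 ((\<lambda>_. 0)(0 := v)))"
    by (rule bounded_multilinear_on_slot[OF A]) simp
  also have "(\<lambda>v. A 1 ((\<lambda>_. 0)(0 := v))) = ?D"
    by (intro ext bounded_multilinear_on_cong[OF A]) simp
  finally have D: "bounded_linear ?D" .
  have rem: "norm (f (x + h) - f x - ?D h) \<le> S / r\<^sup>2 * (norm h)\<^sup>2" if h: "norm h < r" for h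
  proof -
    let ?a = "\<lambda>n. if n < 2 then 0 else A n (\<lambda>_. h)"
    have "(\<lambda>n. A n (\<lambda>_. h)) sums f (x + h)"
      using f h by (auto simp: power_expansion_def)
    from sums_diff[OF this sums_If_finite_set[of "{..<2}" "\<lambda>n. A n (\<lambda>_. h)"]]
    have "(\<lambda>n. A n (\<lambda>_. h) - (if n \<in> {..<2} then A n (\<lambda>_. h) else 0)) sums
        (f (x + h) - (\<Sum>n<2. A n (\<lambda>_. h)))"
      by simp
    also have "(\<lambda>n. A n (\<lambda>_. h) - (if n \<in> {..<2} then A n (\<lambda>_. h) else 0)) = ?a"
      by auto
    also have "(\<Sum>n<2. A n (\<lambda>_. h)) = f x + ?D h"
      by (simp add: numeral_2_eq_2 power_expansion_at_0[OF f])
    finally have a: "?a sums (f (x + h) - f x - ?D h)"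
      by (simp add: diff_diff_eq)
    have bound: "norm (?a n) \<le> (norm h / r)\<^sup>2 * (K n * r ^ n)" for n
    proof (cases "n < 2")
      case False
      have "norm (?a n) \<le> K n * norm h ^ n"
        using bounded_multilinear_on_bound[OF A, of n "\<lambda>_. h"] False by simp
      also have "\<dots> = (norm h / r) ^ n * (K n * r ^ n)"
        using r by (simp add: power_divide)
      also have "\<dots> \<le> (norm h / r)\<^sup>2 * (K n * r ^ n)"
        using False h r K by (intro mult_right_mono power_decreasing) auto
      finally show ?thesis .
    qed (use K r in auto)
    have sum2: "summable (\<lambda>n. (norm h / r)\<^sup>2 * (K n * r ^ n))"
      by (intro summable_mult Ks)
    have "norm (f (x + h) - f x - ?D h) \<le> (\<Sum>n. (norm h / r)\<^sup>2 * (K n * r ^ n))"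
      using norm_suminf_le[OF bound sum2] a by (simp add: sums_iff)
    also have "\<dots> = (norm h / r)\<^sup>2 * S"
      unfolding S_def by (rule suminf_mult[OF Ks])
    finally show ?thesis by (simp add: power_divide mult_ac)
  qed
  have "(f has_derivative ?D) (at x)"
  proof (rule has_derivativeI_sandwich[OF r D, where H = "\<lambda>y. S / r\<^sup>2 * norm (y - x)"])
    fix y assume y: "y \<noteq> x" "dist y x < r"
    have "norm (f y - f x - ?D (y - x)) \<le> S / r\<^sup>2 * (norm (y - x))\<^sup>2"
      using rem[of "y - x"] y by (simp add: dist_norm)
    then show "norm (f y - f x - ?D (y - x)) / norm (y - x) \<le> S / r\<^sup>2 * norm (y - x)"
      using y by (simp add: divide_le_eq power2_eq_square mult_ac)
  next
    have "((\<lambda>y. S / r\<^sup>2 * norm (y - x)) \<longlongrightarrow> S / r\<^sup>2 * norm (x - x)) (at x)"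
      by (intro tendsto_intros)
    then show "((\<lambda>y. S / r\<^sup>2 * norm (y - x)) \<longlongrightarrow> 0) (at x)" by simp
  qed
  then show ?thesis by blast
qed

lemma real_analytic_at_isCont: "real_analytic_at UNIV x f \<Longrightarrow> isCont f x"
  using real_analytic_at_has_derivative has_derivative_continuous by blast

section \<open>Split subspaces\<close>

lemma split_subspaceE:
  assumes "split_subspace F"
  obtains P where "bounded_linear P" "range P = F" "\<And>v. P v \<in> F" "\<And>v. v \<in> F \<Longrightarrow> P v = v"
  using assms unfolding split_subspace_def by fastforce

lemma split_subspaceI:
  assumes "bounded_linear P" "\<And>v. P v \<in> F" "\<And>v. v \<in> F \<Longrightarrow> P v = v"
  shows "split_subspace F"
  unfolding split_subspace_def using assms by (intro exI[of _ P]) (auto, metis rangeI)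

lemma split_subspace_UNIV: "split_subspace UNIV"
  by (rule split_subspaceI[OF bounded_linear_ident]) auto

lemma
  assumes "split_subspace F"
  shows split_subspace_0: "0 \<in> F"
    and split_subspace_add: "v \<in> F \<Longrightarrow> w \<in> F \<Longrightarrow> v + w \<in> F"
    and split_subspace_diff: "v \<in> F \<Longrightarrow> w \<in> F \<Longrightarrow> v - w \<in> F"
proof -
  obtain P where P: "bounded_linear P" "range P = F" "\<And>v. P v \<in> F" "\<And>v. v \<in> F \<Longrightarrow> P v = v"
    using split_subspaceE[OF assms] by blast
  interpret P: bounded_linear P by (rule P(1))
  show "0 \<in> F" using P(2) P.zero by (metis rangeI)
  show "v \<in> F \<Longrightarrow> w \<in> F \<Longrightarrow> v + w \<in> F" using P(2) by (auto simp flip: P.add)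
  show "v \<in> F \<Longrightarrow> w \<in> F \<Longrightarrow> v - w \<in> F" using P(2) by (auto simp flip: P.diff)
qed

lemma split_subspace_diff_iff: "split_subspace F \<Longrightarrow> x \<in> F \<Longrightarrow> z - x \<in> F \<longleftrightarrow> z \<in> F"
  using split_subspace_add[of F "z - x" x] split_subspace_diff[of F z x] by auto

lemma split_subspace_Times:
  assumes "split_subspace F" "split_subspace H"
  shows "split_subspace (F \<times> H)"
proof -
  obtain P where P: "bounded_linear P" "range P = F" "\<And>v. P v \<in> F" "\<And>v. v \<in> F \<Longrightarrow> P v = v"
    using split_subspaceE[OF assms(1)] by blast
  obtain Q where Q: "bounded_linear Q" "range Q = H" "\<And>v. Q v \<in> H" "\<And>v. v \<in> H \<Longrightarrow> Q v = v"
    using split_subspaceE[OF assms(2)] by blast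
  show ?thesis
  proof (rule split_subspaceI)
    show "bounded_linear (\<lambda>z. (P (fst z), Q (snd z)))"
      by (intro bounded_linear_Pair bounded_linear_compose[OF P(1) bounded_linear_fst]
          bounded_linear_compose[OF Q(1) bounded_linear_snd])
    show "(P (fst z), Q (snd z)) \<in> F \<times> H" for z
      using P(3) Q(3) by simp
    show "(P (fst z), Q (snd z)) = z" if "z \<in> F \<times> H" for z
      using that P(4) Q(4) by auto
  qed
qed

text \<open>
  If \<open>R\<close> is a right inverse of \<open>L\<close> on the image of \<open>L\<close>, then \<open>v \<mapsto> v - R (L v)\<close> projects onto the
  kernel of \<open>L\<close>.
\<close>

lemma split_subspace_kernel:
  assumes "split_subspace F" and L: "bounded_linear L" and R: "bounded_linear R"
    and RL: "\<And>v. v \<in> F \<Longrightarrow> R (L v) \<in> F" "\<And>v. v \<in> F \<Longrightarrow> L (R (L v)) = L v"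
  shows "split_subspace {v \<in> F. L v = 0}"
proof -
  obtain P where P: "bounded_linear P" "range P = F" "\<And>v. P v \<in> F" "\<And>v. v \<in> F \<Longrightarrow> P v = v"
    using split_subspaceE[OF assms(1)] by blast
  show ?thesis
  proof (rule split_subspaceI[of "\<lambda>v. P v - R (L (P v))"])
    show "bounded_linear (\<lambda>v. P v - R (L (P v)))"
      by (intro bounded_linear_sub P(1) bounded_linear_compose[OF R]
          bounded_linear_compose[OF L])
    show "P v - R (L (P v)) \<in> {v \<in> F. L v = 0}" for v
      using P RL split_subspace_diff[OF assms(1)] by (simp add: linear_diff[OF bounded_linear.linear[OF L]])
    show "P v - R (L (P v)) = v" if "v \<in> {v \<in> F. L v = 0}" for v
      using that P(4) bounded_linear.linear[OF R, THEN linear_0] by simp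
  qed
qed

text \<open>
  The outer function is known on a subspace only; precomposing it with a projection onto that
  subspace leaves the composition unchanged.
\<close>

lemma real_analytic_at_compose_on:
  assumes f: "real_analytic_at F x f" and g: "real_analytic_at G (f x) g"
    and F: "0 \<in> F" and G: "split_subspace G"
    and FG: "\<forall>\<^sub>F z in nhds x. z - x \<in> F \<longrightarrow> f z - f x \<in> G"
  shows "real_analytic_at F x (g \<circ> f)"
proof -
  obtain Q where Q: "bounded_linear Q" "range Q = G" "\<And>v. Q v \<in> G" "\<And>v. v \<in> G \<Longrightarrow> Q v = v"
    using split_subspaceE[OF G] by blast
  have "real_analytic_at F x ((\<lambda>w. g (f x + Q (w - f x))) \<circ> f)"
    using real_analytic_at_compose[OF f real_analytic_at_projection[OF Q(1) _ g] F] Q(2) by simp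
  then show ?thesis
    by (rule real_analytic_at_cong) (use FG in eventually_elim, auto simp: Q(4))
qed

lemma real_analytic_at_continuous_within:
  assumes f: "real_analytic_at F x f" and F: "split_subspace F" "x \<in> F"
  shows "continuous (at x within F) f"
proof -
  obtain P where P: "bounded_linear P" "range P = F" "\<And>v. P v \<in> F" "\<And>v. v \<in> F \<Longrightarrow> P v = v"
    using split_subspaceE[OF F(1)] by blast
  have "continuous (at x within F) (\<lambda>z. f (x + P (z - x)))"
    using real_analytic_at_projection[OF P(1) _ f] P(2) real_analytic_at_isCont
      continuous_at_imp_continuous_at_within by blast
  then show ?thesis
    by (rule continuous_transform_within[where \<delta> = 1])
       (use F P(4) split_subspace_diff[OF F(1)] in auto)
qed

lemma eventually_nhds_compose_within:
  assumes "continuous (at a within H) g" and "\<forall>\<^sub>F w in nhds (g a). P w"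
  shows "\<forall>\<^sub>F z in nhds a. z \<in> H \<longrightarrow> P (g z)"
proof -
  have "\<forall>\<^sub>F z in at a within H. P (g z)"
    using assms unfolding continuous_within by (rule_tac filterlim_iff[THEN iffD1, rule_format])
  then have "\<forall>\<^sub>F z in nhds a. z \<noteq> a \<longrightarrow> z \<in> H \<longrightarrow> P (g z)"
    by (simp add: eventually_at_filter)
  then show ?thesis
    by eventually_elim (use eventually_nhds_x_imp_x[OF assms(2)] in auto)
qed

section \<open>Manifolds embedded in a Banach space\<close>

text \<open>
  The set underlying each manifold considered here lies in a Banach space. A chart \<open>(U, \<phi>, F)\<close> is
  embedded if \<open>\<phi>\<close> extends to an analytic map on the ambient space locally, and if the inverse of \<open>\<phi>\<close>
  is analytic as a map into the ambient space. Transition maps are then compositions of analytic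
  maps between Banach spaces, and so is every map in charts that extends analytically. The notion is
  stable under products and submanifolds and is inherited by all charts of the maximal atlas.
\<close>

definition ambient_analytic_at :: "'m::banach set \<Rightarrow> ('m \<Rightarrow> 'n::banach) \<Rightarrow> 'm \<Rightarrow> bool" where
  "ambient_analytic_at X f x \<longleftrightarrow>
     (\<exists>g. real_analytic_at UNIV x g \<and> (\<forall>\<^sub>F z in nhds x. z \<in> X \<longrightarrow> f z = g z))"

definition embedded_chart :: "'m::banach set \<Rightarrow> ('m, 'e::banach) chart \<Rightarrow> bool" where
  "embedded_chart X = (\<lambda>(U, \<phi>, F).
     openin (top_of_set X) U \<and> split_subspace F \<and> openin (top_of_set F) (\<phi> ` U) \<and> inj_on \<phi> U \<and>
     (\<forall>x\<in>U. ambient_analytic_at X \<phi> x \<and> real_analytic_at F (\<phi> x) (inv_into U \<phi>)))"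

definition embedded_manifold :: "('m::banach, 'e::banach) manifold \<Rightarrow> 'm set \<Rightarrow> bool" where
  "embedded_manifold M X \<longleftrightarrow>
     mtop M = top_of_set X \<and> (\<forall>c\<in>charts M. embedded_chart X c) \<and> (\<Union>(U, \<phi>, F)\<in>charts M. U) = X"

lemma ambient_analytic_atI: "real_analytic_at UNIV x f \<Longrightarrow> ambient_analytic_at X f x"
  unfolding ambient_analytic_at_def by (intro exI[of _ f]) auto

lemma ambient_analytic_at_subset: "ambient_analytic_at X f x \<Longrightarrow> S \<subseteq> X \<Longrightarrow> ambient_analytic_at S f x"
  unfolding ambient_analytic_at_def by (blast intro: eventually_mono)

lemma ambient_analytic_at_continuous_within:
  assumes "ambient_analytic_at X f x" "x \<in> X"
  shows "continuous (at x within X) f"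
proof -
  obtain g where g: "real_analytic_at UNIV x g" and ev: "\<forall>\<^sub>F z in nhds x. z \<in> X \<longrightarrow> f z = g z"
    using assms(1) unfolding ambient_analytic_at_def by blast
  have "continuous (at x within X) g"
    using real_analytic_at_isCont[OF g] continuous_at_imp_continuous_at_within by blast
  moreover have "g x = f x"
    using eventually_nhds_x_imp_x[OF ev] assms(2) by simp
  moreover have "\<forall>\<^sub>F z in at x within X. g z = f z"
    using ev by (auto simp: eventually_at_filter elim: eventually_mono)
  ultimately show ?thesis
    unfolding continuous_within by (metis tendsto_cong)
qed

lemma ambient_analytic_at_Pair:
  assumes "ambient_analytic_at X f x" "ambient_analytic_at X g x"
  shows "ambient_analytic_at X (\<lambda>z. (f z, g z)) x"
proof -
  obtain f' g' where "real_analytic_at UNIV x f'" "\<forall>\<^sub>F z in nhds x. z \<in> X \<longrightarrow> f z = f' z"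
    "real_analytic_at UNIV x g'" "\<forall>\<^sub>F z in nhds x. z \<in> X \<longrightarrow> g z = g' z"
    using assms unfolding ambient_analytic_at_def by blast
  then show ?thesis
    unfolding ambient_analytic_at_def
    by (intro exI[of _ "\<lambda>z. (f' z, g' z)"]) (auto intro: real_analytic_at_Pair elim: eventually_elim2)
qed

lemma ambient_analytic_at_bounded_linear:
  assumes f: "ambient_analytic_at X f (l x)" and l: "bounded_linear l" "\<And>z. z \<in> Y \<Longrightarrow> l z \<in> X"
  shows "ambient_analytic_at Y (\<lambda>z. f (l z)) x"
proof -
  obtain g where g: "real_analytic_at UNIV (l x) g" and ev: "\<forall>\<^sub>F z in nhds (l x). z \<in> X \<longrightarrow> f z = g z"
    using f unfolding ambient_analytic_at_def by blast
  have "real_analytic_at UNIV x (g \<circ> l)"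
    by (rule real_analytic_at_compose[OF real_analytic_at_bounded_linear[OF l(1)] g]) simp
  moreover have "\<forall>\<^sub>F z in nhds x. l z \<in> X \<longrightarrow> f (l z) = g (l z)"
    using eventually_nhds_compose_within[of x UNIV l, OF _ ev] l(1)
    by (simp add: linear_continuous_at)
  ultimately show ?thesis
    unfolding ambient_analytic_at_def
    by (intro exI[of _ "g \<circ> l"]) (auto elim!: eventually_mono dest: l(2))
qed

lemma embedded_chartD:
  assumes "embedded_chart X (U, \<phi>, F)"
  shows "openin (top_of_set X) U" "split_subspace F" "openin (top_of_set F) (\<phi> ` U)" "inj_on \<phi> U"
    "\<And>x. x \<in> U \<Longrightarrow> ambient_analytic_at X \<phi> x"
    "\<And>x. x \<in> U \<Longrightarrow> real_analytic_at F (\<phi> x) (inv_into U \<phi>)"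
    "U \<subseteq> X" "\<And>x. x \<in> U \<Longrightarrow> \<phi> x \<in> F" "0 \<in> F"
  using assms split_subspace_0 unfolding embedded_chart_def by (auto dest!: openin_imp_subset)

lemma eventually_openin:
  assumes "openin (top_of_set X) U" "x \<in> U"
  shows "\<forall>\<^sub>F z in nhds x. z \<in> X \<longrightarrow> z \<in> U"
proof -
  obtain T where "open T" "U = X \<inter> T" using assms(1) by (auto simp: openin_open)
  then show ?thesis using assms(2) by (auto simp: eventually_nhds)
qed

text \<open>
  A property that holds on \<open>U\<close> near \<open>x\<close> holds for the preimages of all points of \<open>F\<close> near \<open>\<phi> x\<close>.
\<close>

lemma embedded_chart_eventually:
  assumes c: "embedded_chart X (U, \<phi>, F)" and x: "x \<in> U" and P: "\<forall>\<^sub>F w in nhds x. w \<in> U \<longrightarrow> P w"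
  shows "\<forall>\<^sub>F z in nhds (\<phi> x). z - \<phi> x \<in> F \<longrightarrow>
    z \<in> F \<and> z \<in> \<phi> ` U \<and> inv_into U \<phi> z \<in> U \<and> \<phi> (inv_into U \<phi> z) = z \<and> P (inv_into U \<phi> z)"
proof -
  note c = embedded_chartD[OF c]
  have inv: "inv_into U \<phi> (\<phi> x) = x" using c(4) x by simp
  have "continuous (at (\<phi> x) within F) (inv_into U \<phi>)"
    using c x by (intro real_analytic_at_continuous_within) auto
  then have "\<forall>\<^sub>F z in nhds (\<phi> x). z \<in> F \<longrightarrow> inv_into U \<phi> z \<in> U \<longrightarrow> P (inv_into U \<phi> z)"
    by (rule eventually_nhds_compose_within) (simp add: inv P)
  moreover have "\<forall>\<^sub>F z in nhds (\<phi> x). z \<in> F \<longrightarrow> z \<in> \<phi> ` U"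
    using x by (intro eventually_openin c(3)) auto
  ultimately show ?thesis
    by eventually_elim
       (use c x in \<open>auto simp: split_subspace_diff_iff inv_into_into f_inv_into_f\<close>)
qed

text \<open>
  A map that extends analytically to the ambient space is analytic in all embedded charts, because
  inverse charts are analytic into the ambient space and charts extend analytically.
\<close>

lemma real_analytic_at_in_charts:
  assumes V: "embedded_chart Y (V, \<psi>, H)" and U: "embedded_chart X (U, \<phi>, F)"
    and y: "y \<in> V" "f y \<in> U" and f: "ambient_analytic_at Y f y"
    and fX: "\<forall>\<^sub>F z in nhds y. z \<in> Y \<longrightarrow> f z \<in> X"
  shows "real_analytic_at H (\<psi> y) (\<phi> \<circ> f \<circ> inv_into V \<psi>)"
proof -
  note V' = embedded_chartD[OF V] and U' = embedded_chartD[OF U]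
  obtain g where g: "real_analytic_at UNIV y g" and fg: "\<forall>\<^sub>F z in nhds y. z \<in> Y \<longrightarrow> f z = g z"
    using f unfolding ambient_analytic_at_def by blast
  obtain \<eta> where \<eta>: "real_analytic_at UNIV (f y) \<eta>" and \<phi>\<eta>: "\<forall>\<^sub>F w in nhds (f y). w \<in> X \<longrightarrow> \<phi> w = \<eta> w"
    using U'(5)[OF y(2)] unfolding ambient_analytic_at_def by blast
  have inv: "inv_into V \<psi> (\<psi> y) = y" using V' y by simp
  have gy: "g y = f y" using eventually_nhds_x_imp_x[OF fg] V' y by auto
  have an: "real_analytic_at UNIV y (\<eta> \<circ> g)"
    by (rule real_analytic_at_compose[OF g]) (simp_all add: gy \<eta>)
  have "real_analytic_at H (\<psi> y) ((\<eta> \<circ> g) \<circ> inv_into V \<psi>)"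
    by (rule real_analytic_at_compose[OF V'(6)[OF y(1)]]) (use inv an V' in auto)
  moreover have "\<forall>\<^sub>F z in nhds y. z \<in> V \<longrightarrow> \<phi> (f z) = \<eta> (g z)"
  proof -
    have "\<forall>\<^sub>F z in nhds y. g z \<in> X \<longrightarrow> \<phi> (g z) = \<eta> (g z)"
      using eventually_nhds_compose_within[of y UNIV g "\<lambda>w. w \<in> X \<longrightarrow> \<phi> w = \<eta> w"]
        real_analytic_at_isCont[OF g] \<phi>\<eta> gy by simp
    with fg fX show ?thesis
      by eventually_elim (use V'(7) in auto)
  qed
  ultimately show ?thesis
    by (rule_tac real_analytic_at_cong)
       (auto dest!: embedded_chart_eventually[OF V y(1)] elim!: eventually_mono)
qed

lemma embedded_chart_compatible:
  assumes "embedded_chart X c" "embedded_chart X d"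
  shows "compatible c d"
proof -
  obtain U \<phi> F V \<psi> H where cd: "c = (U, \<phi>, F)" "d = (V, \<psi>, H)"
    by (metis prod_cases3)
  have "real_analytic_on F (\<phi> ` (U \<inter> V)) (\<psi> \<circ> inv_into U \<phi>)"
    if "embedded_chart X (U, \<phi>, F)" "embedded_chart X (V, \<psi>, H)"
    for U V :: "'a set" and \<phi> \<psi> :: "'a \<Rightarrow> 'b" and F H
    unfolding real_analytic_on_def
  proof safe
    fix x assume "x \<in> U" "x \<in> V"
    then have "real_analytic_at F (\<phi> x) (\<psi> \<circ> (\<lambda>z. z) \<circ> inv_into U \<phi>)"
      using that
      by (intro real_analytic_at_in_charts[where X = X and Y = X and F = H and U = V])
         (auto intro: ambient_analytic_atI real_analytic_at_ident)
    then show "real_analytic_at F (\<phi> x) (\<psi> \<circ> inv_into U \<phi>)"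
      by (simp add: o_def)
  qed
  from this[of U \<phi> F V \<psi> H] this[of V \<psi> H U \<phi> F] show ?thesis
    using assms by (simp add: compatible_def cd Int_commute)
qed

lemma embedded_chart_is_chart:
  assumes c: "embedded_chart X (U, \<phi>, F)"
  shows "is_chart (top_of_set X) (U, \<phi>, F)"
proof -
  note c = embedded_chartD[OF c]
  have "continuous_on U \<phi>"
    unfolding continuous_on_eq_continuous_within
    using ambient_analytic_at_continuous_within[OF c(5)] c(7) continuous_within_subset by blast
  moreover have "continuous_on (\<phi> ` U) (inv_into U \<phi>)"
    unfolding continuous_on_eq_continuous_within
    using real_analytic_at_continuous_within[OF c(6) c(2) c(8)] c(8)
    by (auto intro: continuous_within_subset)
  ultimately have "homeomorphic_maps (top_of_set U) (top_of_set (\<phi> ` U)) \<phi> (inv_into U \<phi>)"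
    using c(4) by (auto simp: homeomorphic_maps_def inv_into_into)
  then have "homeomorphic_map (top_of_set U) (top_of_set (\<phi> ` U)) \<phi>"
    by (rule homeomorphic_maps_map[THEN iffD1, THEN conjunct1])
  then show ?thesis
    using c by (simp add: is_chart_def subtopology_subtopology Int_absorb1)
qed

lemma embedded_chart_maximal_atlas:
  assumes "embedded_manifold M X" "embedded_chart X c"
  shows "c \<in> maximal_atlas M"
proof -
  have "is_chart (mtop M) c"
    using assms embedded_chart_is_chart[of X] by (cases c) (auto simp: embedded_manifold_def)
  moreover have "compatible c d" if "d \<in> charts M" for d
    using assms that by (intro embedded_chart_compatible[of X]) (auto simp: embedded_manifold_def)
  ultimately show ?thesis
    by (simp add: maximal_atlas_def)
qed

lemma embedded_manifold_real_analytic: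
  assumes "embedded_manifold M X"
  shows "real_analytic_manifold M"
proof -
  have "c \<in> maximal_atlas M" if "c \<in> charts M" for c
    using assms that by (intro embedded_chart_maximal_atlas) (auto simp: embedded_manifold_def)
  then show ?thesis
    using assms unfolding real_analytic_manifold_def maximal_atlas_def
    by (auto simp: embedded_manifold_def Hausdorff_space_subtopology)
qed

lemma embedded_manifold_same_analytic_structure:
  "embedded_manifold M X \<Longrightarrow> embedded_manifold N X \<Longrightarrow> same_analytic_structure M N"
  by (auto simp: same_analytic_structure_def embedded_manifold_def embedded_chart_compatible)

text \<open>
  Let \<open>\<psi>\<close> be an embedded chart at \<open>x\<close> and \<open>\<phi>\<close> a chart compatible with it. Then
  \<open>\<phi> = (\<phi> \<circ> \<psi>\<^sup>-\<^sup>1) \<circ> \<psi>\<close>, where the transition map is extended from the model space of \<open>\<psi>\<close> to the whole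
  space by a projection, and \<open>\<phi>\<^sup>-\<^sup>1 = \<psi>\<^sup>-\<^sup>1 \<circ> (\<psi> \<circ> \<phi>\<^sup>-\<^sup>1)\<close>.
\<close>

lemma maximal_atlas_embedded_chart:
  assumes M: "embedded_manifold M X" and c: "(U, \<phi>, F) \<in> maximal_atlas M"
  shows "embedded_chart X (U, \<phi>, F)"
proof -
  have top: "mtop M = top_of_set X" using M by (simp add: embedded_manifold_def)
  have U: "openin (top_of_set X) U" and F: "split_subspace F" and FU: "openin (top_of_set F) (\<phi> ` U)"
    and hom: "homeomorphic_map (top_of_set U) (top_of_set (\<phi> ` U)) \<phi>"
    using c by (auto simp: maximal_atlas_def is_chart_def top subtopology_subtopology
        Int_absorb1 dest: openin_imp_subset)
  have inj: "inj_on \<phi> U" using homeomorphic_imp_injective_map[OF hom] by simp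
  have UX: "U \<subseteq> X" using U by (rule openin_imp_subset)
  have "ambient_analytic_at X \<phi> x \<and> real_analytic_at F (\<phi> x) (inv_into U \<phi>)" if x: "x \<in> U" for x
  proof -
    have "x \<in> (\<Union>(U, \<phi>, F)\<in>charts M. U)"
      using M x UX by (auto simp: embedded_manifold_def)
    then obtain V \<psi> H where V: "(V, \<psi>, H) \<in> charts M" "x \<in> V" by auto
    then have eV: "embedded_chart X (V, \<psi>, H)" using M by (auto simp: embedded_manifold_def)
    note V' = embedded_chartD[OF eV]
    have comp: "real_analytic_at F (\<phi> x) (\<psi> \<circ> inv_into U \<phi>)" "real_analytic_at H (\<psi> x) (\<phi> \<circ> inv_into V \<psi>)"
      using c V x unfolding maximal_atlas_def compatible_def real_analytic_on_def by fastforce+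
    obtain P where P: "bounded_linear P" "range P = H" "\<And>v. P v \<in> H" "\<And>v. v \<in> H \<Longrightarrow> P v = v"
      using split_subspaceE[OF V'(2)] by blast
    obtain \<eta> where \<eta>: "real_analytic_at UNIV x \<eta>" and \<psi>\<eta>: "\<forall>\<^sub>F z in nhds x. z \<in> X \<longrightarrow> \<psi> z = \<eta> z"
      using V'(5)[OF V(2)] unfolding ambient_analytic_at_def by blast
    have \<eta>x: "\<eta> x = \<psi> x" using eventually_nhds_x_imp_x[OF \<psi>\<eta>] x UX by auto
    let ?g = "(\<lambda>w. (\<phi> \<circ> inv_into V \<psi>) (\<psi> x + P (w - \<psi> x))) \<circ> \<eta>"
    have "real_analytic_at UNIV x ?g"
      by (rule real_analytic_at_compose[OF \<eta>])
         (use real_analytic_at_projection[OF P(1) _ comp(2)] P(2) \<eta>x in auto)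
    moreover have "\<forall>\<^sub>F z in nhds x. z \<in> X \<longrightarrow> \<phi> z = ?g z"
      using \<psi>\<eta> eventually_openin[OF V'(1) V(2)]
    proof eventually_elim
      case (elim z)
      show ?case
      proof
        assume "z \<in> X"
        with elim have z: "z \<in> V" "\<eta> z = \<psi> z" by auto
        then have "P (\<psi> z - \<psi> x) = \<psi> z - \<psi> x"
          using V' V(2) by (intro P(4) split_subspace_diff) auto
        with z V'(4) show "\<phi> z = ?g z" by simp
      qed
    qed
    ultimately have 1: "ambient_analytic_at X \<phi> x"
      unfolding ambient_analytic_at_def by blast
    have inv: "inv_into U \<phi> (\<phi> x) = x" using inj x by simp
    have "openin (top_of_set U) (U \<inter> V)"
      using V'(1) UX by (auto simp: openin_open)
    then have "openin (top_of_set (\<phi> ` U)) (\<phi> ` (U \<inter> V))"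
      using homeomorphic_imp_open_map[OF hom] by (auto simp: open_map_def)
    then have UV: "openin (top_of_set F) (\<phi> ` (U \<inter> V))"
      using FU openin_trans by blast
    have ev: "\<forall>\<^sub>F z in nhds (\<phi> x). z - \<phi> x \<in> F \<longrightarrow>
        inv_into U \<phi> z \<in> V \<and> \<phi> (inv_into U \<phi> z) = z"
    proof -
      have \<phi>x: "\<phi> x \<in> F" using FU x openin_imp_subset by blast
      have "\<forall>\<^sub>F z in nhds (\<phi> x). z \<in> F \<longrightarrow> z \<in> \<phi> ` (U \<inter> V)"
        using x V by (intro eventually_openin[OF UV]) auto
      then show ?thesis
        by eventually_elim (use F \<phi>x inj in \<open>auto simp: split_subspace_diff_iff\<close>)
    qed
    have "real_analytic_at F (\<phi> x) (inv_into V \<psi> \<circ> (\<psi> \<circ> inv_into U \<phi>))"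
    proof (rule real_analytic_at_compose_on[OF comp(1) _ _ V'(2)])
      show "real_analytic_at H ((\<psi> \<circ> inv_into U \<phi>) (\<phi> x)) (inv_into V \<psi>)"
        using V'(6)[OF V(2)] inv by simp
      show "\<forall>\<^sub>F z in nhds (\<phi> x). z - \<phi> x \<in> F \<longrightarrow>
          (\<psi> \<circ> inv_into U \<phi>) z - (\<psi> \<circ> inv_into U \<phi>) (\<phi> x) \<in> H"
        using ev by eventually_elim (use V' V inv split_subspace_diff[OF V'(2)] in auto)
    qed (rule split_subspace_0[OF F])
    then have "real_analytic_at F (\<phi> x) (inv_into U \<phi>)"
      by (rule real_analytic_at_cong) (use ev in eventually_elim, use V'(4) in auto)
    with 1 show ?thesis by blast
  qed
  then show ?thesis
    using U F FU inj by (simp add: embedded_chart_def)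
qed

lemma embedded_chart_restrict:
  assumes c: "embedded_chart X (U, \<phi>, F)" and S: "S \<subseteq> X"
    and F': "split_subspace F'" "F' \<subseteq> F" "\<phi> ` (U \<inter> S) = \<phi> ` U \<inter> F'"
  shows "embedded_chart S (U \<inter> S, \<phi>, F')"
proof -
  note c' = embedded_chartD[OF c]
  have "real_analytic_at F' (\<phi> x) (inv_into (U \<inter> S) \<phi>)" if x: "x \<in> U" "x \<in> S" for x
  proof (rule real_analytic_at_cong[OF real_analytic_at_subset[OF c'(6) F'(2)]])
    show "\<forall>\<^sub>F z in nhds (\<phi> x). z - \<phi> x \<in> F' \<longrightarrow> inv_into U \<phi> z = inv_into (U \<inter> S) \<phi> z"
      using embedded_chart_eventually[OF c x(1), of "\<lambda>_. True", simplified]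
    proof eventually_elim
      case (elim z)
      show ?case
      proof
        assume "z - \<phi> x \<in> F'"
        moreover have "\<phi> x \<in> F'" using x F' by blast
        ultimately have "z \<in> F'"
          using F'(1) by (simp add: split_subspace_diff_iff)
        have z: "inv_into U \<phi> z \<in> U" "\<phi> (inv_into U \<phi> z) = z"
          using elim F'(2) \<open>z - \<phi> x \<in> F'\<close> by auto
        with \<open>z \<in> F'\<close> have "z \<in> \<phi> ` (U \<inter> S)"
          unfolding F'(3) by (metis IntI imageI)
        then obtain u where u: "u \<in> U" "u \<in> S" "z = \<phi> u" by blast
        have "inj_on \<phi> (U \<inter> S)"
          using c'(4) by (rule inj_on_subset) simp
        then show "inv_into U \<phi> z = inv_into (U \<inter> S) \<phi> z"
          using u c'(4) by simp
      qed
    qed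
  qed (use x in auto)
  moreover have "openin (top_of_set S) (U \<inter> S)"
    using c'(1) S by (auto simp: openin_open)
  moreover have "openin (top_of_set F') (\<phi> ` (U \<inter> S))"
    using c'(3) F'(2) unfolding F'(3) by (auto simp: openin_open)
  ultimately show ?thesis
    using c' F' S ambient_analytic_at_subset[OF c'(5) S]
    by (auto simp: embedded_chart_def inj_on_def)
qed

lemma embedded_manifold_banach_space: "embedded_manifold banach_space_manifold UNIV"
proof -
  have "inv_into UNIV id = (id :: 'a \<Rightarrow> 'a)"
    by (simp add: fun_eq_iff inv_into_f_eq)
  then have "embedded_chart (UNIV :: 'a set) (UNIV, id, UNIV)"
    by (auto simp: embedded_chart_def split_subspace_UNIV id_def real_analytic_at_ident
        intro!: ambient_analytic_atI)
  then show ?thesis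
    by (simp add: embedded_manifold_def banach_space_manifold_def)
qed

lemma embedded_manifold_submanifold:
  assumes M: "embedded_manifold M X" and S: "is_submanifold M S"
  shows "embedded_manifold (submanifold M S) S"
proof -
  have SX: "S \<subseteq> X" using M S by (auto simp: embedded_manifold_def is_submanifold_def)
  then show ?thesis
    using M S unfolding embedded_manifold_def is_submanifold_def
    by (auto simp: submanifold_def subtopology_subtopology Int_absorb1
        intro!: embedded_chart_restrict[OF maximal_atlas_embedded_chart[OF M]])
qed

section \<open>Products, open subsets and analytic maps\<close>

lemma embedded_chart_Times:
  assumes U: "embedded_chart X (U, \<phi>, F)" and V: "embedded_chart Y (V, \<psi>, H)"
  shows "embedded_chart (X \<times> Y) (U \<times> V, map_prod \<phi> \<psi>, F \<times> H)"
proof -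
  note U' = embedded_chartD[OF U] and V' = embedded_chartD[OF V]
  have FH: "split_subspace (F \<times> H)" using U' V' by (intro split_subspace_Times)
  have img: "map_prod \<phi> \<psi> ` (U \<times> V) = \<phi> ` U \<times> \<psi> ` V" by (auto simp: image_iff)
  have inj: "inj_on (map_prod \<phi> \<psi>) (U \<times> V)" using U' V' by (intro map_prod_inj_on)
  have "ambient_analytic_at (X \<times> Y) (map_prod \<phi> \<psi>) (x, y)" if "x \<in> U" "y \<in> V" for x y
  proof -
    have "ambient_analytic_at (X \<times> Y) (\<lambda>z. (\<phi> (fst z), \<psi> (snd z))) (x, y)"
      using that U' V'
      by (intro ambient_analytic_at_Pair ambient_analytic_at_bounded_linear[where l = fst and X = X]
          ambient_analytic_at_bounded_linear[where l = snd and X = Y] bounded_linear_fst bounded_linear_snd) auto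
    then show ?thesis by (simp add: map_prod_def case_prod_unfold)
  qed
  moreover have "real_analytic_at (F \<times> H) (\<phi> x, \<psi> y) (inv_into (U \<times> V) (map_prod \<phi> \<psi>))"
    if "x \<in> U" "y \<in> V" for x y
  proof -
    have 0: "0 \<in> F \<times> H" using U' V' by (simp add: zero_prod_def)
    have lin: "real_analytic_at (F \<times> H) p fst" "real_analytic_at (F \<times> H) p snd" for p :: "'b \<times> 'd"
      by (auto intro: real_analytic_at_subset[OF real_analytic_at_bounded_linear] bounded_linear_fst bounded_linear_snd)
    have "real_analytic_at (F \<times> H) (\<phi> x, \<psi> y) (inv_into U \<phi> \<circ> fst)"
      by (rule real_analytic_at_compose_on[OF lin(1) _ 0 U'(2)])
         (use U' that in \<open>auto intro!: always_eventually\<close>)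
    moreover have "real_analytic_at (F \<times> H) (\<phi> x, \<psi> y) (inv_into V \<psi> \<circ> snd)"
      by (rule real_analytic_at_compose_on[OF lin(2) _ 0 V'(2)])
         (use V' that in \<open>auto intro!: always_eventually\<close>)
    ultimately have "real_analytic_at (F \<times> H) (\<phi> x, \<psi> y)
        (\<lambda>z. ((inv_into U \<phi> \<circ> fst) z, (inv_into V \<psi> \<circ> snd) z))"
      using 0 by (rule real_analytic_at_Pair)
    then show ?thesis
    proof (rule real_analytic_at_cong)
      have "openin (top_of_set (F \<times> H)) (\<phi> ` U \<times> \<psi> ` V)"
        using U' V' by (intro openin_Times)
      from eventually_openin[OF this, of "(\<phi> x, \<psi> y)"] that
      have "\<forall>\<^sub>F z in nhds (\<phi> x, \<psi> y). z \<in> F \<times> H \<longrightarrow> z \<in> \<phi> ` U \<times> \<psi> ` V" by auto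
      then show "\<forall>\<^sub>F z in nhds (\<phi> x, \<psi> y). z - (\<phi> x, \<psi> y) \<in> F \<times> H \<longrightarrow>
          ((inv_into U \<phi> \<circ> fst) z, (inv_into V \<psi> \<circ> snd) z) = inv_into (U \<times> V) (map_prod \<phi> \<psi>) z"
      proof eventually_elim
        case (elim z)
        show ?case
        proof
          assume "z - (\<phi> x, \<psi> y) \<in> F \<times> H"
          then have "z \<in> F \<times> H"
            using that U' V' split_subspace_diff_iff[OF FH, of "(\<phi> x, \<psi> y)" z] by auto
          with elim obtain u v where uv: "u \<in> U" "v \<in> V" "z = map_prod \<phi> \<psi> (u, v)" by auto
          then have "inv_into (U \<times> V) (map_prod \<phi> \<psi>) z = (u, v)"
            using inj by (simp only: inv_into_f_f mem_Times_iff fst_conv snd_conv)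
          then show "((inv_into U \<phi> \<circ> fst) z, (inv_into V \<psi> \<circ> snd) z) = inv_into (U \<times> V) (map_prod \<phi> \<psi>) z"
            using uv U' V' by simp
        qed
      qed
    qed
  qed
  ultimately show ?thesis
    unfolding embedded_chart_def
    using U' V' FH inj by (auto simp: img simp del: map_prod_surj_on intro: openin_Times)
qed

lemma embedded_manifold_prod:
  assumes "embedded_manifold M X" "embedded_manifold N Y"
  shows "embedded_manifold (prod_manifold M N) (X \<times> Y)"
proof -
  have "(\<Union>(U, \<phi>, F)\<in>charts (prod_manifold M N). U) =
      (\<Union>(U, \<phi>, F)\<in>charts M. U) \<times> (\<Union>(V, \<psi>, H)\<in>charts N. V)"
    unfolding prod_manifold_def by (auto; blast)
  then show ?thesis
    using assms unfolding embedded_manifold_def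
    by (auto simp: prod_manifold_def prod_topology_subtopology_eu intro!: embedded_chart_Times)
qed

lemma embedded_chart_open_restrict:
  assumes c: "embedded_chart X (U, \<phi>, F)" and W: "openin (top_of_set X) W" "W \<subseteq> U"
  shows "embedded_chart X (W, \<phi>, F)"
proof -
  note c' = embedded_chartD[OF c]
  have "homeomorphic_map (top_of_set U) (top_of_set (\<phi> ` U)) \<phi>"
    using embedded_chart_is_chart[OF c] c'(7)
    by (simp add: is_chart_def subtopology_subtopology Int_absorb1)
  moreover have "openin (top_of_set U) W"
    using W c'(7) by (meson openin_subset_trans)
  ultimately have "openin (top_of_set (\<phi> ` U)) (\<phi> ` W)"
    using homeomorphic_imp_open_map by (auto simp: open_map_def)
  then have open_image: "openin (top_of_set F) (\<phi> ` W)"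
    using c'(3) openin_trans by blast
  have inj: "inj_on \<phi> W" using c'(4) W(2) by (rule inj_on_subset)
  have "real_analytic_at F (\<phi> x) (inv_into W \<phi>)" if x: "x \<in> W" for x
  proof (rule real_analytic_at_cong[OF c'(6)])
    have "\<forall>\<^sub>F z in nhds (\<phi> x). z \<in> F \<longrightarrow> z \<in> \<phi> ` W"
      using x by (intro eventually_openin[OF open_image]) auto
    then show "\<forall>\<^sub>F z in nhds (\<phi> x). z - \<phi> x \<in> F \<longrightarrow> inv_into U \<phi> z = inv_into W \<phi> z"
    proof eventually_elim
      case (elim z)
      show ?case
      proof
        assume "z - \<phi> x \<in> F"
        then have "z \<in> F"
          using c' W x by (auto simp: split_subspace_diff_iff)
        with elim obtain u where "u \<in> W" "z = \<phi> u" by blast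
        then show "inv_into U \<phi> z = inv_into W \<phi> z"
          using inj c'(4) W(2) by (simp add: subset_iff)
      qed
    qed
  qed (use x W in auto)
  then show ?thesis
    using c' W open_image inj by (auto simp: embedded_chart_def)
qed

lemma is_submanifold_self:
  assumes "embedded_manifold M X"
  shows "is_submanifold M X"
proof -
  have "c \<in> charts (submanifold M X)" if "c \<in> charts M" for c
  proof -
    obtain U \<phi> F where c: "c = (U, \<phi>, F)" by (metis prod_cases3)
    have e: "embedded_chart X (U, \<phi>, F)" using assms that c by (auto simp: embedded_manifold_def)
    have "(U, \<phi>, F) \<in> maximal_atlas M"
      by (rule embedded_chart_maximal_atlas[OF assms e])
    moreover have "U \<inter> X = U" "\<phi> ` (U \<inter> X) = \<phi> ` U \<inter> F"
      using embedded_chartD[OF e] by auto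
    ultimately show ?thesis
      using embedded_chartD[OF e] unfolding submanifold_def c
      by (auto intro!: exI[of _ U] exI[of _ F])
  qed
  then have "X \<subseteq> (\<Union>(U, \<phi>, F)\<in>charts (submanifold M X). U)"
    using assms by (fastforce simp: embedded_manifold_def)
  moreover have "(\<Union>(U, \<phi>, F)\<in>charts (submanifold M X). U) \<subseteq> X"
    by (auto simp: submanifold_def)
  ultimately show ?thesis
    using assms by (auto simp: is_submanifold_def embedded_manifold_def)
qed

lemma is_submanifold_openin:
  assumes M: "embedded_manifold M X" and S: "is_submanifold M S" and S': "openin (top_of_set S) S'"
  shows "is_submanifold M S'"
proof -
  have SX: "S \<subseteq> X" using M S by (simp add: is_submanifold_def embedded_manifold_def)
  obtain T where T: "open T" "S' = S \<inter> T" using S' by (auto simp: openin_open)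
  have "x \<in> (\<Union>(U, \<phi>, F)\<in>charts (submanifold M S'). U)" if x: "x \<in> S'" for x
  proof -
    have "x \<in> (\<Union>(U, \<phi>, F)\<in>charts (submanifold M S). U)"
      using x T S by (simp add: is_submanifold_def)
    then obtain U \<phi> F F' where U: "(U, \<phi>, F) \<in> maximal_atlas M" "x \<in> U"
      and F': "split_subspace F'" "F' \<subseteq> F" "\<phi> ` (U \<inter> S) = \<phi> ` U \<inter> F'"
      by (auto simp: submanifold_def)
    have e: "embedded_chart X (U, \<phi>, F)"
      by (rule maximal_atlas_embedded_chart[OF M U(1)])
    note e' = embedded_chartD[OF e]
    have "openin (top_of_set X) (U \<inter> T)"
      using e'(1) T(1) by (auto simp: openin_open)
    then have "(U \<inter> T, \<phi>, F) \<in> maximal_atlas M"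
      by (intro embedded_chart_maximal_atlas[OF M] embedded_chart_open_restrict[OF e]) auto
    moreover have "\<phi> ` (U \<inter> T \<inter> S') = \<phi> ` (U \<inter> T) \<inter> F'"
    proof
      show "\<phi> ` (U \<inter> T \<inter> S') \<subseteq> \<phi> ` (U \<inter> T) \<inter> F'"
        using F'(3) T(2) by blast
      show "\<phi> ` (U \<inter> T) \<inter> F' \<subseteq> \<phi> ` (U \<inter> T \<inter> S')"
      proof
        fix z assume "z \<in> \<phi> ` (U \<inter> T) \<inter> F'"
        then obtain u where u: "u \<in> U" "u \<in> T" "z = \<phi> u" "\<phi> u \<in> F'" by blast
        then have "\<phi> u \<in> \<phi> ` (U \<inter> S)" using F'(3) by blast
        then have "u \<in> S" using u(1) e'(4) by (auto dest: inj_onD)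
        then show "z \<in> \<phi> ` (U \<inter> T \<inter> S')" using u T(2) by blast
      qed
    qed
    ultimately have "(U \<inter> T \<inter> S', \<phi>, F') \<in> charts (submanifold M S')"
      using F' by (auto simp: submanifold_def)
    then show ?thesis
      using x U(2) T(2) by (intro UN_I[of "(U \<inter> T \<inter> S', \<phi>, F')"]) auto
  qed
  moreover have "(\<Union>(U, \<phi>, F)\<in>charts (submanifold M S'). U) \<subseteq> S'"
    by (auto simp: submanifold_def)
  ultimately show ?thesis
    using SX T M by (auto simp: is_submanifold_def embedded_manifold_def)
qed

lemma embedded_real_analytic_map:
  assumes M: "embedded_manifold M X" and N: "embedded_manifold N Y"
    and f: "f \<in> X \<rightarrow> Y" "\<And>x. x \<in> X \<Longrightarrow> ambient_analytic_at X f x"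
  shows "real_analytic_map M N f"
proof -
  have "continuous_on X f"
    unfolding continuous_on_eq_continuous_within
    using ambient_analytic_at_continuous_within[OF f(2)] by blast
  then have "continuous_map (mtop M) (mtop N) f"
    using M N f(1) by (auto simp: embedded_manifold_def)
  moreover have "real_analytic_on F (\<phi> ` {x \<in> U. f x \<in> V}) (\<psi> \<circ> f \<circ> inv_into U \<phi>)"
    if "(U, \<phi>, F) \<in> charts M" "(V, \<psi>, H) \<in> charts N" for U \<phi> F V \<psi> H
    unfolding real_analytic_on_def
  proof safe
    fix x assume x: "x \<in> U" "f x \<in> V"
    have U: "embedded_chart X (U, \<phi>, F)" and V: "embedded_chart Y (V, \<psi>, H)"
      using M N that by (auto simp: embedded_manifold_def)
    show "real_analytic_at F (\<phi> x) (\<psi> \<circ> f \<circ> inv_into U \<phi>)"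
      by (rule real_analytic_at_in_charts[where Y = X and X = Y, OF U V])
         (use x f embedded_chartD(7)[OF U] in \<open>auto intro!: always_eventually\<close>)
  qed
  ultimately show ?thesis
    unfolding real_analytic_map_def by blast
qed

section \<open>Submersions and charts from local inverses\<close>

lemma eventually_nhds_projection:
  assumes "bounded_linear Q" "range Q \<subseteq> H" and "\<forall>\<^sub>F z in nhds a. z - a \<in> H \<longrightarrow> P z"
  shows "\<forall>\<^sub>F z in nhds a. P (a + Q (z - a))"
proof -
  interpret Q: bounded_linear Q by fact
  have "continuous (at a) (\<lambda>z. a + Q (z - a))"
    by (intro continuous_intros Q.continuous)
  then have "\<forall>\<^sub>F z in nhds a. z \<in> UNIV \<longrightarrow> (a + Q (z - a)) - a \<in> H \<longrightarrow> P (a + Q (z - a))"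
    using assms(3) by (intro eventually_nhds_compose_within) auto
  then show ?thesis
    by eventually_elim (use assms(2) in auto)
qed

text \<open>
  If \<open>E\<close> is the derivative of a local section of \<open>f\<close>, then \<open>D \<circ> E\<close> is the identity for the
  derivative \<open>D\<close> of \<open>f\<close>; hence \<open>D\<close> is onto and \<open>E \<circ> D\<close> is a projection along its kernel.
\<close>

lemma submersion_of_local_sections:
  assumes M: "embedded_manifold M X" and N: "embedded_manifold N Y"
    and f: "f \<in> X \<rightarrow> Y" "\<And>x. x \<in> X \<Longrightarrow> ambient_analytic_at X f x"
    and sections: "\<And>x. x \<in> X \<Longrightarrow> \<exists>\<sigma>. real_analytic_at UNIV (f x) \<sigma> \<and> \<sigma> (f x) = x \<and>
      (\<forall>\<^sub>F y in nhds (f x). y \<in> Y \<longrightarrow> \<sigma> y \<in> X \<and> f (\<sigma> y) = y)"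
  shows "submersion M N f"
  unfolding submersion_def
proof (intro conjI ballI, safe)
  show "real_analytic_map M N f"
    by (rule embedded_real_analytic_map[OF M N f])
next
  fix U \<phi> F V \<psi> H x
  assume charts: "(U, \<phi>, F) \<in> charts M" "(V, \<psi>, H) \<in> charts N" and x: "x \<in> U" "f x \<in> V"
  have U: "embedded_chart X (U, \<phi>, F)" and V: "embedded_chart Y (V, \<psi>, H)"
    using M N charts by (auto simp: embedded_manifold_def)
  note U' = embedded_chartD[OF U] and V' = embedded_chartD[OF V]
  have xX: "x \<in> X" using x U' by blast
  obtain \<sigma> where \<sigma>: "real_analytic_at UNIV (f x) \<sigma>" "\<sigma> (f x) = x"
    and sec: "\<forall>\<^sub>F y in nhds (f x). y \<in> Y \<longrightarrow> \<sigma> y \<in> X \<and> f (\<sigma> y) = y"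
    using sections[OF xX] by blast
  obtain P where P: "bounded_linear P" "range P = F" "\<And>v. P v \<in> F" "\<And>v. v \<in> F \<Longrightarrow> P v = v"
    using split_subspaceE[OF U'(2)] by blast
  obtain Q where Q: "bounded_linear Q" "range Q = H" "\<And>v. Q v \<in> H" "\<And>v. v \<in> H \<Longrightarrow> Q v = v"
    using split_subspaceE[OF V'(2)] by blast
  interpret P: bounded_linear P by (rule P(1))
  interpret Q: bounded_linear Q by (rule Q(1))
  define a where "a = \<phi> x"
  define b where "b = \<psi> (f x)"
  have aF: "a \<in> F" and bH: "b \<in> H" using U' V' x by (auto simp: a_def b_def)
  define u where "u = \<psi> \<circ> f \<circ> inv_into U \<phi>"
  define w where "w = \<phi> \<circ> \<sigma> \<circ> inv_into V \<psi>"
  define u' where "u' z = u (a + P (z - a))" for z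
  define w' where "w' z = w (b + Q (z - b))" for z
  have "real_analytic_at F a u"
    unfolding u_def a_def
    by (rule real_analytic_at_in_charts[where Y = X and X = Y, OF U V])
       (use x f xX in \<open>auto intro!: always_eventually\<close>)
  from real_analytic_at_projection[OF P(1) _ this] obtain D where D: "(u' has_derivative D) (at a)"
    using real_analytic_at_has_derivative P(2) unfolding u'_def by blast
  have "real_analytic_at H b w"
    unfolding w_def b_def
    by (rule real_analytic_at_in_charts[where Y = Y and X = X, OF V U])
       (use x \<sigma> sec in \<open>auto intro: ambient_analytic_atI elim: eventually_mono\<close>)
  from real_analytic_at_projection[OF Q(1) _ this] obtain E where E: "(w' has_derivative E) (at b)"
    using real_analytic_at_has_derivative Q(2) unfolding w'_def by blast
  have w'b: "w' b = a"
    using V' x \<sigma>(2) by (simp add: w'_def w_def a_def b_def)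
  have \<sigma>U: "\<forall>\<^sub>F y in nhds (f x). \<sigma> y \<in> X \<longrightarrow> \<sigma> y \<in> U"
    using eventually_nhds_compose_within[of "f x" UNIV \<sigma> "\<lambda>z. z \<in> X \<longrightarrow> z \<in> U"]
      real_analytic_at_isCont[OF \<sigma>(1)] eventually_openin[OF U'(1) x(1)] \<sigma>(2) by simp
  have "\<forall>\<^sub>F y in nhds (f x). y \<in> V \<longrightarrow> \<sigma> y \<in> U \<and> f (\<sigma> y) = y"
    using sec \<sigma>U by eventually_elim (use V'(7) in auto)
  from embedded_chart_eventually[OF V x(2) this]
  have "\<forall>\<^sub>F z in nhds b. z - b \<in> H \<longrightarrow> w z \<in> F \<and> u (w z) = z"
    unfolding b_def w_def u_def by eventually_elim (use U' in auto)
  then have uw: "\<forall>\<^sub>F z in nhds b. w' z \<in> F \<and> u (w' z) = b + Q (z - b)"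
    unfolding w'_def using Q(1,2) by (intro eventually_nhds_projection[where P = "\<lambda>z. w z \<in> F \<and> u (w z) = z"]) auto
  have DE: "D (E h) = Q h" for h
  proof -
    have "(u' \<circ> w' has_derivative D \<circ> E) (at b)"
      using E D w'b by (intro diff_chain_at) auto
    moreover have "\<forall>\<^sub>F z in at b. (u' \<circ> w') z = b + Q (z - b)"
      using uw unfolding eventually_at_filter
      by eventually_elim (use P(4) aF split_subspace_diff[OF U'(2)] in \<open>auto simp: u'_def\<close>)
    moreover have "(u' \<circ> w') b = b + Q (b - b)"
      using eventually_nhds_x_imp_x[OF uw] P(4) aF split_subspace_diff[OF U'(2)]
      by (auto simp: u'_def)
    ultimately have "((\<lambda>z. b + Q (z - b)) has_derivative D \<circ> E) (at b)"
      by (rule has_derivative_transform_eventually) auto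
    moreover have "((\<lambda>z. b + Q (z - b)) has_derivative Q) (at b)"
      by (auto intro!: derivative_eq_intros Q.has_derivative)
    ultimately show ?thesis
      by (metis has_derivative_unique comp_apply)
  qed
  have PE: "P (E h) = E h" for h
  proof -
    have "((\<lambda>z. P (w' z)) has_derivative (\<lambda>h. P (E h))) (at b)"
      by (rule P.has_derivative[OF E])
    moreover have "\<forall>\<^sub>F z in at b. P (w' z) = w' z"
      using uw unfolding eventually_at_filter by eventually_elim (use P(4) in auto)
    ultimately have "(w' has_derivative (\<lambda>h. P (E h))) (at b)"
      by (rule has_derivative_transform_eventually) (use w'b P(4) aF in auto)
    then show ?thesis
      using has_derivative_unique[OF E] by metis
  qed
  have "\<forall>\<^sub>F z in nhds x. z \<in> U \<longrightarrow> f z \<in> V"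
  proof -
    have "\<forall>\<^sub>F z in nhds x. z \<in> X \<longrightarrow> f z \<in> Y \<longrightarrow> f z \<in> V"
      using eventually_nhds_compose_within[OF ambient_analytic_at_continuous_within[OF f(2)[OF xX] xX]
        eventually_openin[OF V'(1) x(2)]] .
    then show ?thesis
      by eventually_elim (use U'(7) f(1) in auto)
  qed
  from embedded_chart_eventually[OF U x(1) this]
  have "\<forall>\<^sub>F z in nhds a. z - a \<in> F \<longrightarrow> u z \<in> H"
    unfolding a_def u_def by eventually_elim (use V' in auto)
  then have uH: "\<forall>\<^sub>F z in nhds a. u' z \<in> H"
    unfolding u'_def using P(1,2) by (intro eventually_nhds_projection) auto
  have QD: "Q (D h) = D h" for h
  proof -
    have "((\<lambda>z. Q (u' z)) has_derivative (\<lambda>h. Q (D h))) (at a)"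
      by (rule Q.has_derivative[OF D])
    moreover have "\<forall>\<^sub>F z in at a. Q (u' z) = u' z"
      using uH unfolding eventually_at_filter by eventually_elim (use Q(4) in auto)
    ultimately have "(u' has_derivative (\<lambda>h. Q (D h))) (at a)"
      by (rule has_derivative_transform_eventually)
         (use eventually_nhds_x_imp_x[OF uH] Q(4) in auto)
    then show ?thesis
      using has_derivative_unique[OF D] by metis
  qed
  have "(u has_derivative D) (at a within \<phi> ` {y \<in> U. f y \<in> V})"
  proof (rule has_derivative_transform)
    show "(u' has_derivative D) (at a within \<phi> ` {y \<in> U. f y \<in> V})"
      using D by (rule has_derivative_at_withinI)
    show "u z = u' z" if "z \<in> \<phi> ` {y \<in> U. f y \<in> V}" for z
      using that P(4) aF U'(8) split_subspace_diff[OF U'(2)] by (auto simp: u'_def)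
  qed (use x in \<open>auto simp: a_def\<close>)
  moreover have "D ` F = H"
  proof
    show "D ` F \<subseteq> H" using QD Q(3) by (metis image_subsetI)
    show "H \<subseteq> D ` F" using DE PE P(3) Q(4) by (metis imageI subsetI)
  qed
  moreover have "split_subspace {h \<in> F. D h = 0}"
    by (rule split_subspace_kernel[OF U'(2) has_derivative_bounded_linear[OF D]
          has_derivative_bounded_linear[OF E]])
       (metis PE P(3), simp add: DE QD)
  ultimately show "\<exists>D. (\<psi> \<circ> f \<circ> inv_into U \<phi> has_derivative D) (at (\<phi> x) within \<phi> ` {y \<in> U. f y \<in> V}) \<and>
      D ` F = H \<and> split_subspace {h \<in> F. D h = 0}"
    unfolding u_def a_def by blast
qed

text \<open>
  An explicit local inverse takes the place of the inverse function theorem. All hypotheses are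
  local at \<open>a\<close> or at \<open>\<Phi> a\<close>: analyticity at a point spreads to a neighbourhood, and the chart domain is
  the set of points near \<open>a\<close> that \<open>\<Phi>\<close> maps near \<open>\<Phi> a\<close>. The additional property \<open>Q\<close> shrinks the domain
  as needed.
\<close>

lemma submanifold_chart_of_local_inverse:
  fixes \<Phi> \<Psi> :: "'e::banach \<Rightarrow> 'e"
  assumes \<Phi>: "real_analytic_at UNIV a \<Phi>" and \<Psi>: "real_analytic_at UNIV (\<Phi> a) \<Psi>"
    and inv: "\<forall>\<^sub>F v in nhds a. \<Psi> (\<Phi> v) = v" "\<forall>\<^sub>F z in nhds (\<Phi> a). \<Phi> (\<Psi> z) = z"
    and F: "split_subspace F" and S: "\<forall>\<^sub>F v in nhds a. v \<in> S \<longleftrightarrow> \<Phi> v \<in> F"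
    and Q: "\<forall>\<^sub>F v in nhds a. Q v"
  obtains U where "a \<in> U" "(U \<inter> S, \<Phi>, F) \<in> charts (submanifold banach_space_manifold S)"
    "\<And>v. v \<in> U \<Longrightarrow> Q v"
proof -
  have ev_analytic: "\<forall>\<^sub>F v in nhds x. real_analytic_at UNIV v f"
    if "real_analytic_at UNIV x f" for x and f :: "'e \<Rightarrow> 'e"
    using open_real_analytic_at[of f] that unfolding eventually_nhds by blast
  have "\<forall>\<^sub>F v in nhds a. real_analytic_at UNIV v \<Phi> \<and> \<Psi> (\<Phi> v) = v \<and> (v \<in> S \<longleftrightarrow> \<Phi> v \<in> F) \<and> Q v"
    using ev_analytic[OF \<Phi>] inv(1) S Q by eventually_elim auto
  then obtain V where V: "open V" "a \<in> V"
    "\<And>v. v \<in> V \<Longrightarrow> real_analytic_at UNIV v \<Phi> \<and> \<Psi> (\<Phi> v) = v \<and> (v \<in> S \<longleftrightarrow> \<Phi> v \<in> F) \<and> Q v"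
    unfolding eventually_nhds by blast
  have "\<forall>\<^sub>F z in nhds (\<Phi> a). real_analytic_at UNIV z \<Psi> \<and> \<Phi> (\<Psi> z) = z"
    using ev_analytic[OF \<Psi>] inv(2) by eventually_elim auto
  then obtain W where W: "open W" "\<Phi> a \<in> W"
    "\<And>z. z \<in> W \<Longrightarrow> real_analytic_at UNIV z \<Psi> \<and> \<Phi> (\<Psi> z) = z"
    unfolding eventually_nhds by blast
  have cont: "continuous_on V \<Phi>" "continuous_on W \<Psi>"
    using V(3) W(3) real_analytic_at_isCont continuous_at_imp_continuous_on by blast+
  define U where "U = V \<inter> \<Phi> -` W"
  have openU: "open U"
    unfolding U_def using cont(1) V(1) W(1) by (rule continuous_open_preimage)
  have img: "\<Phi> ` U = W \<inter> \<Psi> -` V"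
  proof
    show "\<Phi> ` U \<subseteq> W \<inter> \<Psi> -` V" using V(3) by (auto simp: U_def)
    show "W \<inter> \<Psi> -` V \<subseteq> \<Phi> ` U"
    proof
      fix z assume z: "z \<in> W \<inter> \<Psi> -` V"
      then have "\<Psi> z \<in> U" "\<Phi> (\<Psi> z) = z" using W(3)[of z] by (auto simp: U_def)
      then show "z \<in> \<Phi> ` U" by (metis imageI)
    qed
  qed
  have open_img: "open (\<Phi> ` U)"
    unfolding img using cont(2) W(1) V(1) by (rule continuous_open_preimage)
  have inj: "inj_on \<Phi> U"
    using V(3) unfolding U_def by (metis IntE inj_onI)
  have inv_eq: "inv_into U \<Phi> z = \<Psi> z" if "z \<in> \<Phi> ` U" for z
    using that inj V(3) by (auto simp: U_def)
  have "embedded_chart UNIV (U, \<Phi>, UNIV)"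
  proof -
    have "real_analytic_at UNIV (\<Phi> x) (inv_into U \<Phi>)" if "x \<in> U" for x
    proof (rule real_analytic_at_cong)
      show "real_analytic_at UNIV (\<Phi> x) \<Psi>" using W(3) that by (auto simp: U_def)
      have "\<forall>\<^sub>F z in nhds (\<Phi> x). z \<in> \<Phi> ` U"
        using that by (intro eventually_nhds_in_open[OF open_img]) auto
      then show "\<forall>\<^sub>F z in nhds (\<Phi> x). z - \<Phi> x \<in> UNIV \<longrightarrow> \<Psi> z = inv_into U \<Phi> z"
        by eventually_elim (simp add: inv_eq)
    qed
    then show ?thesis
      using openU open_img inj V(3)
      by (auto simp: embedded_chart_def split_subspace_UNIV U_def intro!: ambient_analytic_atI)
  qed
  then have "(U, \<Phi>, UNIV) \<in> maximal_atlas banach_space_manifold"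
    by (rule embedded_chart_maximal_atlas[OF embedded_manifold_banach_space])
  moreover have "\<Phi> ` (U \<inter> S) = \<Phi> ` U \<inter> F"
    using V(3) by (auto simp: U_def)
  ultimately have "(U \<inter> S, \<Phi>, F) \<in> charts (submanifold banach_space_manifold S)"
    using F by (auto simp: submanifold_def)
  moreover have "a \<in> U" using V(2) W(2) by (simp add: U_def)
  ultimately show ?thesis
    using V(3) by (intro that) (auto simp: U_def)
qed

section \<open>The inverse square root in a C*-algebra\<close>

lemma star_0 [simp]: "(0::'a::unital_cstar_algebra)\<^sup>\<star> = 0"
  using star_add[of "0::'a" 0] by simp

lemma star_minus: "(- x :: 'a::unital_cstar_algebra)\<^sup>\<star> = - (x\<^sup>\<star>)"
  using star_add[of x "- x"] by (simp add: eq_neg_iff_add_eq_0 add.commute)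

lemma star_diff: "(x - y :: 'a::unital_cstar_algebra)\<^sup>\<star> = x\<^sup>\<star> - y\<^sup>\<star>"
  using star_add[of x "- y"] by (simp add: star_minus)

lemma star_1 [simp]: "(1::'a::unital_cstar_algebra)\<^sup>\<star> = 1"
  using star_mult[of "1::'a" "1\<^sup>\<star>"] by (simp add: star_star)

lemma star_scaleR: "(r *\<^sub>R x :: 'a::unital_cstar_algebra)\<^sup>\<star> = r *\<^sub>R x\<^sup>\<star>"
  by (metis complex_cnj_complex_of_real scaleC_of_real star_scaleC)

lemma star_power: "(x ^ n :: 'a::unital_cstar_algebra)\<^sup>\<star> = x\<^sup>\<star> ^ n"
  by (induction n) (simp_all add: star_mult power_commutes)

lemmas star_simps = star_star star_add star_diff star_minus star_mult star_scaleR

lemma norm_star: "norm (x\<^sup>\<star> :: 'a::unital_cstar_algebra) = norm x"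
proof -
  have "norm y \<le> norm (y\<^sup>\<star>)" for y :: 'a
  proof (cases "y = 0")
    case False
    have "norm y * norm y \<le> norm (y\<^sup>\<star>) * norm y"
      using norm_mult_ineq[of "y\<^sup>\<star>" y] by (simp add: cstar_identity power2_eq_square)
    with False show ?thesis by simp
  qed simp
  from this[of x] this[of "x\<^sup>\<star>"] show ?thesis by (simp add: star_star)
qed

lemma bounded_linear_star: "bounded_linear (star :: 'a::unital_cstar_algebra \<Rightarrow> 'a)"
  by (rule bounded_linear_intro[of _ 1]) (auto simp: star_simps norm_star)

text \<open>
  The C*-identity gives \<open>\<parallel>1\<parallel> = \<parallel>1\<parallel>\<^sup>2\<close>; the value is \<open>0\<close> in the zero algebra.
\<close>

lemma norm_one_le: "norm (1::'a::unital_cstar_algebra) \<le> 1"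
proof (cases "norm (1::'a) = 0")
  case False
  then show ?thesis
    using cstar_identity[of "1::'a"] by (simp add: power2_eq_square)
qed simp

lemma norm_power_le: "norm (x ^ n :: 'a::unital_cstar_algebra) \<le> norm x ^ n"
proof (induction n)
  case (Suc n)
  have "norm (x ^ Suc n) \<le> norm x * norm (x ^ n)" by (simp add: norm_mult_ineq)
  also have "\<dots> \<le> norm x * norm x ^ n" using Suc by (intro mult_left_mono) auto
  finally show ?case by simp
qed (simp add: norm_one_le)

text \<open>
  The power \<open>z ^ n\<close> is the restriction to the diagonal of the \<open>n\<close>-linear map
  \<open>(h\<^sub>0, \<dots>, h\<^sub>n\<^sub>-\<^sub>1) \<mapsto> h\<^sub>0 \<cdots> h\<^sub>n\<^sub>-\<^sub>1\<close>.
\<close>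

primrec tuple_product :: "nat \<Rightarrow> (nat \<Rightarrow> 'a) \<Rightarrow> 'a::unital_cstar_algebra" where
  "tuple_product 0 h = 1"
| "tuple_product (Suc n) h = tuple_product n h * h n"

lemma tuple_product_cong: "(\<And>i. i < n \<Longrightarrow> h i = k i) \<Longrightarrow> tuple_product n h = tuple_product n k"
  by (induction n) auto

lemma tuple_product_upd_ge: "n \<le> i \<Longrightarrow> tuple_product n (h(i := v)) = tuple_product n h"
  by (rule tuple_product_cong) auto

lemma tuple_product_add:
  "i < n \<Longrightarrow> tuple_product n (h(i := v + w)) = tuple_product n (h(i := v)) + tuple_product n (h(i := w))"
  by (induction n) (auto simp: less_Suc_eq tuple_product_upd_ge algebra_simps)

lemma tuple_product_scaleR:
  "i < n \<Longrightarrow> tuple_product n (h(i := c *\<^sub>R v)) = c *\<^sub>R tuple_product n (h(i := v))"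
  by (induction n) (auto simp: less_Suc_eq tuple_product_upd_ge)

lemma norm_tuple_product: "norm (tuple_product n h) \<le> (\<Prod>i<n. norm (h i))"
proof (induction n)
  case (Suc n)
  have "norm (tuple_product (Suc n) h) \<le> norm (tuple_product n h) * norm (h n)"
    by (simp add: norm_mult_ineq)
  also have "\<dots> \<le> (\<Prod>i<n. norm (h i)) * norm (h n)"
    using Suc by (intro mult_right_mono) auto
  finally show ?case by simp
qed (simp add: norm_one_le)

lemma tuple_product_const: "tuple_product n (\<lambda>_. x) = x ^ n"
  by (induction n) (simp_all add: power_commutes)

abbreviation isqrt_coeff :: "nat \<Rightarrow> real" where
  "isqrt_coeff n \<equiv> (- 1 / 2) gchoose n"

text \<open>
  The binomial series of \<open>(1 + z)\<^sup>-\<^sup>1\<^sup>/\<^sup>2\<close>. It is the only power series in the charts: the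
  inverse of \<open>1 + z\<close> is its square, and the square root is its product with \<open>1 + z\<close>.
\<close>

definition isqrt :: "'a \<Rightarrow> 'a::unital_cstar_algebra" where
  "isqrt z = (\<Sum>n. isqrt_coeff n *\<^sub>R z ^ n)"

lemma abs_isqrt_coeff_le: "\<bar>isqrt_coeff n\<bar> \<le> 1"
proof (induction n)
  case (Suc n)
  have "isqrt_coeff (Suc n) = isqrt_coeff n * ((- 1 / 2 - real n) / real (Suc n))"
    using gbinomial_absorption'[of "Suc n" "- 1 / 2 :: real"]
    by (simp add: gbinomial_prod_rev atLeast0LessThan field_simps)
  moreover have "\<bar>(- 1 / 2 - real n) / real (Suc n)\<bar> \<le> 1"
    by (simp add: field_simps)
  ultimately show ?case
    using Suc by (simp only: abs_mult mult_le_one abs_ge_zero)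
qed simp

lemma summable_isqrt:
  assumes "norm (z :: 'a::unital_cstar_algebra) < 1"
  shows "summable (\<lambda>n. norm (isqrt_coeff n *\<^sub>R z ^ n))"
proof (rule summable_comparison_test'[where N = 0])
  show "summable (\<lambda>n. norm z ^ n)" using assms by simp
  show "norm (norm (isqrt_coeff n *\<^sub>R z ^ n)) \<le> norm z ^ n" for n
    using mult_mono[OF abs_isqrt_coeff_le[of n] norm_power_le[of z n]] by simp
qed

lemma isqrt_sums: "norm z < 1 \<Longrightarrow> (\<lambda>n. isqrt_coeff n *\<^sub>R z ^ n) sums isqrt z"
  unfolding isqrt_def by (rule summable_sums[OF summable_norm_cancel[OF summable_isqrt]])

lemma isqrt_0 [simp]: "isqrt 0 = 1"
proof -
  have "(0::'a) ^ n = 0" if "n > 0" for n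
    using that by (cases n) auto
  then have "(\<lambda>n. isqrt_coeff n *\<^sub>R (0::'a) ^ n) sums (\<Sum>n\<in>{0}. isqrt_coeff n *\<^sub>R 0 ^ n)"
    by (intro sums_finite) auto
  with isqrt_sums[of "0::'a"] show ?thesis
    by (simp add: sums_iff)
qed

text \<open>
  The Vandermonde convolution turns the square of the series into the Neumann series of
  \<open>(1 + z)\<^sup>-\<^sup>1\<close>.
\<close>

lemma isqrt_square:
  assumes z: "norm (z :: 'a::unital_cstar_algebra) < 1"
  shows "isqrt z * isqrt z * (1 + z) = 1"
proof -
  have coeff: "(\<Sum>i\<le>k. isqrt_coeff i * isqrt_coeff (k - i)) = (- 1) ^ k" for k
  proof -
    have "(\<Sum>i\<le>k. isqrt_coeff i * isqrt_coeff (k - i)) = (- 1 / 2 + - 1 / 2) gchoose k"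
      unfolding atMost_atLeast0 by (rule gbinomial_Vandermonde)
    also have "\<dots> = (- 1) ^ k * (1 + real k - 1 gchoose k)"
      using gbinomial_minus[of "1::real" k] by simp
    also have "\<dots> = (- 1) ^ k"
      using binomial_gbinomial[of k k, where 'a = real] by simp
    finally show ?thesis .
  qed
  define a where "a k = (- 1) ^ k *\<^sub>R z ^ k" for k
  have a: "summable a"
  proof (rule summable_comparison_test'[where N = 0])
    show "summable (\<lambda>n. norm z ^ n)" using z by simp
    show "norm (a n) \<le> norm z ^ n" for n by (simp add: a_def norm_power_le)
  qed
  have "isqrt z * isqrt z = (\<Sum>k. \<Sum>i\<le>k. (isqrt_coeff i *\<^sub>R z ^ i) * (isqrt_coeff (k - i) *\<^sub>R z ^ (k - i)))"
    unfolding isqrt_def by (rule Cauchy_product[OF summable_isqrt[OF z] summable_isqrt[OF z]])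
  also have "(\<lambda>k. \<Sum>i\<le>k. (isqrt_coeff i *\<^sub>R z ^ i) * (isqrt_coeff (k - i) *\<^sub>R z ^ (k - i))) = a"
  proof
    fix k
    have "(\<Sum>i\<le>k. (isqrt_coeff i *\<^sub>R z ^ i) * (isqrt_coeff (k - i) *\<^sub>R z ^ (k - i))) =
        (\<Sum>i\<le>k. (isqrt_coeff i * isqrt_coeff (k - i)) *\<^sub>R z ^ k)"
      by (intro sum.cong) (auto simp: power_add[symmetric] mult.commute)
    also have "\<dots> = (\<Sum>i\<le>k. isqrt_coeff i * isqrt_coeff (k - i)) *\<^sub>R z ^ k"
      by (rule scaleR_left.sum[symmetric])
    also have "\<dots> = a k"
      by (simp only: coeff a_def)
    finally show "(\<Sum>i\<le>k. (isqrt_coeff i *\<^sub>R z ^ i) * (isqrt_coeff (k - i) *\<^sub>R z ^ (k - i))) = a k" .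
  qed
  finally have sq: "isqrt z * isqrt z = suminf a" .
  have "suminf a * z = (\<Sum>n. a n * z)"
    by (rule suminf_mult2[OF a])
  also have "\<dots> = (\<Sum>n. - a (Suc n))"
    by (simp add: a_def power_commutes)
  also have "\<dots> = - (\<Sum>n. a (Suc n))"
    by (rule suminf_minus) (use a in \<open>simp add: summable_Suc_iff\<close>)
  also have "\<dots> = - (suminf a - 1)"
    using suminf_split_head[OF a] by (simp add: a_def)
  finally show ?thesis
    by (simp add: sq distrib_left)
qed

text \<open>
  Holds term by term. For \<open>z' = z\<close> this is commutation, and for \<open>z' = 0\<close> or \<open>z = 0\<close> it says that
  \<open>isqrt\<close> acts trivially on elements annihilated by its argument.
\<close>

lemma isqrt_intertwine:
  assumes "w * z = z' * w" and z: "norm z < 1" "norm z' < 1"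
  shows "w * isqrt z = isqrt z' * w"
proof -
  have "w * z ^ n = z' ^ n * w" for n
    by (induction n) (simp_all add: mult.assoc[symmetric] assms(1), simp add: mult.assoc assms(1))
  then have "(\<lambda>n. w * (isqrt_coeff n *\<^sub>R z ^ n)) = (\<lambda>n. (isqrt_coeff n *\<^sub>R z' ^ n) * w)"
    by simp
  then show ?thesis
    using sums_mult[OF isqrt_sums[OF z(1)], of w] sums_mult2[OF isqrt_sums[OF z(2)], of w]
    by (metis sums_unique2)
qed

lemma isqrt_commute: "norm z < 1 \<Longrightarrow> w * z = z * w \<Longrightarrow> w * isqrt z = isqrt z * w"
  by (rule isqrt_intertwine)

lemma isqrt_annihilate:
  assumes "norm z < 1"
  shows "w * z = 0 \<Longrightarrow> w * isqrt z = w" and "z * w = 0 \<Longrightarrow> isqrt z * w = w"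
  using isqrt_intertwine[of w z 0] isqrt_intertwine[of w 0 z] assms by auto

lemma star_isqrt:
  assumes z: "norm z < 1"
  shows "(isqrt z)\<^sup>\<star> = isqrt (z\<^sup>\<star>)"
proof -
  have "(\<lambda>n. (isqrt_coeff n *\<^sub>R z ^ n)\<^sup>\<star>) sums (isqrt z)\<^sup>\<star>"
    by (rule bounded_linear.sums[OF bounded_linear_star isqrt_sums[OF z]])
  moreover have "(\<lambda>n. isqrt_coeff n *\<^sub>R (z\<^sup>\<star>) ^ n) sums isqrt (z\<^sup>\<star>)"
    by (rule isqrt_sums) (simp add: norm_star z)
  ultimately show ?thesis
    by (simp add: star_scaleR star_power sums_unique2)
qed

lemma isqrt_inverse:
  assumes z: "norm z < 1"
  shows "isqrt z * isqrt z * (1 + z) = 1" "(1 + z) * (isqrt z * isqrt z) = 1"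
    "isqrt z * (1 + z) * isqrt z = 1" "isqrt z * (isqrt z * (1 + z)) = 1"
    "isqrt z * (1 + z) * (isqrt z * (1 + z)) = 1 + z"
    "isqrt z * (1 + z) = (1 + z) * isqrt z"
proof -
  have c: "(1 + z) * isqrt z = isqrt z * (1 + z)"
    by (rule isqrt_commute[OF z]) (simp add: distrib_left distrib_right)
  show "isqrt z * (1 + z) = (1 + z) * isqrt z" by (simp add: c)
  show 1: "isqrt z * isqrt z * (1 + z) = 1" by (rule isqrt_square[OF z])
  then show "isqrt z * (isqrt z * (1 + z)) = 1" by (simp add: mult.assoc)
  then show 2: "isqrt z * (1 + z) * isqrt z = 1" by (simp add: mult.assoc c)
  then show "(1 + z) * (isqrt z * isqrt z) = 1" by (simp add: mult.assoc[symmetric] c)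
  show "isqrt z * (1 + z) * (isqrt z * (1 + z)) = 1 + z"
    using 2 by (simp add: mult.assoc[symmetric])
qed

lemma real_analytic_at_isqrt_0: "real_analytic_at UNIV 0 isqrt"
proof -
  define A where "A n h = isqrt_coeff n *\<^sub>R tuple_product n h" for n and h :: "nat \<Rightarrow> 'a"
  have "bounded_multilinear_on UNIV n 1 (A n)" for n
  proof (rule bounded_multilinear_onI)
    fix h :: "nat \<Rightarrow> 'a"
    have "norm (A n h) \<le> 1 * (\<Prod>i<n. norm (h i))"
      unfolding A_def norm_scaleR
      by (intro mult_mono abs_isqrt_coeff_le norm_tuple_product) auto
    then show "norm (A n h) \<le> 1 * (\<Prod>i<n. norm (h i))" .
  qed (auto simp: A_def tuple_product_add tuple_product_scaleR scaleR_add_right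
      intro: tuple_product_cong)
  moreover have "(\<lambda>n. A n (\<lambda>_. h)) sums isqrt (0 + h)" if "norm h < 1 / 2" for h
    unfolding A_def tuple_product_const using isqrt_sums[of h] that by simp
  ultimately have "power_expansion UNIV A (\<lambda>_. 1) (1 / 2) 0 isqrt"
    by (simp add: power_expansion_def)
  then show ?thesis
    unfolding real_analytic_at_iff by blast
qed

lemma real_analytic_at_isqrt:
  "real_analytic_at UNIV x f \<Longrightarrow> f x = 0 \<Longrightarrow> real_analytic_at UNIV x (\<lambda>v. isqrt (f v))"
  using real_analytic_at_compose[of UNIV x f isqrt] real_analytic_at_isqrt_0 by (simp add: o_def)

lemma real_analytic_at_mult:
  fixes f g :: "'e::banach \<Rightarrow> 'a::unital_cstar_algebra"
  shows "real_analytic_at UNIV x f \<Longrightarrow> real_analytic_at UNIV x g \<Longrightarrow> real_analytic_at UNIV x (\<lambda>v. f v * g v)"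
  by (rule real_analytic_at_bilinear_compose[OF bounded_bilinear_mult]) auto

lemma real_analytic_at_star:
  fixes f :: "'e::banach \<Rightarrow> 'a::unital_cstar_algebra"
  shows "real_analytic_at UNIV x f \<Longrightarrow> real_analytic_at UNIV x (\<lambda>v. (f v)\<^sup>\<star>)"
  by (rule real_analytic_at_linear_compose[OF bounded_linear_star]) auto

lemma real_analytic_at_scaleR:
  "real_analytic_at UNIV x f \<Longrightarrow> real_analytic_at UNIV x (\<lambda>v. r *\<^sub>R f v)"
  by (rule real_analytic_at_linear_compose[OF bounded_linear_scaleR_right]) auto

lemma real_analytic_at_minus:
  "real_analytic_at UNIV x f \<Longrightarrow> real_analytic_at UNIV x (\<lambda>v. - f v)"
  by (rule real_analytic_at_linear_compose[OF bounded_linear_minus[OF bounded_linear_ident]]) auto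

lemma real_analytic_at_diff:
  "real_analytic_at UNIV x f \<Longrightarrow> real_analytic_at UNIV x g \<Longrightarrow> real_analytic_at UNIV x (\<lambda>v. f v - g v)"
  using real_analytic_at_add[OF _ real_analytic_at_minus] by fastforce

lemmas real_analytic_intros = real_analytic_at_const real_analytic_at_ident real_analytic_at_add
  real_analytic_at_diff real_analytic_at_minus real_analytic_at_scaleR real_analytic_at_mult
  real_analytic_at_star real_analytic_at_isqrt

lemma real_analytic_at_eventually_norm_less:
  assumes "real_analytic_at UNIV x f" "norm (f x) < c"
  shows "\<forall>\<^sub>F v in nhds x. norm (f v) < c"
proof -
  have "\<forall>\<^sub>F w in nhds (f x). norm w < c"
    using eventually_nhds_in_open[of "ball 0 c" "f x"] assms(2) by (simp add: dist_norm)
  with real_analytic_at_isCont[OF assms(1)] show ?thesis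
    using eventually_nhds_compose_within[of x UNIV f] by simp
qed

section \<open>Projections and partial isometries\<close>

lemma projections_iff: "p \<in> projections \<longleftrightarrow> p * p = p \<and> p\<^sup>\<star> = p"
  unfolding projections_def by (auto simp: power2_eq_square)

lemma partial_isometries_iff: "a \<in> partial_isometries \<longleftrightarrow> a * a\<^sup>\<star> * a = a"
proof
  assume "a \<in> partial_isometries"
  then have p: "a\<^sup>\<star> * (a * (a\<^sup>\<star> * a)) = a\<^sup>\<star> * a"
    by (simp add: partial_isometries_def projections_iff mult.assoc)
  let ?d = "a - a * a\<^sup>\<star> * a"
  have "?d\<^sup>\<star> * ?d = 0"
    by (simp add: star_simps algebra_simps p)
  then have "?d = 0"
    using cstar_identity[of ?d] by simp
  then show "a * a\<^sup>\<star> * a = a" by simp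
next
  assume a: "a * a\<^sup>\<star> * a = a"
  then have "a * (a\<^sup>\<star> * a) = a" "a * (a\<^sup>\<star> * (a * a\<^sup>\<star>)) = a * a\<^sup>\<star>"
    by (simp_all add: mult.assoc[symmetric])
  then show "a \<in> partial_isometries"
    by (simp add: partial_isometries_def projections_iff star_simps mult.assoc)
qed

lemma partial_isometry_rules:
  assumes "a \<in> partial_isometries"
  shows "a * (a\<^sup>\<star> * a) = a" "a * (a\<^sup>\<star> * (a * z)) = a * z"
    "a\<^sup>\<star> * (a * a\<^sup>\<star>) = a\<^sup>\<star>" "a\<^sup>\<star> * (a * (a\<^sup>\<star> * z)) = a\<^sup>\<star> * z"
proof -
  have a: "a * a\<^sup>\<star> * a = a" using assms by (simp add: partial_isometries_iff)
  then have b: "a\<^sup>\<star> * a * a\<^sup>\<star> = a\<^sup>\<star>"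
    by (metis mult.assoc star_mult star_star)
  show "a * (a\<^sup>\<star> * a) = a" "a * (a\<^sup>\<star> * (a * z)) = a * z"
    "a\<^sup>\<star> * (a * a\<^sup>\<star>) = a\<^sup>\<star>" "a\<^sup>\<star> * (a * (a\<^sup>\<star> * z)) = a\<^sup>\<star> * z"
    using a b by (simp_all add: mult.assoc[symmetric])
qed

lemma projections_subset_partial_isometries: "p \<in> projections \<Longrightarrow> p \<in> partial_isometries"
  by (simp add: projections_iff partial_isometries_iff)

lemma star_partial_isometry: "a \<in> partial_isometries \<Longrightarrow> a\<^sup>\<star> \<in> partial_isometries"
  by (simp add: partial_isometries_def star_star)

lemma projection_norm_less_1:
  assumes "e \<in> projections" "norm e < 1"
  shows "e = 0"
proof (rule ccontr)
  assume "e \<noteq> 0"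
  moreover have "norm e = (norm e)\<^sup>2"
    using cstar_identity[of e] assms(1) by (simp add: projections_iff)
  ultimately show False using assms(2) by (simp add: power2_eq_square)
qed

section \<open>Block decomposition along a partial isometry\<close>

text \<open>
  Write \<open>p = a\<^sup>\<star> a\<close> and \<open>q = a a\<^sup>\<star>\<close>. Left multiplication by \<open>a\<^sup>\<star>\<close> identifies \<open>q A\<close> with \<open>p A\<close>, so that
  the blocks of \<open>v\<close> may be taken in \<open>p A p\<close> (\<open>corner\<close>), \<open>(1 - q) A p\<close> (\<open>lower_block\<close>),
  \<open>p A (1 - p)\<close> (\<open>upper_block\<close>) and \<open>(1 - q) A (1 - p)\<close> (\<open>residual_block\<close>). Elements \<open>k\<close> of \<open>p A p\<close>
  that have to be inverted are represented by \<open>k + (1 - p)\<close>, which is invertible in \<open>A\<close> iff \<open>k\<close> is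
  invertible in \<open>p A p\<close>; these are the corner units. The defining equations are oriented as rewrite
  rules for right-nested products, where \<open>k p\<close> and \<open>p k\<close> both reduce to \<open>k - 1 + p\<close>.
\<close>

definition corner_unit :: "'a::unital_cstar_algebra \<Rightarrow> 'a \<Rightarrow> bool" where
  "corner_unit a k \<longleftrightarrow> a\<^sup>\<star> * (a * k) = k - 1 + a\<^sup>\<star> * a \<and> k * (a\<^sup>\<star> * a) = k - 1 + a\<^sup>\<star> * a"

definition corner :: "'a::unital_cstar_algebra \<Rightarrow> 'a \<Rightarrow> bool" where
  "corner a c \<longleftrightarrow> a\<^sup>\<star> * (a * c) = c \<and> c * (a\<^sup>\<star> * a) = c"

definition lower_block :: "'a::unital_cstar_algebra \<Rightarrow> 'a \<Rightarrow> bool" where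
  "lower_block a y \<longleftrightarrow> a\<^sup>\<star> * y = 0 \<and> y * (a\<^sup>\<star> * a) = y"

definition upper_block :: "'a::unital_cstar_algebra \<Rightarrow> 'a \<Rightarrow> bool" where
  "upper_block a x \<longleftrightarrow> a\<^sup>\<star> * (a * x) = x \<and> x * a\<^sup>\<star> = 0"

definition residual_block :: "'a::unital_cstar_algebra \<Rightarrow> 'a \<Rightarrow> bool" where
  "residual_block a e \<longleftrightarrow> a\<^sup>\<star> * e = 0 \<and> e * a\<^sup>\<star> = 0"

lemma mult_assoc_rule: "x * y = z \<Longrightarrow> x * (y * w) = z * (w :: 'a::semigroup_mult)"
  by (simp add: mult.assoc[symmetric])

lemma corner_unit_rules:
  assumes "corner_unit a k"
  shows "a\<^sup>\<star> * (a * k) = k - 1 + a\<^sup>\<star> * a" "a\<^sup>\<star> * (a * (k * z)) = k * z - z + a\<^sup>\<star> * (a * z)"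
    "k * (a\<^sup>\<star> * a) = k - 1 + a\<^sup>\<star> * a" "k * (a\<^sup>\<star> * (a * z)) = k * z - z + a\<^sup>\<star> * (a * z)"
proof -
  show *: "a\<^sup>\<star> * (a * k) = k - 1 + a\<^sup>\<star> * a" "k * (a\<^sup>\<star> * a) = k - 1 + a\<^sup>\<star> * a"
    using assms by (auto simp: corner_unit_def)
  have "a\<^sup>\<star> * (a * (k * z)) = (a\<^sup>\<star> * (a * k)) * z" "k * (a\<^sup>\<star> * (a * z)) = (k * (a\<^sup>\<star> * a)) * z"
    by (simp_all add: mult.assoc)
  then show "a\<^sup>\<star> * (a * (k * z)) = k * z - z + a\<^sup>\<star> * (a * z)"
    "k * (a\<^sup>\<star> * (a * z)) = k * z - z + a\<^sup>\<star> * (a * z)"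
    unfolding * by (simp_all add: algebra_simps)
qed

lemma corner_rules:
  assumes "corner a c"
  shows "a\<^sup>\<star> * (a * c) = c" "a\<^sup>\<star> * (a * (c * z)) = c * z"
    "c * (a\<^sup>\<star> * a) = c" "c * (a\<^sup>\<star> * (a * z)) = c * z"
  using assms mult_assoc_rule[of "a\<^sup>\<star> * a" c c z] mult_assoc_rule[of c "a\<^sup>\<star> * a" c z]
  by (auto simp: corner_def mult.assoc)

lemma lower_block_rules:
  assumes "lower_block a y"
  shows "a\<^sup>\<star> * y = 0" "a\<^sup>\<star> * (y * z) = 0" "y * (a\<^sup>\<star> * a) = y" "y * (a\<^sup>\<star> * (a * z)) = y * z"
    "y\<^sup>\<star> * a = 0" "y\<^sup>\<star> * (a * z) = 0" "a\<^sup>\<star> * (a * y\<^sup>\<star>) = y\<^sup>\<star>" "a\<^sup>\<star> * (a * (y\<^sup>\<star> * z)) = y\<^sup>\<star> * z"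
proof -
  show *: "a\<^sup>\<star> * y = 0" "y * (a\<^sup>\<star> * a) = y"
    using assms by (auto simp: lower_block_def)
  have "(a\<^sup>\<star> * y)\<^sup>\<star> = 0" "(y * (a\<^sup>\<star> * a))\<^sup>\<star> = y\<^sup>\<star>"
    unfolding * by simp_all
  then show **: "y\<^sup>\<star> * a = 0" "a\<^sup>\<star> * (a * y\<^sup>\<star>) = y\<^sup>\<star>"
    by (simp_all add: star_simps mult.assoc)
  show "a\<^sup>\<star> * (y * z) = 0" "y\<^sup>\<star> * (a * z) = 0"
    using *(1) **(1) by (simp_all add: mult.assoc[symmetric])
  show "y * (a\<^sup>\<star> * (a * z)) = y * z" "a\<^sup>\<star> * (a * (y\<^sup>\<star> * z)) = y\<^sup>\<star> * z"
    using *(2) **(2) by (simp_all add: mult.assoc[symmetric])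
qed

lemma upper_block_rules:
  assumes "upper_block a x"
  shows "x * a\<^sup>\<star> = 0" "x * (a\<^sup>\<star> * z) = 0" "a\<^sup>\<star> * (a * x) = x" "a\<^sup>\<star> * (a * (x * z)) = x * z"
    "a * x\<^sup>\<star> = 0" "a * (x\<^sup>\<star> * z) = 0" "x\<^sup>\<star> * (a\<^sup>\<star> * a) = x\<^sup>\<star>" "x\<^sup>\<star> * (a\<^sup>\<star> * (a * z)) = x\<^sup>\<star> * z"
proof -
  show *: "x * a\<^sup>\<star> = 0" "a\<^sup>\<star> * (a * x) = x"
    using assms by (auto simp: upper_block_def)
  have "(x * a\<^sup>\<star>)\<^sup>\<star> = 0" "(a\<^sup>\<star> * (a * x))\<^sup>\<star> = x\<^sup>\<star>"
    unfolding * by simp_all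
  then show **: "a * x\<^sup>\<star> = 0" "x\<^sup>\<star> * (a\<^sup>\<star> * a) = x\<^sup>\<star>"
    by (simp_all add: star_simps mult.assoc)
  show "x * (a\<^sup>\<star> * z) = 0" "a * (x\<^sup>\<star> * z) = 0"
    using *(1) **(1) by (simp_all add: mult.assoc[symmetric])
  show "a\<^sup>\<star> * (a * (x * z)) = x * z" "x\<^sup>\<star> * (a\<^sup>\<star> * (a * z)) = x\<^sup>\<star> * z"
    using *(2) **(2) by (simp_all add: mult.assoc[symmetric])
qed

lemma residual_block_rules:
  assumes "residual_block a e"
  shows "a\<^sup>\<star> * e = 0" "a\<^sup>\<star> * (e * z) = 0" "e * a\<^sup>\<star> = 0" "e * (a\<^sup>\<star> * z) = 0"
    "e\<^sup>\<star> * a = 0" "e\<^sup>\<star> * (a * z) = 0" "a * e\<^sup>\<star> = 0" "a * (e\<^sup>\<star> * z) = 0"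
proof -
  show *: "a\<^sup>\<star> * e = 0" "e * a\<^sup>\<star> = 0"
    using assms by (auto simp: residual_block_def)
  have "(a\<^sup>\<star> * e)\<^sup>\<star> = 0" "(e * a\<^sup>\<star>)\<^sup>\<star> = 0"
    unfolding * by simp_all
  then show **: "e\<^sup>\<star> * a = 0" "a * e\<^sup>\<star> = 0"
    by (simp_all add: star_simps)
  show "a\<^sup>\<star> * (e * z) = 0" "e * (a\<^sup>\<star> * z) = 0" "e\<^sup>\<star> * (a * z) = 0" "a * (e\<^sup>\<star> * z) = 0"
    using * ** by (simp_all add: mult.assoc[symmetric])
qed

lemma corner_unit_mult:
  assumes "corner_unit a k" "corner_unit a l"
  shows "corner_unit a (k * l)"
  by (simp add: corner_unit_def algebra_simps corner_unit_rules[OF assms(1)] corner_unit_rules[OF assms(2)])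

lemma corner_unit_star: "corner_unit a k \<Longrightarrow> corner_unit a (k\<^sup>\<star>)"
proof -
  assume k: "corner_unit a k"
  from k have "(a\<^sup>\<star> * (a * k))\<^sup>\<star> = (k - 1 + a\<^sup>\<star> * a)\<^sup>\<star>" "(k * (a\<^sup>\<star> * a))\<^sup>\<star> = (k - 1 + a\<^sup>\<star> * a)\<^sup>\<star>"
    by (simp_all add: corner_unit_def)
  then show ?thesis
    by (simp add: corner_unit_def star_simps mult.assoc)
qed

lemma corner_unit_add_1: "corner_unit a (1 + c) \<longleftrightarrow> corner a c"
  by (simp add: corner_unit_def corner_def algebra_simps)

lemma corner_unit_isqrt:
  assumes "corner a z" "norm z < 1"
  shows "corner_unit a (isqrt z)"
proof -
  have "(1 - a\<^sup>\<star> * a) * z = 0" "z * (1 - a\<^sup>\<star> * a) = 0"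
    using corner_rules[OF assms(1)] by (simp_all add: algebra_simps)
  from isqrt_annihilate(1)[OF assms(2) this(1)] isqrt_annihilate(2)[OF assms(2) this(2)]
  show ?thesis
    by (simp add: corner_unit_def algebra_simps)
qed

lemma corner_block_square:
  shows "lower_block a y \<Longrightarrow> corner a (y\<^sup>\<star> * y)" and "upper_block a x \<Longrightarrow> corner a (x * x\<^sup>\<star>)"
  using lower_block_rules[of a y] upper_block_rules[of a x]
  by (simp_all add: corner_def mult.assoc)

text \<open>
  The block matrix with diagonal block \<open>a k\<close>, off-diagonal blocks \<open>y k\<close> and \<open>a k x\<close>, and Schur complement
  \<open>e\<close>.
\<close>

definition assemble :: "'a::unital_cstar_algebra \<Rightarrow> 'a \<Rightarrow> 'a \<Rightarrow> 'a \<Rightarrow> 'a \<Rightarrow> 'a" where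
  "assemble a y k x e = (a + y) * k * (a\<^sup>\<star> * a + x) + e"

lemma assemble_blocks:
  assumes "a \<in> partial_isometries" "lower_block a y" "corner_unit a k" "upper_block a x" "residual_block a e"
  defines "v \<equiv> assemble a y k x e"
  shows "a\<^sup>\<star> * v * (a\<^sup>\<star> * a) = k - 1 + a\<^sup>\<star> * a"
    and "(1 - a * a\<^sup>\<star>) * v * (a\<^sup>\<star> * a) = y * k"
    and "a\<^sup>\<star> * v * (1 - a\<^sup>\<star> * a) = k * x"
    and "(1 - a * a\<^sup>\<star>) * v * (1 - a\<^sup>\<star> * a) = y * k * x + e"
proof -
  note rules = partial_isometry_rules[OF assms(1)] lower_block_rules[OF assms(2)]
    corner_unit_rules[OF assms(3)] upper_block_rules[OF assms(4)] residual_block_rules[OF assms(5)]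
  show "a\<^sup>\<star> * v * (a\<^sup>\<star> * a) = k - 1 + a\<^sup>\<star> * a"
    "(1 - a * a\<^sup>\<star>) * v * (a\<^sup>\<star> * a) = y * k"
    "a\<^sup>\<star> * v * (1 - a\<^sup>\<star> * a) = k * x"
    "(1 - a * a\<^sup>\<star>) * v * (1 - a\<^sup>\<star> * a) = y * k * x + e"
    by (simp_all add: v_def assemble_def algebra_simps rules)
qed

lemma sum_blocks:
  assumes "a \<in> partial_isometries" "lower_block a y" "upper_block a x" "corner a c" "residual_block a e"
  defines "z \<equiv> y + a * x + a * c + e"
  shows "(1 - a * a\<^sup>\<star>) * z * (a\<^sup>\<star> * a) = y"
    and "a\<^sup>\<star> * z * (1 - a\<^sup>\<star> * a) = x"
    and "a\<^sup>\<star> * z * (a\<^sup>\<star> * a) = c"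
    and "(1 - a * a\<^sup>\<star>) * z * (1 - a\<^sup>\<star> * a) = e"
proof -
  note rules = partial_isometry_rules[OF assms(1)] lower_block_rules[OF assms(2)]
    upper_block_rules[OF assms(3)] corner_rules[OF assms(4)] residual_block_rules[OF assms(5)]
  show "(1 - a * a\<^sup>\<star>) * z * (a\<^sup>\<star> * a) = y" "a\<^sup>\<star> * z * (1 - a\<^sup>\<star> * a) = x"
    "a\<^sup>\<star> * z * (a\<^sup>\<star> * a) = c" "(1 - a * a\<^sup>\<star>) * z * (1 - a\<^sup>\<star> * a) = e"
    by (simp_all add: z_def algebra_simps rules)
qed

lemma blocks:
  assumes "a \<in> partial_isometries"
  shows "lower_block a ((1 - a * a\<^sup>\<star>) * z * (a\<^sup>\<star> * a))"
    and "upper_block a (a\<^sup>\<star> * z * (1 - a\<^sup>\<star> * a))"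
    and "corner a (a\<^sup>\<star> * z * (a\<^sup>\<star> * a))"
    and "residual_block a ((1 - a * a\<^sup>\<star>) * z * (1 - a\<^sup>\<star> * a))"
    and "(1 - a * a\<^sup>\<star>) * z * (a\<^sup>\<star> * a) + a * (a\<^sup>\<star> * z * (1 - a\<^sup>\<star> * a)) +
      a * (a\<^sup>\<star> * z * (a\<^sup>\<star> * a)) + (1 - a * a\<^sup>\<star>) * z * (1 - a\<^sup>\<star> * a) = z"
  by (simp_all add: lower_block_def upper_block_def corner_def residual_block_def algebra_simps
      partial_isometry_rules[OF assms])

section \<open>The Cayley transform\<close>

text \<open>
  The formulas are \<open>(1 + c) (1 - c)\<^sup>-\<^sup>1\<close> and \<open>(w - 1) (w + 1)\<^sup>-\<^sup>1\<close>, where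
  \<open>w + 1 = 2 (1 + (w - 1) / 2)\<close>.
\<close>

definition cayley :: "'a::unital_cstar_algebra \<Rightarrow> 'a" where
  "cayley c = (1 + c) * (isqrt (- c) * isqrt (- c))"

definition inv_cayley :: "'a::unital_cstar_algebra \<Rightarrow> 'a" where
  "inv_cayley w = (1 / 2) *\<^sub>R ((w - 1) * (isqrt ((1 / 2) *\<^sub>R (w - 1)) * isqrt ((1 / 2) *\<^sub>R (w - 1))))"

lemma mult_inverse_eq_iff:
  fixes j u b w :: "'a::monoid_mult"
  assumes "j * u = 1" "u * j = 1"
  shows "b * j = w \<longleftrightarrow> w * u = b"
  using assms by (auto simp: mult.assoc)

lemma cayley_iff:
  assumes "norm c < 1"
  shows "cayley c = w \<longleftrightarrow> w * (1 - c) = 1 + c"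
proof -
  let ?j = "isqrt (- c) * isqrt (- c)"
  have "?j * (1 - c) = 1" "(1 - c) * ?j = 1"
    using isqrt_inverse(1,2)[of "- c"] assms by simp_all
  then show ?thesis
    unfolding cayley_def by (rule mult_inverse_eq_iff)
qed

lemma inv_cayley_iff:
  assumes "norm (w - 1) < 2"
  shows "inv_cayley w = c \<longleftrightarrow> c * (1 + w) = w - 1" and "(1 + w) * inv_cayley w = w - 1"
proof -
  let ?z = "(1 / 2) *\<^sub>R (w - 1)"
  let ?j = "isqrt ?z * isqrt ?z"
  have z: "norm ?z < 1" using assms by simp
  have half: "1 + ?z = (1 / 2) *\<^sub>R (1 + w)"
    by (simp add: algebra_simps flip: scaleR_add_left)
  have j: "?j * ((1 / 2) *\<^sub>R (1 + w)) = 1" "((1 / 2) *\<^sub>R (1 + w)) * ?j = 1"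
    using isqrt_inverse(1,2)[OF z] unfolding half by simp_all
  have eq: "inv_cayley w = (w - 1) * ((1 / 2) *\<^sub>R ?j)"
    by (simp add: inv_cayley_def)
  have j': "((1 / 2) *\<^sub>R ?j) * (1 + w) = 1" "(1 + w) * ((1 / 2) *\<^sub>R ?j) = 1"
    using j by simp_all
  show "inv_cayley w = c \<longleftrightarrow> c * (1 + w) = w - 1"
    unfolding eq using j' by (rule mult_inverse_eq_iff)
  have "(1 + w) * (w - 1) = (w - 1) * (1 + w)"
    by (simp add: algebra_simps)
  then have "(1 + w) * inv_cayley w = (w - 1) * ((1 + w) * ((1 / 2) *\<^sub>R ?j))"
    unfolding eq by (simp only: mult.assoc[symmetric])
  then show "(1 + w) * inv_cayley w = w - 1"
    by (simp only: j'(2) mult_1_right)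
qed

lemma cayley_inv_cayley:
  assumes "norm (w - 1) < 2" "norm (inv_cayley w) < 1"
  shows "cayley (inv_cayley w) = w"
  using inv_cayley_iff(2)[OF assms(1)] by (simp add: cayley_iff[OF assms(2)] algebra_simps)

lemma cayley_commute:
  assumes "norm c < 1"
  shows "c * cayley c = cayley c * c"
proof -
  have "c * isqrt (- c) = isqrt (- c) * c"
    by (rule isqrt_commute) (use assms in auto)
  then have "(1 + c) * (c * (isqrt (- c) * isqrt (- c))) = (1 + c) * ((isqrt (- c) * isqrt (- c)) * c)"
    by (metis mult.assoc)
  then show ?thesis
    by (simp add: cayley_def algebra_simps)
qed

lemma inv_cayley_cayley:
  assumes "norm c < 1" "norm (cayley c - 1) < 2"
  shows "inv_cayley (cayley c) = c"
  using cayley_iff[OF assms(1), of "cayley c"] cayley_commute[OF assms(1)]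
  by (simp add: inv_cayley_iff(1)[OF assms(2)] algebra_simps)

text \<open>
  The adjoint of \<open>w (1 - c) = 1 + c\<close> is \<open>(1 + c) w\<^sup>\<star> = 1 - c\<close> for skew \<open>c\<close>. As \<open>c\<close> commutes with \<open>w\<close>,
  this gives \<open>(1 + c) w w\<^sup>\<star> = w (1 - c) = 1 + c\<close>.
\<close>

lemma cayley_unitary:
  assumes c: "norm c < 1" "c\<^sup>\<star> = - c"
  shows "cayley c * (cayley c)\<^sup>\<star> = 1"
proof -
  let ?w = "cayley c"
  have w: "?w * (1 - c) = 1 + c" using cayley_iff[OF c(1)] by blast
  have "(1 - c)\<^sup>\<star> * ?w\<^sup>\<star> = (1 + c)\<^sup>\<star>" unfolding w[symmetric] by (simp add: star_mult)
  then have w': "(1 + c) * ?w\<^sup>\<star> = 1 - c" by (simp add: star_simps c(2))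
  have "(1 + c) * ?w = ?w * (1 + c)"
    using cayley_commute[OF c(1)] by (simp add: algebra_simps)
  then have "(1 + c) * (?w * ?w\<^sup>\<star>) = ?w * ((1 + c) * ?w\<^sup>\<star>)"
    by (simp only: mult.assoc[symmetric])
  also have "\<dots> = 1 + c" by (simp add: w' w)
  finally have "(1 + c) * (?w * ?w\<^sup>\<star>) = 1 + c" .
  then have "(isqrt c * isqrt c * (1 + c)) * (?w * ?w\<^sup>\<star>) = isqrt c * isqrt c * (1 + c)"
    by (simp only: mult.assoc)
  then show ?thesis
    by (simp only: isqrt_inverse(1)[OF c(1)] mult_1_left)
qed

text \<open>
  Multiplying the adjoint of \<open>(1 + w) c = w - 1\<close> by the unitary \<open>w\<close> from the right shows that \<open>- c\<^sup>\<star>\<close>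
  solves the equation \<open>c (1 + w) = w - 1\<close>, which determines \<open>c\<close>.
\<close>

lemma inv_cayley_skew:
  assumes w: "norm (w - 1) < 2" "w\<^sup>\<star> * w = 1"
  shows "(inv_cayley w)\<^sup>\<star> = - inv_cayley w"
proof -
  let ?c = "inv_cayley w"
  have "(?c\<^sup>\<star> * (1 + w)\<^sup>\<star>) * w = (w - 1)\<^sup>\<star> * w"
    unfolding inv_cayley_iff(2)[OF w(1), symmetric] by (simp add: star_mult)
  then have "(- (?c\<^sup>\<star>)) * (1 + w) = w - 1"
    by (simp add: star_simps algebra_simps w(2))
  then have "?c = - (?c\<^sup>\<star>)" by (simp only: inv_cayley_iff(1)[OF w(1)])
  then show ?thesis by (metis minus_minus)
qed

lemma corner_inv_cayley:
  assumes "corner_unit a w" "norm (w - 1) < 2"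
  shows "corner a (inv_cayley w)"
proof -
  have c: "corner a (w - 1)"
    using assms(1) corner_unit_add_1[of a "w - 1"] by simp
  then have "corner a ((1 / 2) *\<^sub>R (w - 1))"
    by (simp add: corner_def)
  then have "corner_unit a (isqrt ((1 / 2) *\<^sub>R (w - 1)))"
    using assms(2) by (intro corner_unit_isqrt) auto
  then have "corner_unit a (isqrt ((1 / 2) *\<^sub>R (w - 1)) * isqrt ((1 / 2) *\<^sub>R (w - 1)))"
    by (intro corner_unit_mult)
  from corner_unit_rules[OF this] corner_rules[OF c] show ?thesis
    by (simp add: corner_def inv_cayley_def mult.assoc) (simp add: algebra_simps)
qed

lemma corner_unit_cayley:
  assumes "corner a c" "norm c < 1"
  shows "corner_unit a (cayley c)"
proof -
  have "corner a (- c)" using assms(1) by (simp add: corner_def)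
  then show ?thesis
    unfolding cayley_def using assms
    by (intro corner_unit_mult corner_unit_isqrt) (auto simp: corner_unit_add_1)
qed

section \<open>Charts of the set of partial isometries\<close>

text \<open>
  Block elimination at \<open>a\<close>. The diagonal block is completed by \<open>1 - p\<close> to a corner unit, \<open>lower\<close> and
  \<open>upper\<close> are the off-diagonal blocks divided by it, and \<open>residual\<close> is the Schur complement.
\<close>

definition diagonal :: "'a::unital_cstar_algebra \<Rightarrow> 'a \<Rightarrow> 'a" where
  "diagonal a v = 1 - a\<^sup>\<star> * a + a\<^sup>\<star> * v * (a\<^sup>\<star> * a)"

definition inv_diagonal :: "'a::unital_cstar_algebra \<Rightarrow> 'a \<Rightarrow> 'a" where
  "inv_diagonal a v = isqrt (diagonal a v - 1) * isqrt (diagonal a v - 1)"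

definition lower :: "'a::unital_cstar_algebra \<Rightarrow> 'a \<Rightarrow> 'a" where
  "lower a v = (1 - a * a\<^sup>\<star>) * v * (a\<^sup>\<star> * a) * inv_diagonal a v"

definition upper :: "'a::unital_cstar_algebra \<Rightarrow> 'a \<Rightarrow> 'a" where
  "upper a v = inv_diagonal a v * (a\<^sup>\<star> * v * (1 - a\<^sup>\<star> * a))"

definition residual :: "'a::unital_cstar_algebra \<Rightarrow> 'a \<Rightarrow> 'a" where
  "residual a v = (1 - a * a\<^sup>\<star>) * v * (1 - a\<^sup>\<star> * a) - lower a v * diagonal a v * upper a v"

text \<open>
  This is \<open>(1 + y\<^sup>\<star> y)\<^sup>1\<^sup>/\<^sup>2 k (1 + x x\<^sup>\<star>)\<^sup>1\<^sup>/\<^sup>2\<close>, the unitary part of the diagonal block of a partial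
  isometry.
\<close>

definition normalize_diagonal :: "'a::unital_cstar_algebra \<Rightarrow> 'a \<Rightarrow> 'a \<Rightarrow> 'a" where
  "normalize_diagonal y k x =
     isqrt (y\<^sup>\<star> * y) * (1 + y\<^sup>\<star> * y) * k * (isqrt (x * x\<^sup>\<star>) * (1 + x * x\<^sup>\<star>))"

definition normalized :: "'a::unital_cstar_algebra \<Rightarrow> 'a \<Rightarrow> 'a" where
  "normalized a v = normalize_diagonal (lower a v) (diagonal a v) (upper a v)"

definition pi_chart :: "'a::unital_cstar_algebra \<Rightarrow> 'a \<Rightarrow> 'a" where
  "pi_chart a v = lower a v + a * upper a v + a * inv_cayley (normalized a v) + residual a v"

text \<open>
  The inverse of the chart: the diagonal block is rebuilt from the Cayley transform of the corner
  coordinate and the two off-diagonal coordinates.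
\<close>

definition pi_param :: "'a::unital_cstar_algebra \<Rightarrow> 'a \<Rightarrow> 'a" where
  "pi_param a z =
    (let y = (1 - a * a\<^sup>\<star>) * z * (a\<^sup>\<star> * a); x = a\<^sup>\<star> * z * (1 - a\<^sup>\<star> * a); c = a\<^sup>\<star> * z * (a\<^sup>\<star> * a)
     in assemble a y (isqrt (y\<^sup>\<star> * y) * cayley c * isqrt (x * x\<^sup>\<star>)) x ((1 - a * a\<^sup>\<star>) * z * (1 - a\<^sup>\<star> * a)))"

text \<open>
  The first five conditions make the power series and the Cayley transform converge. The last one
  excludes partial isometries with nonzero Schur complement, such as \<open>a + e\<close> for a partial isometry
  \<open>e\<close> in the residual block.
\<close>

definition pi_chart_domain :: "'a::unital_cstar_algebra \<Rightarrow> 'a \<Rightarrow> bool" where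
  "pi_chart_domain a v \<longleftrightarrow> norm (diagonal a v - 1) < 1 \<and> norm ((lower a v)\<^sup>\<star> * lower a v) < 1 \<and>
     norm (upper a v * (upper a v)\<^sup>\<star>) < 1 \<and> norm (normalized a v - 1) < 2 \<and>
     norm (inv_cayley (normalized a v)) < 1 \<and> norm (residual a v) * norm v < 1"

lemma inv_diagonal_inverse:
  assumes "norm (diagonal a v - 1) < 1"
  shows "inv_diagonal a v * diagonal a v = 1" "diagonal a v * inv_diagonal a v = 1"
  using isqrt_inverse(1,2)[OF assms] by (simp_all add: inv_diagonal_def)

lemma corner_unit_diagonal:
  assumes "a \<in> partial_isometries"
  shows "corner_unit a (diagonal a v)"
  by (simp add: corner_unit_def diagonal_def algebra_simps partial_isometry_rules[OF assms])

lemma corner_unit_inv_diagonal: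
  assumes "a \<in> partial_isometries" "norm (diagonal a v - 1) < 1"
  shows "corner_unit a (inv_diagonal a v)"
proof -
  have "corner a (diagonal a v - 1)"
    using corner_unit_diagonal[OF assms(1), of v] corner_unit_add_1[of a "diagonal a v - 1"] by simp
  then show ?thesis
    unfolding inv_diagonal_def using assms(2) by (intro corner_unit_mult corner_unit_isqrt)
qed

lemma chart_blocks:
  assumes a: "a \<in> partial_isometries" and k: "norm (diagonal a v - 1) < 1"
  shows "lower_block a (lower a v)" "upper_block a (upper a v)" "residual_block a (residual a v)"
    and "assemble a (lower a v) (diagonal a v) (upper a v) (residual a v) = v"
proof -
  note rules = partial_isometry_rules[OF a] corner_unit_rules[OF corner_unit_inv_diagonal[OF a k]]
    corner_unit_rules[OF corner_unit_diagonal[OF a, of v]]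
  show l: "lower_block a (lower a v)"
    by (simp add: lower_block_def lower_def algebra_simps rules)
  show u: "upper_block a (upper a v)"
    by (simp add: upper_block_def upper_def algebra_simps rules)
  note rules' = rules lower_block_rules[OF l] upper_block_rules[OF u]
  show "residual_block a (residual a v)"
    by (simp add: residual_block_def residual_def algebra_simps rules')
  have yk: "lower a v * diagonal a v = (1 - a * a\<^sup>\<star>) * v * (a\<^sup>\<star> * a)"
    using inv_diagonal_inverse(1)[OF k] by (simp add: lower_def mult.assoc)
  have kx: "diagonal a v * upper a v = a\<^sup>\<star> * v * (1 - a\<^sup>\<star> * a)"
    using inv_diagonal_inverse(2)[OF k] by (simp add: upper_def mult.assoc[symmetric])
  have ak: "a * diagonal a v = a * a\<^sup>\<star> * v * (a\<^sup>\<star> * a)"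
    by (simp add: diagonal_def algebra_simps partial_isometry_rules[OF a])
  have "(a + lower a v) * diagonal a v * (a\<^sup>\<star> * a + upper a v) =
      a * diagonal a v * (a\<^sup>\<star> * a) + a * (diagonal a v * upper a v) +
      lower a v * diagonal a v * (a\<^sup>\<star> * a) + lower a v * diagonal a v * upper a v"
    by (simp add: algebra_simps)
  then show "assemble a (lower a v) (diagonal a v) (upper a v) (residual a v) = v"
    unfolding assemble_def residual_def kx yk ak
    by (simp add: algebra_simps partial_isometry_rules[OF a])
qed

lemma corner_unit_normalize:
  assumes "lower_block a y" "upper_block a x" "corner_unit a k" "norm (y\<^sup>\<star> * y) < 1" "norm (x * x\<^sup>\<star>) < 1"
  shows "corner_unit a (normalize_diagonal y k x)"
  unfolding normalize_diagonal_def using assms corner_block_square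
  by (intro corner_unit_mult corner_unit_isqrt) (auto simp: corner_unit_add_1)

lemma isqrt_normalize_diagonal:
  assumes "norm (y\<^sup>\<star> * y) < 1" "norm (x * x\<^sup>\<star>) < 1"
  shows "isqrt (y\<^sup>\<star> * y) * normalize_diagonal y k x * isqrt (x * x\<^sup>\<star>) = k"
    and "normalize_diagonal y (isqrt (y\<^sup>\<star> * y) * w * isqrt (x * x\<^sup>\<star>)) x = w"
proof -
  let ?s = "isqrt (y\<^sup>\<star> * y)" and ?t = "isqrt (x * x\<^sup>\<star>)"
  have "?s * normalize_diagonal y k x * ?t =
      (?s * (?s * (1 + y\<^sup>\<star> * y))) * k * (?t * (1 + x * x\<^sup>\<star>) * ?t)"
    by (simp add: normalize_diagonal_def mult.assoc)
  then show "?s * normalize_diagonal y k x * ?t = k"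
    by (simp only: isqrt_inverse(3,4)[OF assms(1)] isqrt_inverse(3,4)[OF assms(2)] mult_1_left mult_1_right)
  have "normalize_diagonal y (?s * w * ?t) x =
      (?s * (1 + y\<^sup>\<star> * y) * ?s) * w * (?t * (?t * (1 + x * x\<^sup>\<star>)))"
    by (simp add: normalize_diagonal_def mult.assoc)
  then show "normalize_diagonal y (?s * w * ?t) x = w"
    by (simp only: isqrt_inverse(3,4)[OF assms(1)] isqrt_inverse(3,4)[OF assms(2)] mult_1_left mult_1_right)
qed

lemma pi_chart_blocks:
  assumes a: "a \<in> partial_isometries" and dom: "pi_chart_domain a v"
  shows "(1 - a * a\<^sup>\<star>) * pi_chart a v * (a\<^sup>\<star> * a) = lower a v"
    and "a\<^sup>\<star> * pi_chart a v * (1 - a\<^sup>\<star> * a) = upper a v"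
    and "a\<^sup>\<star> * pi_chart a v * (a\<^sup>\<star> * a) = inv_cayley (normalized a v)"
    and "(1 - a * a\<^sup>\<star>) * pi_chart a v * (1 - a\<^sup>\<star> * a) = residual a v"
proof -
  have d: "norm (diagonal a v - 1) < 1" using dom by (simp add: pi_chart_domain_def)
  have "corner a (inv_cayley (normalized a v))"
    using dom chart_blocks[OF a d] corner_unit_diagonal[OF a, of v] unfolding normalized_def
    by (intro corner_inv_cayley corner_unit_normalize) (auto simp: pi_chart_domain_def normalized_def)
  from sum_blocks[OF a chart_blocks(1,2)[OF a d] this chart_blocks(3)[OF a d]]
  show "(1 - a * a\<^sup>\<star>) * pi_chart a v * (a\<^sup>\<star> * a) = lower a v"
    "a\<^sup>\<star> * pi_chart a v * (1 - a\<^sup>\<star> * a) = upper a v"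
    "a\<^sup>\<star> * pi_chart a v * (a\<^sup>\<star> * a) = inv_cayley (normalized a v)"
    "(1 - a * a\<^sup>\<star>) * pi_chart a v * (1 - a\<^sup>\<star> * a) = residual a v"
    unfolding pi_chart_def by blast+
qed

lemma pi_param_chart:
  assumes a: "a \<in> partial_isometries" and dom: "pi_chart_domain a v"
  shows "pi_param a (pi_chart a v) = v"
proof -
  have d: "norm (diagonal a v - 1) < 1" using dom by (simp add: pi_chart_domain_def)
  have "cayley (inv_cayley (normalized a v)) = normalized a v"
    using dom by (intro cayley_inv_cayley) (auto simp: pi_chart_domain_def)
  then show ?thesis
    unfolding pi_param_def Let_def pi_chart_blocks[OF a dom]
    using dom isqrt_normalize_diagonal(1)[of "lower a v" "upper a v" "diagonal a v"] chart_blocks(4)[OF a d]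
    by (simp add: normalized_def pi_chart_domain_def)
qed

lemma pi_chart_param:
  fixes a z :: "'a::unital_cstar_algebra"
  assumes a: "a \<in> partial_isometries"
  defines "y \<equiv> (1 - a * a\<^sup>\<star>) * z * (a\<^sup>\<star> * a)" and "x \<equiv> a\<^sup>\<star> * z * (1 - a\<^sup>\<star> * a)"
    and "c \<equiv> a\<^sup>\<star> * z * (a\<^sup>\<star> * a)"
  assumes small: "norm (y\<^sup>\<star> * y) < 1" "norm (x * x\<^sup>\<star>) < 1" "norm c < 1" "norm (cayley c - 1) < 2"
    "norm (isqrt (y\<^sup>\<star> * y) * cayley c * isqrt (x * x\<^sup>\<star>) - 1) < 1"
  shows "pi_chart a (pi_param a z) = z"
proof -
  define e where "e = (1 - a * a\<^sup>\<star>) * z * (1 - a\<^sup>\<star> * a)"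
  define k where "k = isqrt (y\<^sup>\<star> * y) * cayley c * isqrt (x * x\<^sup>\<star>)"
  have y: "lower_block a y" and x: "upper_block a x" and c: "corner a c" and e: "residual_block a e"
    unfolding y_def x_def c_def e_def by (rule blocks[OF a])+
  have k: "corner_unit a k"
    unfolding k_def using small c corner_block_square(1)[OF y] corner_block_square(2)[OF x]
    by (intro corner_unit_mult corner_unit_isqrt corner_unit_cayley)
  define v where "v = assemble a y k x e"
  have v: "pi_param a z = v"
    by (simp add: pi_param_def Let_def v_def k_def y_def x_def c_def e_def)
  note b = assemble_blocks[OF a y k x e, folded v_def]
  have diag: "diagonal a v = k"
    by (simp add: diagonal_def b)
  have kk: "norm (diagonal a v - 1) < 1"
    using small by (simp add: diag k_def)
  note ki = inv_diagonal_inverse[OF kk, unfolded diag]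
  have low: "lower a v = y"
    unfolding lower_def b by (simp add: mult.assoc ki)
  have up: "upper a v = x"
    unfolding upper_def b by (simp add: mult.assoc[symmetric] ki)
  have res: "residual a v = e"
    by (simp add: residual_def b low up diag)
  have "normalized a v = cayley c"
    unfolding normalized_def low up diag unfolding k_def
    by (rule isqrt_normalize_diagonal(2)[OF small(1,2)])
  then have "inv_cayley (normalized a v) = c"
    using inv_cayley_cayley[OF small(3,4)] by simp
  then show ?thesis
    unfolding v pi_chart_def low up res using blocks(5)[OF a, of z]
    by (simp add: y_def x_def c_def e_def)
qed

lemma chart_functions_at_center:
  assumes a: "a \<in> partial_isometries"
  shows "diagonal a a = 1" "inv_diagonal a a = 1" "lower a a = 0" "upper a a = 0" "residual a a = 0"
    "normalized a a = 1" "pi_chart a a = 0"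
proof -
  show d: "diagonal a a = 1"
    by (simp add: diagonal_def algebra_simps partial_isometry_rules[OF a])
  then show i: "inv_diagonal a a = 1" by (simp add: inv_diagonal_def)
  show l: "lower a a = 0" and u: "upper a a = 0"
    by (simp_all add: lower_def upper_def i algebra_simps partial_isometry_rules[OF a])
  show r: "residual a a = 0"
    by (simp add: residual_def l u algebra_simps partial_isometry_rules[OF a])
  show n: "normalized a a = 1"
    by (simp add: normalized_def normalize_diagonal_def l u d)
  show "pi_chart a a = 0"
    by (simp add: pi_chart_def l u r n inv_cayley_def)
qed

lemma chart_functions_analytic:
  fixes a :: "'a::unital_cstar_algebra"
  assumes a: "a \<in> partial_isometries"
  shows "real_analytic_at UNIV a (diagonal a)" "real_analytic_at UNIV a (inv_diagonal a)"
    "real_analytic_at UNIV a (lower a)" "real_analytic_at UNIV a (upper a)"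
    "real_analytic_at UNIV a (residual a)" "real_analytic_at UNIV a (normalized a)"
    "real_analytic_at UNIV a (\<lambda>v. inv_cayley (normalized a v))" "real_analytic_at UNIV a (pi_chart a)"
proof -
  note center = chart_functions_at_center[OF a]
  show d: "real_analytic_at UNIV a (diagonal a)"
    unfolding diagonal_def[abs_def] by (intro real_analytic_intros)
  show i: "real_analytic_at UNIV a (inv_diagonal a)"
    unfolding inv_diagonal_def[abs_def] by (intro real_analytic_intros d) (simp_all add: center)
  show l: "real_analytic_at UNIV a (lower a)" and u: "real_analytic_at UNIV a (upper a)"
    unfolding lower_def[abs_def] upper_def[abs_def] by (intro real_analytic_intros i)+
  show r: "real_analytic_at UNIV a (residual a)"
    unfolding residual_def[abs_def] by (intro real_analytic_intros l u d)
  show n: "real_analytic_at UNIV a (normalized a)"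
    unfolding normalized_def[abs_def] normalize_diagonal_def
    by (intro real_analytic_intros l u d) (simp_all add: center)
  show c: "real_analytic_at UNIV a (\<lambda>v. inv_cayley (normalized a v))"
    unfolding inv_cayley_def by (intro real_analytic_intros n) (simp_all add: center)
  show "real_analytic_at UNIV a (pi_chart a)"
    unfolding pi_chart_def[abs_def] by (intro real_analytic_intros l u c r)
qed

lemma eventually_pi_chart_domain:
  assumes a: "a \<in> partial_isometries"
  shows "\<forall>\<^sub>F v in nhds a. pi_chart_domain a v"
proof -
  note center = chart_functions_at_center[OF a] and an = chart_functions_analytic[OF a]
  have 1: "\<forall>\<^sub>F v in nhds a. norm (diagonal a v - 1) < 1"
    by (rule real_analytic_at_eventually_norm_less, intro real_analytic_intros an) (simp add: center)
  have 2: "\<forall>\<^sub>F v in nhds a. norm ((lower a v)\<^sup>\<star> * lower a v) < 1"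
    by (rule real_analytic_at_eventually_norm_less, intro real_analytic_intros an) (simp add: center)
  have 3: "\<forall>\<^sub>F v in nhds a. norm (upper a v * (upper a v)\<^sup>\<star>) < 1"
    by (rule real_analytic_at_eventually_norm_less, intro real_analytic_intros an) (simp add: center)
  have 4: "\<forall>\<^sub>F v in nhds a. norm (normalized a v - 1) < 2"
    by (rule real_analytic_at_eventually_norm_less, intro real_analytic_intros an) (simp add: center)
  have 5: "\<forall>\<^sub>F v in nhds a. norm (inv_cayley (normalized a v)) < 1"
    by (rule real_analytic_at_eventually_norm_less, intro real_analytic_intros an)
       (simp add: center inv_cayley_def)
  have 6: "\<forall>\<^sub>F v in nhds a. norm (residual a v) < 1 / (norm a + 1)"
    by (rule real_analytic_at_eventually_norm_less, intro real_analytic_intros an)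
       (simp add: center add_nonneg_pos)
  have 7: "\<forall>\<^sub>F v in nhds a. norm v < norm a + 1"
    by (rule real_analytic_at_eventually_norm_less, intro real_analytic_intros) simp
  have small: "norm (residual a v) * norm v < 1"
    if "norm (residual a v) < 1 / (norm a + 1)" "norm v < norm a + 1" for v
  proof -
    have "norm (residual a v) * norm v \<le> norm (residual a v) * (norm a + 1)"
      using that(2) by (intro mult_left_mono) auto
    also have "\<dots> < 1"
      using that(1) by (simp add: pos_less_divide_eq add_nonneg_pos)
    finally show ?thesis .
  qed
  from 1 2 3 4 5 6 7 show ?thesis
    unfolding pi_chart_domain_def by eventually_elim (use small in auto)
qed

lemma pi_param_analytic:
  fixes a :: "'a::unital_cstar_algebra"
  assumes a: "a \<in> partial_isometries"
  shows "real_analytic_at UNIV 0 (pi_param a)"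
    and "\<forall>\<^sub>F z in nhds 0. pi_chart a (pi_param a z) = z"
proof -
  let ?y = "\<lambda>z. (1 - a * a\<^sup>\<star>) * z * (a\<^sup>\<star> * a)" and ?x = "\<lambda>z. a\<^sup>\<star> * z * (1 - a\<^sup>\<star> * a)"
  let ?c = "\<lambda>z. a\<^sup>\<star> * z * (a\<^sup>\<star> * a)"
  let ?k = "\<lambda>z. isqrt ((?y z)\<^sup>\<star> * ?y z) * cayley (?c z) * isqrt (?x z * (?x z)\<^sup>\<star>)"
  have y: "real_analytic_at UNIV 0 ?y" and x: "real_analytic_at UNIV 0 ?x" and c: "real_analytic_at UNIV 0 ?c"
    by (intro real_analytic_intros)+
  have w: "real_analytic_at UNIV 0 (\<lambda>z. cayley (?c z))"
    unfolding cayley_def by (intro real_analytic_intros) simp_all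
  have k: "real_analytic_at UNIV 0 ?k"
    by (intro real_analytic_intros w) simp_all
  show "real_analytic_at UNIV 0 (pi_param a)"
    unfolding pi_param_def[abs_def] Let_def assemble_def by (intro real_analytic_intros k)
  have 1: "\<forall>\<^sub>F z in nhds 0. norm ((?y z)\<^sup>\<star> * ?y z) < 1"
    by (rule real_analytic_at_eventually_norm_less, intro real_analytic_intros) simp
  have 2: "\<forall>\<^sub>F z in nhds 0. norm (?x z * (?x z)\<^sup>\<star>) < 1"
    by (rule real_analytic_at_eventually_norm_less, intro real_analytic_intros) simp
  have 3: "\<forall>\<^sub>F z in nhds 0. norm (?c z) < 1"
    by (rule real_analytic_at_eventually_norm_less, intro real_analytic_intros) simp
  have 4: "\<forall>\<^sub>F z in nhds 0. norm (cayley (?c z) - 1) < 2"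
    by (rule real_analytic_at_eventually_norm_less, intro real_analytic_intros w) (simp add: cayley_def)
  have 5: "\<forall>\<^sub>F z in nhds 0. norm (?k z - 1) < 1"
    by (rule real_analytic_at_eventually_norm_less, intro real_analytic_intros k) (simp add: cayley_def)
  from 1 2 3 4 5 show "\<forall>\<^sub>F z in nhds 0. pi_chart a (pi_param a z) = z"
    by eventually_elim (rule pi_chart_param[OF a])
qed

section \<open>Equations in the charts\<close>

text \<open>
  Row and column elimination isolate the Schur complement: \<open>l v = e = v r\<close> for the elements \<open>l\<close> and
  \<open>r\<close> below. Therefore \<open>e = l v r = l v v\<^sup>\<star> v r = e v\<^sup>\<star> e\<close>, and \<open>\<parallel>e\<parallel> \<le> \<parallel>e\<parallel>\<^sup>2 \<parallel>v\<parallel>\<close> forces \<open>e = 0\<close>.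
\<close>

lemma residual_zero:
  assumes a: "a \<in> partial_isometries" and dom: "pi_chart_domain a v" and v: "v \<in> partial_isometries"
  shows "residual a v = 0"
proof -
  have d: "norm (diagonal a v - 1) < 1" using dom by (simp add: pi_chart_domain_def)
  define y x e k where yxek: "y = lower a v" "x = upper a v" "e = residual a v" "k = diagonal a v"
  note b = chart_blocks[OF a d, folded yxek]
  note rules = partial_isometry_rules[OF a] lower_block_rules[OF b(1)] upper_block_rules[OF b(2)]
    residual_block_rules[OF b(3)]
  have xx: "x * x = 0" and ex: "e * x = 0"
    using upper_block_rules(2)[OF b(2), of "a * x"] residual_block_rules(4)[OF b(3), of "a * x"]
    by (simp_all add: upper_block_rules(3)[OF b(2)])
  define l where "l = 1 - a * a\<^sup>\<star> - y * a\<^sup>\<star>"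
  define r where "r = 1 - a\<^sup>\<star> * a - x"
  have lv: "l * v = e"
  proof -
    have "l * (a + y) = 0" by (simp add: l_def algebra_simps rules)
    then have "l * ((a + y) * k * (a\<^sup>\<star> * a + x)) = 0" by (simp add: mult.assoc[symmetric])
    moreover have "l * e = e" by (simp add: l_def algebra_simps rules)
    ultimately show ?thesis
      unfolding b(4)[symmetric] assemble_def by (simp add: distrib_left)
  qed
  have vr: "v * r = e"
  proof -
    have "(a\<^sup>\<star> * a + x) * r = 0" by (simp add: r_def algebra_simps rules xx)
    then have "(a + y) * k * (a\<^sup>\<star> * a + x) * r = 0" by (simp add: mult.assoc)
    moreover have "e * r = e" by (simp add: r_def algebra_simps rules ex)
    ultimately show ?thesis
      unfolding b(4)[symmetric] assemble_def by (simp add: distrib_right)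
  qed
  have "e = l * v * r" using vr lv by (simp add: r_def algebra_simps rules ex)
  also have "\<dots> = (l * v) * v\<^sup>\<star> * (v * r)"
    using v by (simp add: partial_isometries_iff mult.assoc) (simp add: mult.assoc[symmetric])
  finally have "e = e * v\<^sup>\<star> * e" by (simp only: lv vr)
  then have "norm e \<le> norm (e * v\<^sup>\<star>) * norm e" by (metis norm_mult_ineq)
  also have "\<dots> \<le> (norm e * norm v) * norm e"
    using norm_mult_ineq[of e "v\<^sup>\<star>"] by (intro mult_right_mono) (auto simp: norm_star)
  finally have "norm e * (1 - norm e * norm v) \<le> 0" by (simp add: algebra_simps)
  moreover have "1 - norm e * norm v > 0" using dom by (simp add: pi_chart_domain_def yxek)
  ultimately have "norm e \<le> 0" by (simp add: mult_le_0_iff)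
  then show ?thesis by (simp add: yxek)
qed

text \<open>
  For \<open>v = (a + y) k (p + x)\<close> one has \<open>(p + x) (p + x)\<^sup>\<star> = p (1 + x x\<^sup>\<star>)\<close> and
  \<open>(a + y)\<^sup>\<star> (a + y) = p (1 + y\<^sup>\<star> y)\<close>. Hence \<open>v v\<^sup>\<star> v = (a + y) m k (p + x)\<close>, where \<open>m\<close> is the left-hand
  side of the equation, and \<open>v v\<^sup>\<star> v = v\<close> amounts to \<open>m = 1\<close>.
\<close>

lemma block_product_partial_isometry_iff:
  assumes a: "a \<in> partial_isometries" and y: "lower_block a y" and x: "upper_block a x"
    and k: "corner_unit a k" and ki: "ki * k = 1" "k * ki = 1"
  shows "assemble a y k x 0 \<in> partial_isometries \<longleftrightarrow> k * (1 + x * x\<^sup>\<star>) * k\<^sup>\<star> * (1 + y\<^sup>\<star> * y) = 1"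
proof -
  let ?v = "assemble a y k x 0" and ?l = "a + y" and ?r = "a\<^sup>\<star> * a + x"
  define m where "m = k * (1 + x * x\<^sup>\<star>) * k\<^sup>\<star> * (1 + y\<^sup>\<star> * y)"
  note rules = partial_isometry_rules[OF a] lower_block_rules[OF y] upper_block_rules[OF x]
  have m: "corner_unit a m"
    unfolding m_def using k corner_block_square(1)[OF y] corner_block_square(2)[OF x]
    by (intro corner_unit_mult corner_unit_star) (simp_all add: corner_unit_add_1)
  have rr: "?r * ?r\<^sup>\<star> = a\<^sup>\<star> * a * (1 + x * x\<^sup>\<star>)" and ll: "?l\<^sup>\<star> * ?l = a\<^sup>\<star> * a * (1 + y\<^sup>\<star> * y)"
    by (simp_all add: star_simps algebra_simps rules)
  have pk: "k * (a\<^sup>\<star> * a) = a\<^sup>\<star> * a * k" "k\<^sup>\<star> * (a\<^sup>\<star> * a) = a\<^sup>\<star> * a * k\<^sup>\<star>"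
    using k corner_unit_star[OF k] by (simp_all add: corner_unit_def mult.assoc)
  have pp: "a\<^sup>\<star> * a * (a\<^sup>\<star> * a) = a\<^sup>\<star> * a" and px: "(1 + x * x\<^sup>\<star>) * (a\<^sup>\<star> * a) = a\<^sup>\<star> * a * (1 + x * x\<^sup>\<star>)"
    and lp: "?l * (a\<^sup>\<star> * a) = ?l"
    by (simp_all add: algebra_simps rules)
  have v: "?v = ?l * k * ?r" "?v\<^sup>\<star> = ?r\<^sup>\<star> * (k\<^sup>\<star> * ?l\<^sup>\<star>)"
    by (simp_all only: assemble_def add_0_right star_mult)
  have "?v * ?v\<^sup>\<star> * ?v = ?l * k * (?r * ?r\<^sup>\<star>) * k\<^sup>\<star> * (?l\<^sup>\<star> * ?l) * k * ?r"
    unfolding v(2) unfolding v(1) by (simp only: mult.assoc)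
  also have "\<dots> = ?l * ((k * (a\<^sup>\<star> * a)) * (1 + x * x\<^sup>\<star>) * (k\<^sup>\<star> * (a\<^sup>\<star> * a)) * (1 + y\<^sup>\<star> * y)) * k * ?r"
    unfolding rr ll by (simp only: mult.assoc)
  also have "\<dots> = ?l * (a\<^sup>\<star> * a * (k * ((1 + x * x\<^sup>\<star>) * (a\<^sup>\<star> * a)) * k\<^sup>\<star> * (1 + y\<^sup>\<star> * y))) * k * ?r"
    unfolding pk by (simp only: mult.assoc)
  also have "\<dots> = ?l * (a\<^sup>\<star> * a * ((k * (a\<^sup>\<star> * a)) * (1 + x * x\<^sup>\<star>) * k\<^sup>\<star> * (1 + y\<^sup>\<star> * y))) * k * ?r"
    unfolding px by (simp only: mult.assoc)
  also have "\<dots> = ?l * (a\<^sup>\<star> * a * (a\<^sup>\<star> * a)) * m * k * ?r"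
    unfolding pk m_def by (simp only: mult.assoc)
  also have "\<dots> = ?l * m * k * ?r"
    unfolding pp by (simp only: lp)
  finally have vvv: "?v * ?v\<^sup>\<star> * ?v = ?l * m * k * ?r" .
  show ?thesis
  proof
    assume "?v \<in> partial_isometries"
    then have eq: "?l * (m * k) * ?r = ?l * k * ?r"
      using vvv by (simp add: partial_isometries_iff assemble_def mult.assoc)
    have mk: "corner_unit a (m * k)" by (rule corner_unit_mult[OF m k])
    have "a\<^sup>\<star> * (?l * (m * k) * ?r) * (a\<^sup>\<star> * a) = m * k - 1 + a\<^sup>\<star> * a"
      by (simp add: algebra_simps rules corner_unit_rules[OF m] corner_unit_rules[OF k])
    moreover have "a\<^sup>\<star> * (?l * k * ?r) * (a\<^sup>\<star> * a) = k - 1 + a\<^sup>\<star> * a"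
      by (simp add: algebra_simps rules corner_unit_rules[OF k])
    ultimately have "m * k = k" using eq by simp
    then have "m * (k * ki) = k * ki" by (simp add: mult.assoc[symmetric])
    then show "k * (1 + x * x\<^sup>\<star>) * k\<^sup>\<star> * (1 + y\<^sup>\<star> * y) = 1"
      by (simp add: ki m_def)
  next
    assume "k * (1 + x * x\<^sup>\<star>) * k\<^sup>\<star> * (1 + y\<^sup>\<star> * y) = 1"
    then have "?v * ?v\<^sup>\<star> * ?v = ?v"
      using vvv by (simp add: m_def assemble_def)
    then show "?v \<in> partial_isometries" by (simp add: partial_isometries_iff)
  qed
qed

text \<open>
  With \<open>t\<close>, \<open>t'\<close> the square roots of \<open>1 + y\<^sup>\<star> y\<close>, \<open>1 + x x\<^sup>\<star>\<close> one has \<open>w = t k t'\<close>. As these roots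
  are self-adjoint, \<open>w w\<^sup>\<star> = t k (1 + x x\<^sup>\<star>) k\<^sup>\<star> t\<close>. An invertible \<open>k\<close> makes \<open>w\<close> invertible, so that
  \<open>w w\<^sup>\<star> = 1\<close> implies \<open>w\<^sup>\<star> w = 1\<close>.
\<close>

lemma normalize_diagonal_unitary_iff:
  assumes small: "norm (y\<^sup>\<star> * y) < 1" "norm (x * x\<^sup>\<star>) < 1" and ki: "ki * k = 1"
  defines "w \<equiv> normalize_diagonal y k x"
  shows "k * (1 + x * x\<^sup>\<star>) * k\<^sup>\<star> * (1 + y\<^sup>\<star> * y) = 1 \<longleftrightarrow> w * w\<^sup>\<star> = 1"
    and "w * w\<^sup>\<star> = 1 \<Longrightarrow> w\<^sup>\<star> * w = 1"
proof -
  define s where "s = isqrt (y\<^sup>\<star> * y)"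
  define t where "t = s * (1 + y\<^sup>\<star> * y)"
  define s' where "s' = isqrt (x * x\<^sup>\<star>)"
  define t' where "t' = s' * (1 + x * x\<^sup>\<star>)"
  have inv: "s * t = 1" "t * s = 1" "t * t = 1 + y\<^sup>\<star> * y" "s * s * (1 + y\<^sup>\<star> * y) = 1" "t = (1 + y\<^sup>\<star> * y) * s"
    unfolding t_def s_def using isqrt_inverse[OF small(1)] by simp_all
  have inv': "s' * t' = 1" "t' * s' = 1" "t' * t' = 1 + x * x\<^sup>\<star>" "t' = (1 + x * x\<^sup>\<star>) * s'"
    unfolding t'_def s'_def using isqrt_inverse[OF small(2)] by simp_all
  have "s\<^sup>\<star> = s" "s'\<^sup>\<star> = s'"
    unfolding s_def s'_def using small by (simp_all add: star_isqrt star_simps)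
  then have "t\<^sup>\<star> = (1 + y\<^sup>\<star> * y) * s" "t'\<^sup>\<star> = (1 + x * x\<^sup>\<star>) * s'"
    by (simp_all add: t_def t'_def star_simps)
  then have star_t: "t\<^sup>\<star> = t" "t'\<^sup>\<star> = t'"
    using inv(5) inv'(4) by simp_all
  have w: "w = t * k * t'"
    by (simp add: w_def normalize_diagonal_def t_def s_def t'_def s'_def)
  have ww: "w * w\<^sup>\<star> = t * (k * (1 + x * x\<^sup>\<star>) * k\<^sup>\<star>) * t"
    unfolding w inv'(3)[symmetric] by (simp add: star_mult star_t mult.assoc)
  show "k * (1 + x * x\<^sup>\<star>) * k\<^sup>\<star> * (1 + y\<^sup>\<star> * y) = 1 \<longleftrightarrow> w * w\<^sup>\<star> = 1"
  proof
    assume m: "k * (1 + x * x\<^sup>\<star>) * k\<^sup>\<star> * (1 + y\<^sup>\<star> * y) = 1"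
    have eq: "t * (k * (1 + x * x\<^sup>\<star>) * k\<^sup>\<star>) * t = t * (k * (1 + x * x\<^sup>\<star>) * k\<^sup>\<star> * (1 + y\<^sup>\<star> * y)) * s"
      by (simp only: inv(5) mult.assoc)
    show "w * w\<^sup>\<star> = 1"
      unfolding ww eq m by (simp only: mult_1_right inv(2))
  next
    assume "w * w\<^sup>\<star> = 1"
    then have "s * (t * (k * (1 + x * x\<^sup>\<star>) * k\<^sup>\<star>) * t) * (s * (1 + y\<^sup>\<star> * y)) = s * (s * (1 + y\<^sup>\<star> * y))"
      by (simp add: ww)
    moreover have "s * (t * (k * (1 + x * x\<^sup>\<star>) * k\<^sup>\<star>) * t) * (s * (1 + y\<^sup>\<star> * y)) =
        (s * t) * (k * (1 + x * x\<^sup>\<star>) * k\<^sup>\<star>) * (t * s) * (1 + y\<^sup>\<star> * y)"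
      by (simp only: mult.assoc)
    ultimately have "(s * t) * (k * (1 + x * x\<^sup>\<star>) * k\<^sup>\<star>) * (t * s) * (1 + y\<^sup>\<star> * y) = s * s * (1 + y\<^sup>\<star> * y)"
      by (simp only: mult.assoc)
    then show "k * (1 + x * x\<^sup>\<star>) * k\<^sup>\<star> * (1 + y\<^sup>\<star> * y) = 1"
      by (simp only: inv(1,2,4) mult_1_left mult_1_right)
  qed
  show "w\<^sup>\<star> * w = 1" if "w * w\<^sup>\<star> = 1"
  proof -
    have "(s' * ki * s) * w = s' * (ki * ((s * t) * k)) * t'"
      by (simp only: w mult.assoc)
    then have left: "(s' * ki * s) * w = 1"
      by (simp only: inv(1) inv'(1) ki mult_1_left mult_1_right)
    have "(s' * ki * s) * (w * w\<^sup>\<star>) = w\<^sup>\<star>"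
      unfolding mult.assoc[symmetric] left by simp
    then show ?thesis using left that by simp
  qed
qed

text \<open>
  In coordinates \<open>(y, x, c, e)\<close>: \<open>e = 0\<close> and \<open>c\<^sup>\<star> = - c\<close>. This is a real, not a complex subspace.
\<close>

definition pi_model :: "'a::unital_cstar_algebra \<Rightarrow> 'a set" where
  "pi_model a = {z. (1 - a * a\<^sup>\<star>) * z * (1 - a\<^sup>\<star> * a) = 0 \<and>
     (a\<^sup>\<star> * z * (a\<^sup>\<star> * a))\<^sup>\<star> = - (a\<^sup>\<star> * z * (a\<^sup>\<star> * a))}"

lemma pi_chart_model_iff:
  assumes a: "a \<in> partial_isometries" and dom: "pi_chart_domain a v"
  shows "pi_chart a v \<in> pi_model a \<longleftrightarrow>
    residual a v = 0 \<and> (inv_cayley (normalized a v))\<^sup>\<star> = - inv_cayley (normalized a v)"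
  by (simp only: pi_model_def mem_Collect_eq pi_chart_blocks[OF a dom])

lemma partial_isometry_block_equation:
  assumes a: "a \<in> partial_isometries" and dom: "pi_chart_domain a v" and e: "residual a v = 0"
  shows "v \<in> partial_isometries \<longleftrightarrow> diagonal a v * (1 + upper a v * (upper a v)\<^sup>\<star>) *
    (diagonal a v)\<^sup>\<star> * (1 + (lower a v)\<^sup>\<star> * lower a v) = 1"
proof -
  have d: "norm (diagonal a v - 1) < 1" using dom by (simp add: pi_chart_domain_def)
  note b = chart_blocks[OF a d]
  from block_product_partial_isometry_iff[OF a b(1,2) corner_unit_diagonal[OF a, of v]
      inv_diagonal_inverse[OF d]] b(4)
  show ?thesis by (simp only: e)
qed

lemma pi_chart_straightens:
  assumes a: "a \<in> partial_isometries" and dom: "pi_chart_domain a v"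
  shows "v \<in> partial_isometries \<longleftrightarrow> pi_chart a v \<in> pi_model a"
proof -
  have d: "norm (diagonal a v - 1) < 1" and w: "norm (normalized a v - 1) < 2"
    and c: "norm (inv_cayley (normalized a v)) < 1"
    using dom by (auto simp: pi_chart_domain_def)
  have "norm ((lower a v)\<^sup>\<star> * lower a v) < 1" "norm (upper a v * (upper a v)\<^sup>\<star>) < 1"
    using dom by (auto simp: pi_chart_domain_def)
  note unitary = normalize_diagonal_unitary_iff[OF this inv_diagonal_inverse(1)[OF d], folded normalized_def]
  have "normalized a v * (normalized a v)\<^sup>\<star> = 1 \<longleftrightarrow>
      (inv_cayley (normalized a v))\<^sup>\<star> = - inv_cayley (normalized a v)"
  proof
    assume "normalized a v * (normalized a v)\<^sup>\<star> = 1"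
    then show "(inv_cayley (normalized a v))\<^sup>\<star> = - inv_cayley (normalized a v)"
      using unitary(2) by (intro inv_cayley_skew[OF w])
  next
    assume "(inv_cayley (normalized a v))\<^sup>\<star> = - inv_cayley (normalized a v)"
    from cayley_unitary[OF c this] show "normalized a v * (normalized a v)\<^sup>\<star> = 1"
      by (simp only: cayley_inv_cayley[OF w c])
  qed
  then show ?thesis
    unfolding pi_chart_model_iff[OF a dom]
    using residual_zero[OF a dom] partial_isometry_block_equation[OF a dom] unitary(1) by blast
qed

lemma split_subspace_pi_model:
  fixes a :: "'a::unital_cstar_algebra"
  assumes a: "a \<in> partial_isometries"
  shows "split_subspace (pi_model a)"
proof -
  define c where "c z = a\<^sup>\<star> * z * (a\<^sup>\<star> * a)" for z
  define L where "L z = (1 - a * a\<^sup>\<star>) * z * (1 - a\<^sup>\<star> * a) + (1 / 2) *\<^sub>R (a * (c z + (c z)\<^sup>\<star>))" for z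
  note rules = partial_isometry_rules[OF a]
  have c: "a\<^sup>\<star> * (a * c z) = c z" "(c z)\<^sup>\<star> * (a\<^sup>\<star> * a) = (c z)\<^sup>\<star>"
    "c z * (a\<^sup>\<star> * a) = c z" "a\<^sup>\<star> * (a * (c z)\<^sup>\<star>) = (c z)\<^sup>\<star>" for z
    by (simp_all add: c_def star_simps algebra_simps rules)
  have lin: "bounded_linear c"
    unfolding c_def
    by (intro bounded_linear_intros bounded_linear_mult_const bounded_linear_const_mult bounded_linear_ident)
  have "bounded_linear L"
    unfolding L_def
    by (intro bounded_linear_add bounded_linear_compose[OF bounded_linear_scaleR_right]
        bounded_linear_mult_const bounded_linear_const_mult bounded_linear_ident lin
        bounded_linear_compose[OF bounded_linear_star lin])
  have cL: "c (L z) = (1 / 2) *\<^sub>R (c z + (c z)\<^sup>\<star>)" for z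
  proof -
    have "c (L z) = a\<^sup>\<star> * L z * (a\<^sup>\<star> * a)"
      by (simp only: c_def)
    also have "\<dots> = (1 / 2) *\<^sub>R (a\<^sup>\<star> * (a * ((c z + (c z)\<^sup>\<star>) * (a\<^sup>\<star> * a))))"
      by (simp add: L_def algebra_simps rules)
    finally show ?thesis by (simp add: algebra_simps c)
  qed
  have LL: "L (L z) = L z" for z
  proof -
    have half: "c (L z) + (c (L z))\<^sup>\<star> = c z + (c z)\<^sup>\<star>"
      by (simp add: cL star_simps algebra_simps flip: scaleR_add_left)
    have "(1 - a * a\<^sup>\<star>) * L z * (1 - a\<^sup>\<star> * a) = (1 - a * a\<^sup>\<star>) * z * (1 - a\<^sup>\<star> * a)"
      by (simp add: L_def algebra_simps rules)
    then show ?thesis by (simp add: L_def[of "L z"] half) (simp add: L_def)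
  qed
  have "split_subspace {z \<in> UNIV. L z = 0}"
    using \<open>bounded_linear L\<close> LL by (intro split_subspace_kernel[OF split_subspace_UNIV _ bounded_linear_ident]) auto
  moreover have "L z = 0 \<longleftrightarrow> z \<in> pi_model a" for z
  proof
    assume L: "L z = 0"
    have "c 0 = 0" by (simp add: c_def)
    with cL[of z] L have "(c z)\<^sup>\<star> = - c z" by (simp add: eq_neg_iff_add_eq_0 add.commute)
    then show "z \<in> pi_model a" using L by (simp add: L_def pi_model_def c_def)
  next
    assume "z \<in> pi_model a"
    then show "L z = 0" by (simp add: L_def pi_model_def c_def)
  qed
  ultimately show ?thesis by simp
qed

text \<open>
  In coordinates \<open>(y, x, c, e)\<close> at \<open>a = p\<close>: \<open>e = 0\<close>, \<open>c = 0\<close> and \<open>x\<^sup>\<star> = y\<close>. These are the self-adjoint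
  off-diagonal elements.
\<close>

definition projection_model :: "'a::unital_cstar_algebra \<Rightarrow> 'a set" where
  "projection_model p = {z. (1 - p) * z * (1 - p) = 0 \<and> p * z * p = 0 \<and> (p * z * (1 - p))\<^sup>\<star> = (1 - p) * z * p}"

lemma split_subspace_projection_model:
  fixes p :: "'a::unital_cstar_algebra"
  assumes p: "p \<in> projections"
  shows "split_subspace (projection_model p)"
proof (rule split_subspaceI)
  have pp: "p * p = p" "p\<^sup>\<star> = p" "p * (p * z) = p * z" for z
    using p by (simp_all add: projections_iff mult.assoc[symmetric])
  let ?P = "\<lambda>z. (1 / 2) *\<^sub>R (p * (z + z\<^sup>\<star>) * (1 - p) + (1 - p) * (z + z\<^sup>\<star>) * p)"
  show "bounded_linear ?P"
    by (intro bounded_linear_add bounded_linear_compose[OF bounded_linear_scaleR_right]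
        bounded_linear_mult_const bounded_linear_const_mult bounded_linear_ident bounded_linear_star)
  show "?P z \<in> projection_model p" for z
    by (simp add: projection_model_def star_simps algebra_simps pp)
  show "?P z = z" if "z \<in> projection_model p" for z
  proof -
    have z: "(1 - p) * z * (1 - p) = 0" "p * z * p = 0" "(p * z * (1 - p))\<^sup>\<star> = (1 - p) * z * p"
      using that by (auto simp: projection_model_def)
    have star_blocks: "(p * z * (1 - p))\<^sup>\<star> = (1 - p) * z\<^sup>\<star> * p" "((1 - p) * z * p)\<^sup>\<star> = p * z\<^sup>\<star> * (1 - p)"
      by (simp_all add: star_mult star_diff pp mult.assoc)
    then have z': "p * z\<^sup>\<star> * (1 - p) = p * z * (1 - p)" "(1 - p) * z\<^sup>\<star> * p = (1 - p) * z * p"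
      using z(3) by (metis star_star)+
    have "?P z = (1 / 2) *\<^sub>R (p * z * (1 - p) + p * z\<^sup>\<star> * (1 - p) + ((1 - p) * z * p + (1 - p) * z\<^sup>\<star> * p))"
      by (simp add: distrib_left distrib_right)
    also have "\<dots> = p * z * (1 - p) + (1 - p) * z * p"
      unfolding z' by (simp add: scaleR_add_right flip: scaleR_add_left)
    also have "\<dots> = p * z * p + p * z * (1 - p) + (1 - p) * z * p + (1 - p) * z * (1 - p)"
      by (simp add: z)
    also have "\<dots> = z" by (simp add: algebra_simps)
    finally show ?thesis .
  qed
qed

text \<open>
  If \<open>v\<close> is self-adjoint, then \<open>k\<^sup>\<star> = k\<close> and \<open>x\<^sup>\<star> = y\<close>, and the equation of the partial isometries
  becomes \<open>(k X)\<^sup>2 = 1\<close> with \<open>X = 1 + x x\<^sup>\<star>\<close>. As \<open>k X\<close> is near \<open>1\<close>, this gives \<open>k = X\<^sup>-\<^sup>1\<close>, that is, \<open>w = 1\<close>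
  and \<open>c = 0\<close>. Conversely, \<open>(p + x\<^sup>\<star>) X\<^sup>-\<^sup>1 (p + x)\<close> is the projection onto the graph of \<open>x\<^sup>\<star>\<close>.
\<close>

lemma projection_chart_straightens:
  assumes p: "p \<in> projections" and dom: "pi_chart_domain p v"
    and small: "norm (diagonal p v * (1 + upper p v * (upper p v)\<^sup>\<star>) - 1) < 2"
  shows "v \<in> projections \<longleftrightarrow> pi_chart p v \<in> projection_model p"
proof -
  have a: "p \<in> partial_isometries" by (rule projections_subset_partial_isometries[OF p])
  have pp: "p\<^sup>\<star> = p" "p * p = p" using p by (simp_all add: projections_iff)
  have d: "norm (diagonal p v - 1) < 1" and w: "norm (normalized p v - 1) < 2"
    and c: "norm (inv_cayley (normalized p v)) < 1"
    using dom by (auto simp: pi_chart_domain_def)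
  have yy: "norm ((lower p v)\<^sup>\<star> * lower p v) < 1" and xx: "norm (upper p v * (upper p v)\<^sup>\<star>) < 1"
    using dom by (auto simp: pi_chart_domain_def)
  define y x k ki where yxk: "y = lower p v" "x = upper p v" "k = diagonal p v" "ki = inv_diagonal p v"
  note b = chart_blocks[OF a d, folded yxk] and yy = yy[folded yxk] and xx = xx[folded yxk]
  note ki = inv_diagonal_inverse[OF d, folded yxk]
  have model: "pi_chart p v \<in> projection_model p \<longleftrightarrow>
      residual p v = 0 \<and> inv_cayley (normalized p v) = 0 \<and> x\<^sup>\<star> = y"
    unfolding projection_model_def yxk mem_Collect_eq
    by (simp only: pi_chart_blocks[OF a dom, unfolded pp])
  have s: "isqrt (x * x\<^sup>\<star>) * isqrt (x * x\<^sup>\<star>) * (1 + x * x\<^sup>\<star>) = 1"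
    "(1 + x * x\<^sup>\<star>) * (isqrt (x * x\<^sup>\<star>) * isqrt (x * x\<^sup>\<star>)) = 1"
    by (rule isqrt_inverse[OF xx])+
  show ?thesis
    unfolding model
  proof (intro iffI conjI)
    assume v: "v \<in> projections"
    then have vpi: "v \<in> partial_isometries" by (rule projections_subset_partial_isometries)
    show e: "residual p v = 0" by (rule residual_zero[OF a dom vpi])
    have vs: "v\<^sup>\<star> = v" using v by (simp add: projections_iff)
    have ks: "k\<^sup>\<star> = k"
      by (simp add: yxk diagonal_def star_simps pp vs mult.assoc)
    have "norm (k - 1) < 1" using d by (simp add: yxk)
    then have kis: "ki\<^sup>\<star> = ki"
      using ks by (simp add: yxk inv_diagonal_def star_mult star_isqrt star_diff)
    show xy: "x\<^sup>\<star> = y"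
      using kis by (simp add: yxk upper_def lower_def star_mult star_diff pp vs mult.assoc)
    let ?X = "1 + x * x\<^sup>\<star>"
    have "k * ?X * k\<^sup>\<star> * (1 + y\<^sup>\<star> * y) = 1"
      using partial_isometry_block_equation[OF a dom e] vpi by (simp only: yxk)
    then have sq: "(k * ?X) * (k * ?X) = 1"
      by (simp add: ks xy[symmetric] star_star mult.assoc)
    let ?u = "k * ?X"
    have u: "norm (?u - 1) < 2" using small by (simp only: yxk)
    \<comment> \<open>\<open>?u\<close> is an involution near \<open>1\<close>, so adding \<open>?u - 1\<close> to its inverse Cayley transform
       does not change the defining equation of the latter.\<close>
    have "(inv_cayley ?u + (?u - 1)) * (1 + ?u) = ?u - 1"
    proof -
      have "inv_cayley ?u * (1 + ?u) = ?u - 1" using inv_cayley_iff(1)[OF u] by blast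
      moreover have "(?u - 1) * (1 + ?u) = ?u * ?u - 1" by (simp add: left_diff_distrib distrib_left)
      ultimately show ?thesis using sq
        by (simp only: distrib_right diff_self add_0_right)
    qed
    then have "inv_cayley ?u = inv_cayley ?u + (?u - 1)" by (simp only: inv_cayley_iff(1)[OF u])
    then have u1: "k * ?X = 1" by simp
    then have "?X = ki" using ki(1) by (metis mult.assoc mult_1_left mult_1_right)
    then have Xk: "?X * k = 1" using ki(1) by simp
    let ?s = "isqrt (x * x\<^sup>\<star>)"
    have "normalized p v = ?s * (?X * k) * (?s * ?X)"
      by (simp add: normalized_def normalize_diagonal_def xy[symmetric] star_star mult.assoc flip: yxk)
    also have "\<dots> = 1" unfolding Xk using s(1) by (simp add: mult.assoc)
    finally show "inv_cayley (normalized p v) = 0" by (simp add: inv_cayley_def)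
  next
    assume *: "residual p v = 0 \<and> inv_cayley (normalized p v) = 0 \<and> x\<^sup>\<star> = y"
    then have "normalized p v = 1"
      using cayley_inv_cayley[OF w c] by (simp add: cayley_def)
    moreover have "y\<^sup>\<star> = x" "y = x\<^sup>\<star>"
      using * star_star[of x] by simp_all
    ultimately have k: "k = isqrt (x * x\<^sup>\<star>) * isqrt (x * x\<^sup>\<star>)"
      using isqrt_normalize_diagonal(1)[OF yy xx, of k]
      by (simp add: normalized_def star_star flip: yxk)
    then have ks: "k\<^sup>\<star> = k" and Xk: "(1 + x * x\<^sup>\<star>) * k = 1"
      using xx s by (simp_all add: star_mult star_isqrt star_star)
    have v: "v = (p + x\<^sup>\<star>) * k * (p + x)"
      using b(4) * by (simp add: assemble_def pp)
    note rules = upper_block_rules[OF b(2), unfolded pp]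
    have rr: "(p + x) * (p + x\<^sup>\<star>) = p * (1 + x * x\<^sup>\<star>)"
      using rules(1,5) rules(4)[of "x\<^sup>\<star>"] by (simp add: algebra_simps pp mult_assoc_rule[OF pp(2)])
    have pr: "p * (p + x) = p + x"
      using rules(3) by (simp add: distrib_left pp mult_assoc_rule[OF pp(2)])
    have "v * v = (p + x\<^sup>\<star>) * k * ((p + x) * (p + x\<^sup>\<star>)) * k * (p + x)"
      by (simp add: v mult.assoc)
    also have "\<dots> = (p + x\<^sup>\<star>) * k * (p * ((1 + x * x\<^sup>\<star>) * k) * (p + x))"
      unfolding rr by (simp only: mult.assoc)
    also have "\<dots> = v"
      unfolding Xk mult_1_right pr by (simp only: v)
    finally have "v * v = v" .
    moreover have "v\<^sup>\<star> = v"
      unfolding v by (simp add: star_mult star_add star_star pp ks mult.assoc)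
    ultimately show "v \<in> projections" by (simp add: projections_iff)
  qed
qed

text \<open>
  The hypotheses say that \<open>p1\<close> and \<open>p2\<close> project onto the graphs of \<open>u1\<close> and \<open>u2\<close>, regarded as maps from
  the range of \<open>p\<close> to its complement.
\<close>

lemma eq_projections_iff:
  fixes p1 p2 u1 u2 :: "'a::unital_cstar_algebra"
  assumes P: "p1\<^sup>\<star> = p1" "p2\<^sup>\<star> = p2" and r: "p1 * (p + u1) = p + u1" "p2 * (p + u2) = p + u2"
    and t: "p1 = (p + u1) * t1" "p2 = (p + u2) * t2"
    and u: "u1 * p = u1" "u2 * p = u2" "p * u1 = 0" "p * u2 = 0" and p: "p * p = p"
  shows "p1 = p2 \<longleftrightarrow> u1 = u2"
proof
  assume "u1 = u2"
  have "p1 * p2 = p2"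
    using \<open>u1 = u2\<close> r(1) t(2) by (metis mult.assoc)
  moreover have "p2 * p1 = p1"
    using \<open>u1 = u2\<close> r(2) t(1) by (metis mult.assoc)
  ultimately show "p1 = p2"
    using P by (metis star_mult)
next
  assume "p1 = p2"
  then have eq: "p + u1 = (p + u2) * (t2 * (p + u1))"
    using r(1) t(2) by (simp add: mult.assoc)
  have "p = p * (p + u1)" by (simp add: distrib_left p u)
  also have "\<dots> = p * (p + u2) * (t2 * (p + u1))"
    using eq by (simp only: mult.assoc)
  also have "p * (p + u2) = p" by (simp add: distrib_left p u)
  finally have pt: "p * (t2 * (p + u1)) = p" by simp
  have "p + u1 = (p + u2) * (p * (t2 * (p + u1)))"
    using eq by (simp add: mult.assoc[symmetric] distrib_right p u)
  also have "\<dots> = p + u2" by (simp add: pt distrib_right p u)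
  finally show "u1 = u2" by simp
qed

text \<open>
  The source projection of \<open>g = (a + y) k (p + x)\<close> has the range of \<open>p + x\<^sup>\<star>\<close>, and the target
  projection of \<open>h = (b + y') k' (b\<^sup>\<star> b + x')\<close> has the range of \<open>b + y'\<close>, which is that of
  \<open>p + y' b\<^sup>\<star>\<close> because \<open>p = b b\<^sup>\<star>\<close>.
\<close>

lemma composable_in_charts:
  assumes a: "a \<in> partial_isometries" and b: "b \<in> partial_isometries" and ab: "a\<^sup>\<star> * a = b * b\<^sup>\<star>"
    and g: "g \<in> partial_isometries" "pi_chart_domain a g"
    and h: "h \<in> partial_isometries" "pi_chart_domain b h"
  shows "g\<^sup>\<star> * g = h * h\<^sup>\<star> \<longleftrightarrow> (upper a g)\<^sup>\<star> = lower b h * b\<^sup>\<star>"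
proof -
  have dg: "norm (diagonal a g - 1) < 1" and dh: "norm (diagonal b h - 1) < 1"
    using g h by (auto simp: pi_chart_domain_def)
  define x k ki y where xkg: "x = upper a g" "k = diagonal a g" "ki = inv_diagonal a g" "y = lower a g"
  define y' k' ki' x' where ykh: "y' = lower b h" "k' = diagonal b h" "ki' = inv_diagonal b h" "x' = upper b h"
  let ?p = "a\<^sup>\<star> * a"
  note bg = chart_blocks[OF a dg, folded xkg] and bh = chart_blocks[OF b dh, folded ykh]
  have gv: "g = (a + y) * k * (?p + x)"
    using bg(4) by (simp add: assemble_def residual_zero[OF a g(2,1)])
  have hv: "h = (b + y') * k' * (b\<^sup>\<star> * b + x')"
    using bh(4) by (simp add: assemble_def residual_zero[OF b h(2,1)])
  note kig = inv_diagonal_inverse[OF dg, folded xkg] and kih = inv_diagonal_inverse[OF dh, folded ykh]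
  note ra = partial_isometry_rules[OF a] and rb = partial_isometry_rules[OF b]
  note rx = upper_block_rules[OF bg(2)] and ry = lower_block_rules[OF bg(1)]
  note rx' = upper_block_rules[OF bh(2)] and ry' = lower_block_rules[OF bh(1)]
  have k_comm: "?p * k = k * ?p" and k'_comm: "b\<^sup>\<star> * b * k' = k' * (b\<^sup>\<star> * b)"
    using corner_unit_diagonal[OF a, of g] corner_unit_diagonal[OF b, of h]
    by (simp_all add: xkg ykh corner_unit_def mult.assoc)
  have Pg: "(g\<^sup>\<star> * g)\<^sup>\<star> = g\<^sup>\<star> * g" and Ph: "(h * h\<^sup>\<star>)\<^sup>\<star> = h * h\<^sup>\<star>"
    by (simp_all add: star_simps)
  have rs: "(?p + x)\<^sup>\<star> = ?p + x\<^sup>\<star>"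
    by (simp add: star_simps)
  have tg: "g\<^sup>\<star> * g = (?p + x\<^sup>\<star>) * (k\<^sup>\<star> * (a + y)\<^sup>\<star> * g)"
    by (subst gv) (simp only: star_mult rs mult.assoc)
  have rg: "g\<^sup>\<star> * g * (?p + x\<^sup>\<star>) = ?p + x\<^sup>\<star>"
  proof -
    have "a\<^sup>\<star> * g = ?p * k * (?p + x)"
      by (simp add: gv distrib_left distrib_right mult.assoc[symmetric]) (simp add: ry mult.assoc)
    also have "\<dots> = k * (?p + x)"
      unfolding k_comm by (simp add: mult.assoc distrib_left ra rx)
    finally have "ki * (a\<^sup>\<star> * g) = ?p + x"
      by (simp add: mult.assoc[symmetric] kig)
    then have "(ki * (a\<^sup>\<star> * g))\<^sup>\<star> = ?p + x\<^sup>\<star>"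
      using rs by simp
    then have "?p + x\<^sup>\<star> = g\<^sup>\<star> * (a * ki\<^sup>\<star>)"
      by (simp add: star_simps mult.assoc)
    then show ?thesis
      using partial_isometry_rules(4)[OF g(1)] by (simp add: mult.assoc)
  qed
  have lb: "b + y' = (?p + y' * b\<^sup>\<star>) * b" and bs: "(b + y') * b\<^sup>\<star> = ?p + y' * b\<^sup>\<star>"
    unfolding ab by (simp_all add: distrib_right mult.assoc rb ry')
  have th: "h * h\<^sup>\<star> = (?p + y' * b\<^sup>\<star>) * (b * k' * (b\<^sup>\<star> * b + x') * h\<^sup>\<star>)"
  proof -
    have "h * h\<^sup>\<star> = (b + y') * (k' * (b\<^sup>\<star> * b + x') * h\<^sup>\<star>)"
      using arg_cong[OF hv, of "\<lambda>w. w * h\<^sup>\<star>"] by (simp only: mult.assoc)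
    then show ?thesis by (simp only: lb mult.assoc)
  qed
  have rh: "h * h\<^sup>\<star> * (?p + y' * b\<^sup>\<star>) = ?p + y' * b\<^sup>\<star>"
  proof -
    have "h * (b\<^sup>\<star> * b) = (b + y') * (k' * (b\<^sup>\<star> * b))"
      by (simp add: hv mult.assoc distrib_right distrib_left) (simp add: rb rx')
    also have "\<dots> = (b + y') * k'"
      unfolding k'_comm[symmetric] by (simp add: mult.assoc[symmetric] distrib_right) (simp add: mult.assoc rb ry')
    finally have "h * (b\<^sup>\<star> * b) * ki' = b + y'"
      by (simp add: mult.assoc kih)
    then have "h * (b\<^sup>\<star> * b) * ki' * b\<^sup>\<star> = ?p + y' * b\<^sup>\<star>"
      by (simp only: bs)
    then have "?p + y' * b\<^sup>\<star> = h * (b\<^sup>\<star> * b * ki' * b\<^sup>\<star>)"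
      by (simp only: mult.assoc)
    then show ?thesis
      using partial_isometry_rules(2)[OF h(1)] by (simp add: mult.assoc)
  qed
  have px: "x\<^sup>\<star> * ?p = x\<^sup>\<star>" "?p * x\<^sup>\<star> = 0" "?p * ?p = ?p"
    by (simp_all add: mult.assoc ra rx)
  have py: "(y' * b\<^sup>\<star>) * ?p = y' * b\<^sup>\<star>" "?p * (y' * b\<^sup>\<star>) = 0"
    unfolding ab by (simp_all add: mult.assoc rb ry')
  have "g\<^sup>\<star> * g = h * h\<^sup>\<star> \<longleftrightarrow> x\<^sup>\<star> = y' * b\<^sup>\<star>"
    by (rule eq_projections_iff[OF Pg Ph rg rh tg th px(1) py(1) px(2) py(2) px(3)])
  then show ?thesis by (simp only: xkg ykh)
qed

section \<open>Local sections of source and target\<close>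

text \<open>
  The factor \<open>isqrt\<close> is \<open>(p q p)\<^sup>-\<^sup>1\<^sup>/\<^sup>2\<close> in the corner of \<open>p = a\<^sup>\<star> a\<close>, completed by \<open>1 - p\<close>.
\<close>

definition source_section :: "'a::unital_cstar_algebra \<Rightarrow> 'a \<Rightarrow> 'a" where
  "source_section a q = a * isqrt (a\<^sup>\<star> * a * q * (a\<^sup>\<star> * a) - a\<^sup>\<star> * a) * q"

text \<open>
  With \<open>s\<close> for the inverse square root, \<open>\<sigma> \<sigma>\<^sup>\<star> = a s (p q p) s a\<^sup>\<star> = a a\<^sup>\<star>\<close>. So \<open>\<sigma>\<^sup>\<star> \<sigma>\<close> is a
  projection below \<open>q\<close>, and their difference is a projection of norm less than \<open>1\<close> for \<open>q\<close> near \<open>p\<close>.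
\<close>

lemma source_section:
  fixes a :: "'a::unital_cstar_algebra"
  assumes a: "a \<in> partial_isometries"
  shows "real_analytic_at UNIV (a\<^sup>\<star> * a) (source_section a)"
    and "source_section a (a\<^sup>\<star> * a) = a"
    and "\<forall>\<^sub>F q in nhds (a\<^sup>\<star> * a). q \<in> projections \<longrightarrow> source_section a q \<in> partial_isometries \<and>
      (source_section a q)\<^sup>\<star> * source_section a q = q \<and>
      source_section a q * (source_section a q)\<^sup>\<star> = a * a\<^sup>\<star>"
proof -
  let ?p = "a\<^sup>\<star> * a"
  let ?z = "\<lambda>q. ?p * q * ?p - ?p"
  let ?\<sigma> = "source_section a"
  note ra = partial_isometry_rules[OF a]
  have z: "?z ?p = 0" by (simp add: mult.assoc ra)
  have zan: "real_analytic_at UNIV ?p ?z" by (intro real_analytic_intros)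
  show an: "real_analytic_at UNIV ?p ?\<sigma>"
    unfolding source_section_def[abs_def] by (intro real_analytic_intros z)
  show center: "?\<sigma> ?p = a"
    unfolding source_section_def z by (simp add: ra)
  have "\<forall>\<^sub>F q in nhds ?p. norm (?z q) < 1"
    by (rule real_analytic_at_eventually_norm_less[OF zan]) (simp add: z)
  moreover have "\<forall>\<^sub>F q in nhds ?p. norm (q - (?\<sigma> q)\<^sup>\<star> * ?\<sigma> q) < 1"
    by (rule real_analytic_at_eventually_norm_less, intro real_analytic_intros an) (simp add: center)
  ultimately show "\<forall>\<^sub>F q in nhds ?p. q \<in> projections \<longrightarrow> ?\<sigma> q \<in> partial_isometries \<and>
      (?\<sigma> q)\<^sup>\<star> * ?\<sigma> q = q \<and> ?\<sigma> q * (?\<sigma> q)\<^sup>\<star> = a * a\<^sup>\<star>"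
  proof eventually_elim
    case (elim q)
    show ?case
    proof
      assume q: "q \<in> projections"
      then have qq: "q * q = q" "q\<^sup>\<star> = q" "q * (q * w) = q * w" for w
        by (simp_all add: projections_iff mult.assoc[symmetric])
      define s where "s = isqrt (?z q)"
      have \<sigma>: "?\<sigma> q = a * s * q" by (simp add: source_section_def s_def)
      have "corner a (?z q)" by (simp add: corner_def algebra_simps ra)
      then have s: "corner_unit a s" unfolding s_def by (rule corner_unit_isqrt) (rule elim(1))
      have "(?z q)\<^sup>\<star> = ?z q" by (simp add: star_simps qq mult.assoc)
      then have ss: "s\<^sup>\<star> = s" unfolding s_def using elim(1) by (simp add: star_isqrt)
      have as: "a * s = a * s * ?p" and sp: "?p * s = s * ?p"
        by (simp_all add: mult.assoc corner_unit_rules(1,3)[OF s] distrib_left right_diff_distrib ra)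
      have expand: "a * (s * (m - n) * s) * b = a * (s * m * s) * b - a * (s * n * s) * b" for m n b
        by (simp add: left_diff_distrib right_diff_distrib)
      have "?\<sigma> q * (?\<sigma> q)\<^sup>\<star> = a * s * q * (s * a\<^sup>\<star>)"
        by (simp add: \<sigma> star_simps ss qq mult.assoc)
      also have "\<dots> = a * (?p * s * q * (s * ?p)) * a\<^sup>\<star>"
        by (simp add: mult.assoc ra)
      also have "\<dots> = a * (s * (?p * q * ?p) * s) * a\<^sup>\<star>"
        unfolding sp by (simp only: mult.assoc sp[unfolded mult.assoc])
      also have "?p * q * ?p = (1 + ?z q) - (1 - ?p)" by simp
      also have "a * (s * ((1 + ?z q) - (1 - ?p)) * s) * a\<^sup>\<star> =
          a * (s * (1 + ?z q) * s) * a\<^sup>\<star> - a * (s * (1 - ?p) * s) * a\<^sup>\<star>"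
        by (rule expand)
      also have "s * (1 + ?z q) * s = 1"
        unfolding s_def by (rule isqrt_inverse(3)[OF elim(1)])
      also have "a * (s * (1 - ?p) * s) * a\<^sup>\<star> = 0"
      proof -
        have "s * (1 - ?p) = 1 - ?p" using s by (simp add: corner_unit_def algebra_simps)
        then have "a * (s * (1 - ?p) * s) = (a * (1 - ?p)) * s" by (simp add: mult.assoc)
        also have "a * (1 - ?p) = 0" by (simp add: right_diff_distrib ra)
        finally show ?thesis by simp
      qed
      finally have target: "?\<sigma> q * (?\<sigma> q)\<^sup>\<star> = a * a\<^sup>\<star>" by simp
      have pi: "?\<sigma> q \<in> partial_isometries"
        unfolding partial_isometries_iff target by (simp add: \<sigma> mult.assoc ra)
      let ?r = "(?\<sigma> q)\<^sup>\<star> * ?\<sigma> q"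
      have r: "?r * ?r = ?r" "?r\<^sup>\<star> = ?r"
        using pi by (simp_all add: partial_isometries_def projections_iff)
      have "q * ?r = ?r" "?r * q = ?r"
        by (simp_all add: \<sigma> star_simps ss qq mult.assoc)
      then have "q - ?r \<in> projections"
        using r qq by (simp add: projections_iff star_diff algebra_simps)
      then have "q - ?r = 0" by (rule projection_norm_less_1) (rule elim(2))
      with pi target show "?\<sigma> q \<in> partial_isometries \<and> ?r = q \<and> ?\<sigma> q * (?\<sigma> q)\<^sup>\<star> = a * a\<^sup>\<star>"
        by simp
    qed
  qed
qed

lemma target_section:
  fixes a :: "'a::unital_cstar_algebra"
  assumes a: "a \<in> partial_isometries"
  defines "\<tau> \<equiv> (\<lambda>q. (source_section (a\<^sup>\<star>) q)\<^sup>\<star>)"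
  shows "real_analytic_at UNIV (a * a\<^sup>\<star>) \<tau>" and "\<tau> (a * a\<^sup>\<star>) = a"
    and "\<forall>\<^sub>F q in nhds (a * a\<^sup>\<star>). q \<in> projections \<longrightarrow> \<tau> q \<in> partial_isometries \<and>
      \<tau> q * (\<tau> q)\<^sup>\<star> = q \<and> (\<tau> q)\<^sup>\<star> * \<tau> q = a\<^sup>\<star> * a"
proof -
  note s = source_section[OF star_partial_isometry[OF a], unfolded star_star]
  show "real_analytic_at UNIV (a * a\<^sup>\<star>) \<tau>"
    unfolding \<tau>_def by (intro real_analytic_intros s)
  show "\<tau> (a * a\<^sup>\<star>) = a"
    by (simp add: \<tau>_def s star_star)
  from s(3) show "\<forall>\<^sub>F q in nhds (a * a\<^sup>\<star>). q \<in> projections \<longrightarrow> \<tau> q \<in> partial_isometries \<and>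
      \<tau> q * (\<tau> q)\<^sup>\<star> = q \<and> (\<tau> q)\<^sup>\<star> * \<tau> q = a\<^sup>\<star> * a"
    by eventually_elim (auto simp: \<tau>_def star_star intro: star_partial_isometry)
qed

section \<open>The groupoid of partial isometries\<close>

lemma is_submanifold_banach_spaceI:
  assumes "\<And>a. a \<in> S \<Longrightarrow> \<exists>U \<phi> F. a \<in> U \<and> (U \<inter> S, \<phi>, F) \<in> charts (submanifold banach_space_manifold S)"
  shows "is_submanifold banach_space_manifold S"
proof -
  have "(\<Union>(U, \<phi>, F)\<in>charts (submanifold banach_space_manifold S). U) \<subseteq> S"
    by (auto simp: submanifold_def)
  moreover have "S \<subseteq> (\<Union>(U, \<phi>, F)\<in>charts (submanifold banach_space_manifold S). U)"
  proof
    fix a assume "a \<in> S"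
    with assms obtain U \<phi> F where "a \<in> U" "(U \<inter> S, \<phi>, F) \<in> charts (submanifold banach_space_manifold S)"
      by blast
    with \<open>a \<in> S\<close> show "a \<in> (\<Union>(U, \<phi>, F)\<in>charts (submanifold banach_space_manifold S). U)"
      by (intro UN_I[of "(U \<inter> S, \<phi>, F)"]) auto
  qed
  ultimately show ?thesis
    by (auto simp: is_submanifold_def banach_space_manifold_def)
qed

lemma partial_isometry_chart:
  assumes a: "a \<in> partial_isometries"
  obtains U where "a \<in> U" "(U \<inter> partial_isometries, pi_chart a, pi_model a) \<in> charts partial_isometry_manifold"
    "\<And>v. v \<in> U \<Longrightarrow> pi_chart_domain a v"
proof -
  have dom: "\<forall>\<^sub>F v in nhds a. pi_chart_domain a v"
    by (rule eventually_pi_chart_domain[OF a])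
  have 0: "pi_chart a a = 0"
    by (rule chart_functions_at_center(7)[OF a])
  show ?thesis
  proof (rule submanifold_chart_of_local_inverse)
    show "real_analytic_at UNIV a (pi_chart a)"
      by (rule chart_functions_analytic(8)[OF a])
    show "real_analytic_at UNIV (pi_chart a a) (pi_param a)"
      "\<forall>\<^sub>F z in nhds (pi_chart a a). pi_chart a (pi_param a z) = z"
      unfolding 0 by (rule pi_param_analytic[OF a])+
    show "\<forall>\<^sub>F v in nhds a. pi_param a (pi_chart a v) = v"
      using dom by eventually_elim (rule pi_param_chart[OF a])
    show "split_subspace (pi_model a)"
      by (rule split_subspace_pi_model[OF a])
    show "\<forall>\<^sub>F v in nhds a. v \<in> partial_isometries \<longleftrightarrow> pi_chart a v \<in> pi_model a"
      using dom by eventually_elim (rule pi_chart_straightens[OF a])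
    show "\<forall>\<^sub>F v in nhds a. pi_chart_domain a v"
      by (rule dom)
  qed (use that in \<open>auto simp: partial_isometry_manifold_def\<close>)
qed

lemma is_submanifold_partial_isometries: "is_submanifold banach_space_manifold partial_isometries"
  by (rule is_submanifold_banach_spaceI)
     (metis partial_isometry_chart partial_isometry_manifold_def)

lemma is_submanifold_projections:
  "is_submanifold banach_space_manifold (projections :: 'a::unital_cstar_algebra set)"
proof (rule is_submanifold_banach_spaceI)
  fix p :: 'a assume p: "p \<in> projections"
  then have a: "p \<in> partial_isometries" by (rule projections_subset_partial_isometries)
  have dom: "\<forall>\<^sub>F v in nhds p. pi_chart_domain p v"
    by (rule eventually_pi_chart_domain[OF a])
  have 0: "pi_chart p p = 0"
    by (rule chart_functions_at_center(7)[OF a])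
  have small: "\<forall>\<^sub>F v in nhds p. norm (diagonal p v * (1 + upper p v * (upper p v)\<^sup>\<star>) - 1) < 2"
    by (rule real_analytic_at_eventually_norm_less, intro real_analytic_intros chart_functions_analytic[OF a])
       (simp add: chart_functions_at_center[OF a])
  obtain U where "p \<in> U" "(U \<inter> projections, pi_chart p, projection_model p) \<in>
      charts (submanifold banach_space_manifold projections)"
  proof (rule submanifold_chart_of_local_inverse)
    show "real_analytic_at UNIV p (pi_chart p)"
      by (rule chart_functions_analytic(8)[OF a])
    show "real_analytic_at UNIV (pi_chart p p) (pi_param p)"
      "\<forall>\<^sub>F z in nhds (pi_chart p p). pi_chart p (pi_param p z) = z"
      unfolding 0 by (rule pi_param_analytic[OF a])+
    show "\<forall>\<^sub>F v in nhds p. pi_param p (pi_chart p v) = v"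
      using dom by eventually_elim (rule pi_param_chart[OF a])
    show "split_subspace (projection_model p)"
      by (rule split_subspace_projection_model[OF p])
    show "\<forall>\<^sub>F v in nhds p. v \<in> projections \<longleftrightarrow> pi_chart p v \<in> projection_model p"
      using dom small by eventually_elim (rule projection_chart_straightens[OF p])
    show "\<forall>\<^sub>F v in nhds p. True"
      by simp
  qed auto
  then show "\<exists>U \<phi> F. p \<in> U \<and> (U \<inter> projections, \<phi>, F) \<in> charts (submanifold banach_space_manifold projections)"
    by blast
qed

lemma embedded_projection_manifold:
  "embedded_manifold (projection_manifold :: ('a::unital_cstar_algebra, 'a) manifold) projections"
  unfolding projection_manifold_def
  by (rule embedded_manifold_submanifold[OF embedded_manifold_banach_space is_submanifold_projections])

lemma embedded_partial_isometry_manifold: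
  "embedded_manifold (partial_isometry_manifold :: ('a::unital_cstar_algebra, 'a) manifold) partial_isometries"
  unfolding partial_isometry_manifold_def
  by (rule embedded_manifold_submanifold[OF embedded_manifold_banach_space is_submanifold_partial_isometries])

lemma prod_manifold_chart:
  "(U, \<phi>, F) \<in> charts M \<Longrightarrow> (V, \<psi>, H) \<in> charts N \<Longrightarrow>
    (U \<times> V, map_prod \<phi> \<psi>, F \<times> H) \<in> charts (prod_manifold M N)"
  unfolding prod_manifold_def by simp blast

lemma image_Int_eq: "(\<And>w. w \<in> W \<Longrightarrow> w \<in> C \<longleftrightarrow> f w \<in> F) \<Longrightarrow> f ` (W \<inter> C) = f ` W \<inter> F"
  by blast

lemma real_analytic_at_product:
  "real_analytic_at UNIV x (\<lambda>z. fst z * snd z :: 'a::unital_cstar_algebra)"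
  by (rule real_analytic_at_bounded_bilinear[OF bounded_bilinear_mult])

text \<open>
  In the product of the charts at \<open>a\<close> and \<open>b\<close> the composable pairs are the kernel of the bounded
  linear map \<open>L\<close>. A right inverse of \<open>L\<close> on its image is \<open>w \<mapsto> (0, - w b)\<close>, which changes only the
  lower coordinate of the second factor.
\<close>

lemma is_submanifold_composable:
  "is_submanifold (prod_manifold partial_isometry_manifold partial_isometry_manifold)
     (composable (partial_isometry_groupoid :: ('a::unital_cstar_algebra, 'a) groupoid))"
proof -
  let ?G = "partial_isometry_manifold :: ('a, 'a) manifold"
  let ?PI = "partial_isometries :: 'a set"
  define C where "C = composable (partial_isometry_groupoid :: ('a, 'a) groupoid)"
  have C: "(g, h) \<in> C \<longleftrightarrow> g \<in> ?PI \<and> h \<in> ?PI \<and> g\<^sup>\<star> * g = h * h\<^sup>\<star>" for g h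
    by (simp add: C_def composable_def partial_isometry_groupoid_def)
  have emb: "embedded_manifold (prod_manifold ?G ?G) (?PI \<times> ?PI)"
    by (intro embedded_manifold_prod embedded_partial_isometry_manifold)
  have CPI: "C \<subseteq> ?PI \<times> ?PI" using C by auto
  have "(a, b) \<in> (\<Union>(U, \<phi>, F)\<in>charts (submanifold (prod_manifold ?G ?G) C). U)" if ab: "(a, b) \<in> C" for a b
  proof -
    have a: "a \<in> ?PI" and b: "b \<in> ?PI" and pq: "a\<^sup>\<star> * a = b * b\<^sup>\<star>" using ab C by auto
    obtain U where U: "a \<in> U" "(U \<inter> ?PI, pi_chart a, pi_model a) \<in> charts ?G"
      "\<And>v. v \<in> U \<Longrightarrow> pi_chart_domain a v"
      using partial_isometry_chart[OF a] by blast
    obtain V where V: "b \<in> V" "(V \<inter> ?PI, pi_chart b, pi_model b) \<in> charts ?G"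
      "\<And>v. v \<in> V \<Longrightarrow> pi_chart_domain b v"
      using partial_isometry_chart[OF b] by blast
    let ?W = "(U \<inter> ?PI) \<times> (V \<inter> ?PI)" and ?\<phi> = "map_prod (pi_chart a) (pi_chart b)"
      and ?F = "pi_model a \<times> pi_model b"
    define L where "L z = (a\<^sup>\<star> * fst z * (1 - a\<^sup>\<star> * a))\<^sup>\<star> - (1 - b * b\<^sup>\<star>) * snd z * (b\<^sup>\<star> * b) * b\<^sup>\<star>" for z
    define F' where "F' = {z \<in> ?F. L z = 0}"
    have "(?W, ?\<phi>, ?F) \<in> charts (prod_manifold ?G ?G)"
      by (rule prod_manifold_chart[OF U(2) V(2)])
    then have "embedded_chart (?PI \<times> ?PI) (?W, ?\<phi>, ?F)"
      using emb by (auto simp: embedded_manifold_def)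
    then have chart: "(?W, ?\<phi>, ?F) \<in> maximal_atlas (prod_manifold ?G ?G)"
      by (rule embedded_chart_maximal_atlas[OF emb])
    note ra = partial_isometry_rules[OF a] and rb = partial_isometry_rules[OF b]
    have split: "split_subspace F'"
      unfolding F'_def
    proof (rule split_subspace_kernel)
      show "split_subspace ?F"
        using a b by (intro split_subspace_Times split_subspace_pi_model)
      show "bounded_linear L"
        unfolding L_def
        by (intro bounded_linear_sub bounded_linear_compose[OF bounded_linear_star]
            bounded_linear_mult_const bounded_linear_const_mult bounded_linear_fst bounded_linear_snd)
      show "bounded_linear (\<lambda>w. (0 :: 'a, - (w * b)))"
        by (intro bounded_linear_Pair bounded_linear_zero bounded_linear_minus
            bounded_linear_mult_const bounded_linear_ident)
      fix z assume "z \<in> ?F"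
      have L: "L z = (1 - b * b\<^sup>\<star>) * (fst z)\<^sup>\<star> * a - (1 - b * b\<^sup>\<star>) * snd z * b\<^sup>\<star>"
        by (simp add: L_def star_simps mult.assoc rb pq)
      have bL: "b\<^sup>\<star> * L z = 0"
        unfolding L by (simp add: algebra_simps rb)
      have LB: "L z * (b * b\<^sup>\<star>) = L z"
        unfolding L using partial_isometry_rules(1)[OF a, unfolded pq]
        by (simp add: left_diff_distrib mult.assoc rb)
      show "(0, - (L z * b)) \<in> ?F"
        using bL by (simp add: pi_model_def algebra_simps rb mult_assoc_rule[OF bL])
      show "L (0, - (L z * b)) = L z"
        unfolding L_def[of "(0, _)"] using LB
        by (simp add: algebra_simps rb mult_assoc_rule[OF bL])
    qed
    have straight: "?\<phi> ` (?W \<inter> C) = ?\<phi> ` ?W \<inter> F'"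
    proof -
      have "w \<in> C \<longleftrightarrow> ?\<phi> w \<in> F'" if "w \<in> ?W" for w
      proof -
        obtain g h where w: "w = (g, h)" by (rule prod.exhaust)
        have g: "g \<in> ?PI" "pi_chart_domain a g" and h: "h \<in> ?PI" "pi_chart_domain b h"
          using that U(3) V(3) by (auto simp: w)
        have "L (?\<phi> (g, h)) = (upper a g)\<^sup>\<star> - lower b h * b\<^sup>\<star>"
          by (simp only: L_def map_prod_simp fst_conv snd_conv pi_chart_blocks[OF a g(2)] pi_chart_blocks[OF b h(2)])
        then show ?thesis
          using g h pi_chart_straightens[OF a g(2)] pi_chart_straightens[OF b h(2)]
            composable_in_charts[OF a b pq g h]
          by (simp add: w C F'_def)
      qed
      then show ?thesis by (rule image_Int_eq)
    qed
    have "(?W \<inter> C, ?\<phi>, F') \<in> charts (submanifold (prod_manifold ?G ?G) C)"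
      using chart split straight unfolding submanifold_def F'_def by auto
    moreover have "(a, b) \<in> ?W \<inter> C" using ab a b U(1) V(1) by simp
    ultimately show ?thesis by (intro UN_I[of "(?W \<inter> C, ?\<phi>, F')"]) auto
  qed
  then have "C \<subseteq> (\<Union>(U, \<phi>, F)\<in>charts (submanifold (prod_manifold ?G ?G) C). U)"
    by auto
  moreover have "(\<Union>(U, \<phi>, F)\<in>charts (submanifold (prod_manifold ?G ?G) C). U) \<subseteq> C"
    by (auto simp: submanifold_def)
  ultimately show ?thesis
    using emb CPI unfolding is_submanifold_def C_def[symmetric] by (auto simp: embedded_manifold_def)
qed

lemma is_groupoid_partial_isometry: "is_groupoid partial_isometry_groupoid"
proof -
  have prod: "(a * b) * (a * b)\<^sup>\<star> = a * a\<^sup>\<star>" "(a * b)\<^sup>\<star> * (a * b) = b\<^sup>\<star> * b" "a * b \<in> partial_isometries"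
    if "a \<in> partial_isometries" "b \<in> partial_isometries" "a\<^sup>\<star> * a = b * b\<^sup>\<star>" for a b :: 'a
  proof -
    note ra = partial_isometry_rules[OF that(1)] and rb = partial_isometry_rules[OF that(2)]
    have "(a * b) * (a * b)\<^sup>\<star> = a * (b * b\<^sup>\<star>) * a\<^sup>\<star>" by (simp add: star_mult mult.assoc)
    then show t: "(a * b) * (a * b)\<^sup>\<star> = a * a\<^sup>\<star>" by (simp add: that(3)[symmetric] mult.assoc ra)
    have "(a * b)\<^sup>\<star> * (a * b) = b\<^sup>\<star> * (a\<^sup>\<star> * a) * b" by (simp add: star_mult mult.assoc)
    then show "(a * b)\<^sup>\<star> * (a * b) = b\<^sup>\<star> * b" by (simp add: that(3) mult.assoc rb)
    show "a * b \<in> partial_isometries"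
      unfolding partial_isometries_iff t by (simp add: mult.assoc ra)
  qed
  show ?thesis
    unfolding is_groupoid_def composable_def partial_isometry_groupoid_def
    using prod
    by (auto simp: projections_subset_partial_isometries star_partial_isometry star_star mult.assoc
        partial_isometry_rules, auto simp: partial_isometries_def projections_iff)
qed

text \<open>
  A section \<open>\<sigma>\<close> through \<open>x \<in> U\<close> maps points near \<open>f x\<close> into \<open>U\<close>, so these points lie in \<open>f ` U\<close>.
\<close>

lemma open_map_of_local_sections:
  assumes f: "f \<in> X \<rightarrow> Y"
    and sections: "\<And>x. x \<in> X \<Longrightarrow> \<exists>\<sigma>. real_analytic_at UNIV (f x) \<sigma> \<and> \<sigma> (f x) = x \<and>
      (\<forall>\<^sub>F y in nhds (f x). y \<in> Y \<longrightarrow> \<sigma> y \<in> X \<and> f (\<sigma> y) = y)"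
  shows "open_map (top_of_set X) (top_of_set Y) f"
  unfolding open_map_def
proof (intro allI impI)
  fix U assume U: "openin (top_of_set X) U"
  show "openin (top_of_set Y) (f ` U)"
    unfolding openin_contains_ball
  proof (intro conjI ballI)
    show "f ` U \<subseteq> Y" using f openin_imp_subset[OF U] by blast
    fix y assume "y \<in> f ` U"
    then obtain x where x: "x \<in> U" "y = f x" by blast
    then have "x \<in> X" using openin_imp_subset[OF U] by blast
    from sections[OF this] obtain \<sigma> where \<sigma>: "real_analytic_at UNIV y \<sigma>" "\<sigma> y = x"
      "\<forall>\<^sub>F y' in nhds y. y' \<in> Y \<longrightarrow> \<sigma> y' \<in> X \<and> f (\<sigma> y') = y'"
      using x(2) by blast
    have "\<forall>\<^sub>F y' in nhds y. \<sigma> y' \<in> X \<longrightarrow> \<sigma> y' \<in> U"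
      using eventually_nhds_compose_within[of y UNIV \<sigma> "\<lambda>z. z \<in> X \<longrightarrow> z \<in> U"]
        real_analytic_at_isCont[OF \<sigma>(1)] eventually_openin[OF U x(1)] \<sigma>(2) by simp
    with \<sigma>(3) have "\<forall>\<^sub>F y' in nhds y. y' \<in> Y \<longrightarrow> y' \<in> f ` U"
      by eventually_elim (metis imageI)
    then show "\<exists>e>0. ball y e \<inter> Y \<subseteq> f ` U"
      unfolding eventually_nhds_metric by (auto simp: dist_commute subset_iff)
  qed
qed

lemma partial_isometry_Banach_Lie_groupoid:
  "real_analytic_Banach_Lie_groupoid (partial_isometry_groupoid :: ('a::unital_cstar_algebra, 'a) groupoid)
     partial_isometry_manifold projection_manifold"
proof -
  let ?G = "partial_isometry_manifold :: ('a, 'a) manifold" and ?M = "projection_manifold :: ('a, 'a) manifold"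
  let ?PI = "partial_isometries :: 'a set" and ?P = "projections :: 'a set"
  let ?C = "composable (partial_isometry_groupoid :: ('a, 'a) groupoid)"
  let ?s = "\<lambda>a::'a. a\<^sup>\<star> * a" and ?t = "\<lambda>a::'a. a * a\<^sup>\<star>"
  note G = embedded_partial_isometry_manifold and M = embedded_projection_manifold
  have topG: "mtop ?G = top_of_set ?PI" and topM: "mtop ?M = top_of_set ?P"
    using G M by (auto simp: embedded_manifold_def)
  have CPI: "?C \<subseteq> ?PI \<times> ?PI"
    by (auto simp: composable_def partial_isometry_groupoid_def)
  have GG: "embedded_manifold (prod_manifold ?G ?G) (?PI \<times> ?PI)"
    by (intro embedded_manifold_prod G)
  have C: "embedded_manifold (submanifold (prod_manifold ?G ?G) ?C) ?C"
    by (rule embedded_manifold_submanifold[OF GG is_submanifold_composable])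
  have groupoid: "is_groupoid (partial_isometry_groupoid :: ('a, 'a) groupoid)"
    by (rule is_groupoid_partial_isometry)
  have maps: "?s \<in> ?PI \<rightarrow> ?P" "?t \<in> ?PI \<rightarrow> ?P" "(\<lambda>p. p) \<in> ?P \<rightarrow> ?PI" "star \<in> ?PI \<rightarrow> ?PI"
    "(\<lambda>(a, b). a * b) \<in> ?C \<rightarrow> ?PI"
    using groupoid by (auto simp: is_groupoid_def partial_isometry_groupoid_def composable_def)
  have s: "real_analytic_map ?G ?M ?s" and t: "real_analytic_map ?G ?M ?t"
    by (intro embedded_real_analytic_map[OF G M] maps ambient_analytic_atI real_analytic_intros)+
  have e: "real_analytic_map ?M ?G (\<lambda>p. p)"
    by (intro embedded_real_analytic_map[OF M G] maps ambient_analytic_atI real_analytic_intros)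
  have i: "real_analytic_map ?G ?G star"
    by (intro embedded_real_analytic_map[OF G G] maps ambient_analytic_atI
        real_analytic_at_bounded_linear bounded_linear_star)
  have mult: "real_analytic_map (submanifold (prod_manifold ?G ?G) ?C) ?G (\<lambda>(a, b). a * b)"
    using real_analytic_at_product
    by (intro embedded_real_analytic_map[OF C G] maps ambient_analytic_atI) (simp add: case_prod_unfold)
  have s_sections: "\<exists>\<sigma>. real_analytic_at UNIV (?s a) \<sigma> \<and> \<sigma> (?s a) = a \<and>
      (\<forall>\<^sub>F q in nhds (?s a). q \<in> ?P \<longrightarrow> \<sigma> q \<in> ?PI \<and> ?s (\<sigma> q) = q)" if "a \<in> ?PI" for a
    using source_section[OF that] by (intro exI[of _ "source_section a"]) (auto elim: eventually_mono)
  have t_sections: "\<exists>\<sigma>. real_analytic_at UNIV (?t a) \<sigma> \<and> \<sigma> (?t a) = a \<and>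
      (\<forall>\<^sub>F q in nhds (?t a). q \<in> ?P \<longrightarrow> \<sigma> q \<in> ?PI \<and> ?t (\<sigma> q) = q)" if "a \<in> ?PI" for a
    using target_section[OF that]
    by (intro exI[of _ "\<lambda>q. (source_section (a\<^sup>\<star>) q)\<^sup>\<star>"]) (auto elim: eventually_mono)
  have "submersion ?G ?M ?s"
    by (rule submersion_of_local_sections[OF G M maps(1) _ s_sections])
       (intro ambient_analytic_atI real_analytic_intros)
  moreover have "open_map (mtop ?G) (mtop ?M) ?s"
    unfolding topG topM by (rule open_map_of_local_sections[OF maps(1) s_sections])
  moreover have "open_map (mtop ?G) (mtop ?M) ?t"
    unfolding topG topM by (rule open_map_of_local_sections[OF maps(2) t_sections])
  moreover have "embedding_map (mtop ?M) (mtop ?G) (\<lambda>p. p)"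
  proof -
    have "?P \<subseteq> ?PI" using maps(3) by auto
    then have "subtopology (top_of_set ?PI) ?P = top_of_set ?P"
      by (simp add: subtopology_subtopology Int_absorb1)
    then show ?thesis
      unfolding topG topM embedding_map_def by (simp add: homeomorphic_map_id[unfolded id_def])
  qed
  moreover have "?s ` ?PI = ?P" "?t ` ?PI = ?P"
  proof -
    have "p = ?s p \<and> p = ?t p \<and> p \<in> ?PI" if "p \<in> ?P" for p
      using that maps(3) by (auto simp: projections_iff)
    then show "?s ` ?PI = ?P" "?t ` ?PI = ?P" using maps(1,2) by blast+
  qed
  moreover have "continuous_map (subtopology (prod_topology (mtop ?G) (mtop ?G)) ?C) (mtop ?G) (\<lambda>(a, b). a * b)"
    using mult by (simp add: real_analytic_map_def submanifold_def prod_manifold_def)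
  moreover have "real_analytic_manifold ?G" "real_analytic_manifold ?M"
    using G M by (auto intro: embedded_manifold_real_analytic)
  ultimately show ?thesis
    using s t e i mult groupoid is_submanifold_composable
    unfolding real_analytic_Banach_Lie_groupoid_def topological_groupoid_def
    by (simp add: partial_isometry_groupoid_def topG topM real_analytic_map_def)
qed

text \<open>
  The target section through \<open>a\<close> has constant source, so it connects \<open>a\<^sup>\<star> a\<close> with all projections
  near \<open>a a\<^sup>\<star>\<close>.
\<close>

lemma partial_isometry_locally_transitive:
  "locally_transitive (partial_isometry_groupoid :: ('a::unital_cstar_algebra, 'a) groupoid)
     (mtop projection_manifold)"
proof -
  let ?G = "partial_isometry_groupoid :: ('a, 'a) groupoid"
  have topM: "mtop (projection_manifold :: ('a, 'a) manifold) = top_of_set projections"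
    using embedded_projection_manifold by (auto simp: embedded_manifold_def)
  have orb: "orbit ?G x = {a * a\<^sup>\<star> | a. a \<in> partial_isometries \<and> a\<^sup>\<star> * a = x}" for x
    by (simp add: orbit_def partial_isometry_groupoid_def)
  have "openin (top_of_set projections) (orbit ?G x)" for x
    unfolding openin_contains_ball
  proof (intro conjI ballI)
    show "orbit ?G x \<subseteq> projections"
      by (auto simp: orb partial_isometries_def)
    fix y assume "y \<in> orbit ?G x"
    then obtain a where a: "a \<in> partial_isometries" "a\<^sup>\<star> * a = x" "y = a * a\<^sup>\<star>"
      by (auto simp: orb)
    have "\<forall>\<^sub>F q in nhds y. q \<in> projections \<longrightarrow> q \<in> orbit ?G x"
      using target_section(3)[OF a(1)] unfolding a(3) orb a(2)
      by eventually_elim (metis (mono_tags, lifting) mem_Collect_eq)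
    then show "\<exists>e>0. ball y e \<inter> projections \<subseteq> orbit ?G x"
      unfolding eventually_nhds_metric by (auto simp: dist_commute subset_iff)
  qed
  then show ?thesis
    by (simp add: locally_transitive_def topM)
qed

section \<open>The unitary group\<close>

lemma isotropy_group_1_eq_unitary_group:
  "isotropy_group (partial_isometry_groupoid :: ('a::unital_cstar_algebra, 'a) groupoid) 1 = unitary_group"
  by (auto simp: isotropy_group_def unitary_group_def partial_isometry_groupoid_def unitaries_def
      partial_isometries_iff)

text \<open>
  For a partial isometry \<open>v\<close> near the unitaries, \<open>1 - v\<^sup>\<star> v\<close> and \<open>1 - v v\<^sup>\<star>\<close> are projections of norm
  less than \<open>1\<close>.
\<close>

lemma openin_unitaries:
  "openin (top_of_set (partial_isometries :: 'a::unital_cstar_algebra set)) unitaries"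
proof -
  let ?O = "{v::'a. norm (1 - v\<^sup>\<star> * v) < 1 \<and> norm (1 - v * v\<^sup>\<star>) < 1}"
  have cont: "continuous_on UNIV (\<lambda>v::'a. norm (1 - v\<^sup>\<star> * v))" "continuous_on UNIV (\<lambda>v::'a. norm (1 - v * v\<^sup>\<star>))"
    by (intro continuous_intros linear_continuous_on bounded_linear_star)+
  have "open ?O"
    by (intro open_Collect_conj open_Collect_less cont continuous_on_const)
  moreover have "unitaries = partial_isometries \<inter> ?O"
  proof
    show "unitaries \<subseteq> partial_isometries \<inter> ?O"
      by (auto simp: unitaries_def partial_isometries_iff)
    show "partial_isometries \<inter> ?O \<subseteq> unitaries"
    proof
      fix v assume v: "v \<in> partial_isometries \<inter> ?O"
      then have "v\<^sup>\<star> * v \<in> projections" "v * v\<^sup>\<star> \<in> projections"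
        by (auto simp: partial_isometries_def)
      then have "1 - v\<^sup>\<star> * v \<in> projections" "1 - v * v\<^sup>\<star> \<in> projections"
        by (simp_all add: projections_iff star_diff left_diff_distrib right_diff_distrib)
      then have "1 - v\<^sup>\<star> * v = 0" "1 - v * v\<^sup>\<star> = 0"
        using v projection_norm_less_1 by blast+
      then show "v \<in> unitaries" by (simp add: unitaries_def)
    qed
  qed
  ultimately show ?thesis by (auto simp: openin_open)
qed

lemma is_submanifold_unitaries:
  "is_submanifold banach_space_manifold (unitaries :: 'a::unital_cstar_algebra set)"
  "is_submanifold partial_isometry_manifold (unitaries :: 'a set)"
  by (rule is_submanifold_openin[OF embedded_manifold_banach_space is_submanifold_partial_isometries openin_unitaries])
     (rule is_submanifold_openin[OF embedded_partial_isometry_manifold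
        is_submanifold_self[OF embedded_partial_isometry_manifold] openin_unitaries])

lemma embedded_unitary_manifold:
  "embedded_manifold (unitary_manifold :: ('a::unital_cstar_algebra, 'a) manifold) unitaries"
  unfolding unitary_manifold_def
  by (rule embedded_manifold_submanifold[OF embedded_manifold_banach_space is_submanifold_unitaries(1)])

lemma unitary_Banach_Lie_group:
  "real_analytic_Banach_Lie_group (unitary_group :: 'a::unital_cstar_algebra monoid) unitary_manifold"
proof -
  let ?U = "unitary_group :: 'a monoid" and ?M = "unitary_manifold :: ('a, 'a) manifold"
  note M = embedded_unitary_manifold
  have closed: "u * v \<in> unitaries" "u\<^sup>\<star> \<in> unitaries" if "u \<in> unitaries" "v \<in> unitaries" for u v :: 'a
  proof -
    have "(u * v)\<^sup>\<star> * (u * v) = v\<^sup>\<star> * (u\<^sup>\<star> * u) * v" "(u * v) * (u * v)\<^sup>\<star> = u * (v * v\<^sup>\<star>) * u\<^sup>\<star>"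
      by (simp_all add: star_mult mult.assoc)
    then show "u * v \<in> unitaries" using that by (simp add: unitaries_def)
    show "u\<^sup>\<star> \<in> unitaries" using that by (simp add: unitaries_def star_star)
  qed
  have "1 \<in> (unitaries :: 'a set)"
    by (simp add: unitaries_def)
  then have grp: "Group.group ?U"
  proof (intro groupI)
    show "\<exists>v\<in>carrier ?U. v \<otimes>\<^bsub>?U\<^esub> u = \<one>\<^bsub>?U\<^esub>" if "u \<in> carrier ?U" for u
      using that closed(2)[of u u] by (intro bexI[of _ "u\<^sup>\<star>"]) (auto simp: unitary_group_def unitaries_def)
  qed (use closed(1) in \<open>auto simp: unitary_group_def mult.assoc\<close>)
  have inv: "m_inv ?U u = u\<^sup>\<star>" if "u \<in> unitaries" for u
    using that closed by (intro group.inv_equality[OF grp]) (auto simp: unitary_group_def unitaries_def)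
  have mult: "real_analytic_map (prod_manifold ?M ?M) ?M (\<lambda>(x, y). x \<otimes>\<^bsub>?U\<^esub> y)"
    using real_analytic_at_product closed
    by (intro embedded_real_analytic_map[OF embedded_manifold_prod[OF M M] M] ambient_analytic_atI)
       (auto simp: case_prod_unfold unitary_group_def)
  have "ambient_analytic_at unitaries (\<lambda>x. m_inv ?U x) x" for x
    unfolding ambient_analytic_at_def using inv
    by (intro exI[of _ star]) (auto intro!: always_eventually real_analytic_at_bounded_linear bounded_linear_star)
  then have "real_analytic_map ?M ?M (\<lambda>x. m_inv ?U x)"
    using inv closed by (intro embedded_real_analytic_map[OF M M]) auto
  with grp mult M show ?thesis
    by (auto simp: real_analytic_Banach_Lie_group_def unitary_group_def embedded_manifold_def
        intro: embedded_manifold_real_analytic[OF M])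
qed

theorem theorem7p6:
  shows "is_submanifold banach_space_manifold (projections :: 'a::unital_cstar_algebra set) \<and>
    is_submanifold banach_space_manifold (partial_isometries :: 'a set) \<and>
    real_analytic_Banach_Lie_groupoid (partial_isometry_groupoid :: ('a, 'a) groupoid)
      partial_isometry_manifold projection_manifold \<and>
    locally_transitive (partial_isometry_groupoid :: ('a, 'a) groupoid) (mtop projection_manifold) \<and>
    isotropy_group (partial_isometry_groupoid :: ('a, 'a) groupoid) 1 = unitary_group \<and>
    is_submanifold banach_space_manifold (unitaries :: 'a set) \<and>
    real_analytic_Banach_Lie_group (unitary_group :: 'a monoid) unitary_manifold \<and>
    is_submanifold partial_isometry_manifold (unitaries :: 'a set) \<and>
    same_analytic_structure unitary_manifold
      (submanifold partial_isometry_manifold (unitaries :: 'a set))"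
  using embedded_manifold_same_analytic_structure[OF embedded_unitary_manifold
      embedded_manifold_submanifold[OF embedded_partial_isometry_manifold is_submanifold_unitaries(2)]]
  by (intro conjI is_submanifold_projections is_submanifold_partial_isometries
      partial_isometry_Banach_Lie_groupoid partial_isometry_locally_transitive
      isotropy_group_1_eq_unitary_group is_submanifold_unitaries unitary_Banach_Lie_group)

end
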